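(* Consider the two-sample setting described in the context, under the null hypothesis that $X^{(0)}$ and $X^{(1)}$ have the same distribution, and let $n_1\to\infty$ with $n_1/n\to 0$, where $n=n_0+n_1$. (1) If $\xi_{0,1}>0$, then $n_1^{1/2}T\xrightarrow{d}N(0,m_1^2\xi_{0,1})$. (2) Suppose $\xi_{0,1}=0$ and $\xi_{0,2}>0$, and at least one of the following holds: (a) $\xi_{1,0}=0$; (b) $n_1^2/n_0\to 0$. Then $$n_1T\xrightarrow{d}\frac{m_1(m_1-1)}{2}\,\eta,\qquad \eta=\sum_{j=1}^\infty\lambda_j(\chi^2_{1j}-1),$$ where the $\chi^2_{1j}$ are independent $\chi^2_1$ random variables and the $\lambda_j$ are the eigenvalues of the integral operator $Ag(x)=\int h_{0,2}(x,y)g(y)\,dF(y)$, with $F$ the distribution of $X^{(1)}$.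
   Context: Observations $X_1^{(0)},\dots,X_{n_0}^{(0)}$ (controls, class $Y=0$) are i.i.d. in $\mathbb{R}^p$, and $X_1^{(1)},\dots,X_{n_1}^{(1)}$ (cases, class $Y=1$) are i.i.d. in $\mathbb{R}^p$; the two samples are independent. Fix integers $m_0,m_1\ge1$. Let $h:(\mathbb{R}^p)^{m_0}\times(\mathbb{R}^p)^{m_1}\to\mathbb{R}$ be a measurable kernel that is symmetric in its first $m_0$ arguments and symmetric in its last $m_1$ arguments, with $\mathrm{E}\,h(X_1^{(0)},\dots,X_{m_0}^{(0)};X_1^{(1)},\dots,X_{m_1}^{(1)})=0$ and finite second moment. Define $$T=\binom{n_0}{m_0}^{-1}\binom{n_1}{m_1}^{-1}\sum h\big(X_{i_1}^{(0)},\dots,X_{i_{m_0}}^{(0)};X_{j_1}^{(1)},\dots,X_{j_{m_1}}^{(1)}\big),$$ the sum running over all $1\le i_1<\dots<i_{m_0}\le n_0$ and all $1\le j_1<\dots<j_{m_1}\le n_1$. For $0\le a\le m_0$, $0\le b\le m_1$ define the projection $$h_{a,b}(x_1,\dots,x_a;y_1,\dots,y_b)=\mathrm{E}\{h(X_1^{(0)},\dots,X_{m_0}^{(0)};X_1^{(1)},\dots,X_{m_1}^{(1)})\mid X_1^{(0)}=x_1,\dots,X_a^{(0)}=x_a,X_1^{(1)}=y_1,\dots,X_b^{(1)}=y_b\},$$ and $\xi_{a,b}=\operatorname{Var}\{h_{a,b}(X_1^{(0)},\dots,X_a^{(0)};X_1^{(1)},\dots,X_b^{(1)})\}$. *)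

theory Defs
  imports "HOL-Probability.Probability"
begin

definition enum_args :: "nat set \<Rightarrow> (nat \<Rightarrow> 'v) \<Rightarrow> (nat \<Rightarrow> 'v)" where
  "enum_args I X = (\<lambda>i. X (sorted_list_of_set I ! i))"

definition ustat :: "nat \<Rightarrow> nat \<Rightarrow> ((nat \<Rightarrow> 'v) \<Rightarrow> (nat \<Rightarrow> 'v) \<Rightarrow> real)
    \<Rightarrow> nat \<Rightarrow> nat \<Rightarrow> (nat \<Rightarrow> 'v) \<Rightarrow> (nat \<Rightarrow> 'v) \<Rightarrow> real" where
  "ustat m0 m1 h n0 n1 X0 X1 =
     inverse (real (n0 choose m0) * real (n1 choose m1)) *
     (\<Sum>I\<in>{I. I \<subseteq> {..<n0} \<and> card I = m0}. \<Sum>J\<in>{J. J \<subseteq> {..<n1} \<and> card J = m1}.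
        h (enum_args I X0) (enum_args J X1))"

text \<open>Projection h_{a,b} under the null hypothesis (both samples with law F):
  the conditional expectation given the first a control and first b case
  arguments, written as integration over the remaining independent arguments.\<close>
definition proj :: "'v measure \<Rightarrow> nat \<Rightarrow> nat \<Rightarrow> ((nat \<Rightarrow> 'v) \<Rightarrow> (nat \<Rightarrow> 'v) \<Rightarrow> real)
    \<Rightarrow> nat \<Rightarrow> nat \<Rightarrow> (nat \<Rightarrow> 'v) \<Rightarrow> (nat \<Rightarrow> 'v) \<Rightarrow> real" where
  "proj F m0 m1 h a b x y =
     (\<integral>z. h (\<lambda>i. if i < a then x i else fst z i) (\<lambda>j. if j < b then y j else snd z j)
        \<partial>(PiM {a..<m0} (\<lambda>_. F) \<Otimes>\<^sub>M PiM {b..<m1} (\<lambda>_. F)))"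

definition xi :: "'v measure \<Rightarrow> nat \<Rightarrow> nat \<Rightarrow> ((nat \<Rightarrow> 'v) \<Rightarrow> (nat \<Rightarrow> 'v) \<Rightarrow> real)
    \<Rightarrow> nat \<Rightarrow> nat \<Rightarrow> real" where
  "xi F m0 m1 h a b =
     (let P = PiM {..<a} (\<lambda>_. F) \<Otimes>\<^sub>M PiM {..<b} (\<lambda>_. F);
          g = (\<lambda>w. proj F m0 m1 h a b (fst w) (snd w))
      in \<integral>w. (g w - (\<integral>w'. g w' \<partial>P))\<^sup>2 \<partial>P)"

definition int_op :: "'v measure \<Rightarrow> ('v \<Rightarrow> 'v \<Rightarrow> real) \<Rightarrow> ('v \<Rightarrow> real) \<Rightarrow> 'v \<Rightarrow> real" where
  "int_op F k g x = (\<integral>y. k x y * g y \<partial>F)"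

definition in_L2 :: "'v measure \<Rightarrow> ('v \<Rightarrow> real) \<Rightarrow> bool" where
  "in_L2 F g \<longleftrightarrow> g \<in> borel_measurable F \<and> integrable F (\<lambda>x. (g x)\<^sup>2)"

text \<open>lam enumerates the (nonzero) eigenvalues of the integral operator with kernel k
  on L2(F), each repeated according to its multiplicity (the dimension of its
  eigenspace); entries equal to 0 are allowed and contribute nothing.\<close>
definition eigen_enum :: "'v measure \<Rightarrow> ('v \<Rightarrow> 'v \<Rightarrow> real) \<Rightarrow> (nat \<Rightarrow> real) \<Rightarrow> bool" where
  "eigen_enum F k lam \<longleftrightarrow>
     (\<exists>\<phi> :: nat \<Rightarrow> 'v \<Rightarrow> real.
        (\<forall>j. lam j \<noteq> 0 \<longrightarrow> in_L2 F (\<phi> j)) \<and>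
        (\<forall>i j. lam i \<noteq> 0 \<longrightarrow> lam j \<noteq> 0 \<longrightarrow>
            (\<integral>x. \<phi> i x * \<phi> j x \<partial>F) = (if i = j then 1 else 0)) \<and>
        (\<forall>j. lam j \<noteq> 0 \<longrightarrow> (AE x in F. int_op F k (\<phi> j) x = lam j * \<phi> j x)) \<and>
        (\<forall>\<mu>. \<mu> \<noteq> 0 \<longrightarrow> finite {j. lam j = \<mu>}) \<and>
        (\<forall>\<mu> g. \<mu> \<noteq> 0 \<longrightarrow> in_L2 F g \<longrightarrow> (AE x in F. int_op F k g x = \<mu> * g x) \<longrightarrow>
            (\<exists>c. AE x in F. g x = (\<Sum>j\<in>{j. lam j = \<mu>}. c j * \<phi> j x))))"

end

theory Submission
  imports Defs
begin

text \<open>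
  All observations are moved to a product space, where conditioning on a set \<open>S\<close> of observations
  means integrating out the coordinates outside \<open>S\<close>.  Subtracting from each summand of \<open>T\<close> its
  conditional expectations given \<open>b\<close> case observations (\<open>b = 1\<close> in part (1), \<open>b = 2\<close> in part (2))
  leaves a remainder whose summands are uncorrelated unless their index sets overlap substantially;
  counting the overlapping pairs shows that the remainder is negligible.  What is left is a sum of
  independent variables in part (1), and in part (2) a degenerate U-statistic of degree two in the
  cases alone.

  For the latter the kernel is expanded in \<open>L\<^sup>2\<close> as \<open>\<Sum>j. \<lambda>\<^sub>j \<phi>\<^sub>j(x) \<phi>\<^sub>j(y)\<close>.  The expansion is complete
  because a nonzero symmetric square-integrable kernel \<open>R\<close> has a nonzero eigenvalue: the iterated
  kernels \<open>R\<^sup>2\<^sup>n\<close>, suitably normalized, converge to a nonzero kernel whose sections are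
  eigenfunctions of \<open>R\<^sup>2\<close>.  A finite part of the expansion is a quadratic form in normalized sums
  \<open>S\<^sub>j\<close>.  Its characteristic function converges, since \<open>exp(i a s\<^sup>2)\<close> is approximated by polynomials
  in \<open>exp(-s\<^sup>2)\<close>, and \<open>exp(-\<Sum>j. a\<^sub>j S\<^sub>j\<^sup>2/2)\<close> is the mean of \<open>exp(i \<Sum>j. \<surd>a\<^sub>j g\<^sub>j S\<^sub>j)\<close> over independent standard
  normal \<open>g\<^sub>j\<close>, so that the one-dimensional central limit theorem applies.
\<close>

section \<open>Square-integrable functions\<close>

text \<open>The conditions on the sample sizes come from the counting. Among all pairs of summands,
  those sharing a control form a fraction O(1/n0) and those sharing more than \<open>b\<close> cases
  a fraction O(\<open>1 / n1 ^ Suc b\<close>). Multiplied by the squared scale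
  \<open>n1 ^ b\<close>, the second is always O(1/n1), while the first is n1/n0 for
  \<open>b = 1\<close> but \<open>n1 ^ 2 / n0\<close> for \<open>b = 2\<close>. Alternative (b)
  makes this small; alternative (a) makes remainder terms sharing one control and no case
  uncorrelated, which leaves \<open>(n1 / n0) ^ 2\<close> and n1/n0. The eigenvalues are only known
  to be square-summable, so their sum may diverge and the terms \<open>(z j)\<^sup>2 - 1\<close>
  cannot be separated in the limit. The series for eta is therefore obtained as an almost sure limit
  through Kolmogorov's maximal inequality, and the kernel expansion is cut off at a finite level
  whose error is bounded uniformly in n: n tends to infinity first, the cut-off level second. Errors
  are needed only in L1, because \<open>iexp\<close> is 1-Lipschitz and weak convergence is read off
  characteristic functions.\<close>

lemma in_L2_measurable[measurable_dest]: "in_L2 M f \<Longrightarrow> f \<in> borel_measurable M"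
  by (simp add: in_L2_def)

lemma in_L2_integrable_square: "in_L2 M f \<Longrightarrow> integrable M (\<lambda>x. (f x)\<^sup>2)"
  by (simp add: in_L2_def)

lemma in_L2_mult_integrable:
  assumes "in_L2 M f" "in_L2 M g"
  shows "integrable M (\<lambda>x. f x * g x)"
proof (rule Bochner_Integration.integrable_bound)
  show "integrable M (\<lambda>x. (f x)\<^sup>2 + (g x)\<^sup>2)"
    using assms by (simp add: in_L2_def)
  show "(\<lambda>x. f x * g x) \<in> borel_measurable M"
    using assms by (auto simp: in_L2_def)
  have "\<bar>a * b\<bar> \<le> a\<^sup>2 + b\<^sup>2" for a b :: real
    using sum_squares_bound[of "\<bar>a\<bar>" "\<bar>b\<bar>"] mult_nonneg_nonneg[of "\<bar>a\<bar>" "\<bar>b\<bar>"]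
    unfolding abs_mult mult.assoc power2_abs by linarith
  then show "AE x in M. norm (f x * g x) \<le> norm ((f x)\<^sup>2 + (g x)\<^sup>2)"
    by simp
qed

lemma in_L2_cmult: "in_L2 M f \<Longrightarrow> in_L2 M (\<lambda>x. c * f x)"
  by (auto simp: in_L2_def power_mult_distrib)

lemma in_L2_add:
  assumes "in_L2 M f" "in_L2 M g"
  shows "in_L2 M (\<lambda>x. f x + g x)"
  using assms in_L2_mult_integrable[OF assms]
  by (auto simp: in_L2_def power2_sum mult.assoc)

lemma in_L2_diff:
  assumes "in_L2 M f" "in_L2 M g"
  shows "in_L2 M (\<lambda>x. f x - g x)"
  using assms in_L2_mult_integrable[OF assms]
  by (auto simp: in_L2_def power2_diff mult.assoc)

lemma in_L2_zero: "in_L2 M (\<lambda>x. 0)"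
  by (simp add: in_L2_def)

lemma in_L2_sum: "(\<And>i. i \<in> I \<Longrightarrow> in_L2 M (f i)) \<Longrightarrow> in_L2 M (\<lambda>x. \<Sum>i\<in>I. f i x)"
  by (induction I rule: infinite_finite_induct) (auto intro!: in_L2_add in_L2_zero)

lemma in_L2_cong_AE:
  assumes "in_L2 M f" "g \<in> borel_measurable M" "AE x in M. f x = g x"
  shows "in_L2 M g"
proof -
  have "integrable M (\<lambda>x. (f x)\<^sup>2) \<longleftrightarrow> integrable M (\<lambda>x. (g x)\<^sup>2)"
    using assms by (intro integrable_cong_AE) (auto simp: in_L2_def)
  then show ?thesis
    using assms by (simp add: in_L2_def)
qed

text \<open>Discriminant argument: the integral of \<open>(t * f x - g x)\<^sup>2\<close> is a
  nonnegative quadratic polynomial in \<open>t\<close>, evaluated at its minimum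
  \<open>t = b / a\<close>.\<close>

lemma in_L2_Cauchy_Schwarz:
  assumes f: "in_L2 M f" and g: "in_L2 M g"
  shows "(\<integral>x. f x * g x \<partial>M)\<^sup>2 \<le> (\<integral>x. (f x)\<^sup>2 \<partial>M) * (\<integral>x. (g x)\<^sup>2 \<partial>M)"
proof -
  define a b c where "a = (\<integral>x. (f x)\<^sup>2 \<partial>M)" and "b = (\<integral>x. f x * g x \<partial>M)"
    and "c = (\<integral>x. (g x)\<^sup>2 \<partial>M)"
  note i = in_L2_mult_integrable[OF f g] in_L2_integrable_square[OF f] in_L2_integrable_square[OF g]
  have quad: "0 \<le> t\<^sup>2 * a - 2 * t * b + c" for t
  proof -
    have "0 \<le> (\<integral>x. (t * f x - g x)\<^sup>2 \<partial>M)"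
      by simp
    also have "(\<lambda>x. (t * f x - g x)\<^sup>2) = (\<lambda>x. t\<^sup>2 * (f x)\<^sup>2 - 2 * t * (f x * g x) + (g x)\<^sup>2)"
      by (auto simp: power2_diff power_mult_distrib)
    also have "(\<integral>x. (t\<^sup>2 * (f x)\<^sup>2 - 2 * t * (f x * g x) + (g x)\<^sup>2) \<partial>M) = t\<^sup>2 * a - 2 * t * b + c"
      using i by (simp add: a_def b_def c_def)
    finally show ?thesis .
  qed
  have "a \<ge> 0" "c \<ge> 0" by (simp_all add: a_def c_def)
  show ?thesis
  proof (cases "a = 0")
    case True
    have "b = 0"
    proof (rule ccontr)
      assume "b \<noteq> 0"
      \<comment> \<open>For \<open>a = 0\<close> the polynomial is affine in \<open>t\<close>, and
        this \<open>t\<close> gives it the value -1.\<close>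
      with quad[of "(c + 1) / (2 * b)"] True show False by simp
    qed
    then show ?thesis using \<open>a \<ge> 0\<close> \<open>c \<ge> 0\<close> by (simp flip: a_def b_def c_def)
  next
    case False
    with \<open>a \<ge> 0\<close> quad[of "b / a"] have "b\<^sup>2 \<le> a * c"
      by (simp add: field_simps power2_eq_square)
    then show ?thesis by (simp add: a_def b_def c_def)
  qed
qed

lemma in_L2_abs_integral_le:
  assumes "in_L2 M f" "in_L2 M g"
  shows "\<bar>\<integral>x. f x * g x \<partial>M\<bar> \<le> sqrt (\<integral>x. (f x)\<^sup>2 \<partial>M) * sqrt (\<integral>x. (g x)\<^sup>2 \<partial>M)"
  using real_sqrt_le_mono[OF in_L2_Cauchy_Schwarz[OF assms]] by (simp add: real_sqrt_mult)

lemma (in prob_space) in_L2_const: "in_L2 M (\<lambda>x. c)"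
  by (simp add: in_L2_def)

lemma (in prob_space) in_L2_integrable: "in_L2 M f \<Longrightarrow> integrable M f"
  using in_L2_mult_integrable[of M f "\<lambda>_. 1"] in_L2_const by simp

lemma in_L2_abs: "in_L2 M f \<Longrightarrow> in_L2 M (\<lambda>x. \<bar>f x\<bar>)"
  by (auto simp: in_L2_def)

lemma (in prob_space) square_integral_le:
  assumes "in_L2 M f"
  shows "(\<integral>x. f x \<partial>M)\<^sup>2 \<le> (\<integral>x. (f x)\<^sup>2 \<partial>M)"
  using in_L2_Cauchy_Schwarz[OF assms in_L2_const[of 1]] by (simp add: prob_space)

lemma (in prob_space) L1_norm_le_L2_norm:
  assumes "in_L2 M f"
  shows "(\<integral>x. \<bar>f x\<bar> \<partial>M) \<le> sqrt (\<integral>x. (f x)\<^sup>2 \<partial>M)"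
  using square_integral_le[OF in_L2_abs[OF assms]] by (intro real_le_rsqrt) simp

lemma integral_square_sum_le:
  assumes "in_L2 M f" "in_L2 M g"
  shows "(\<integral>x. (f x + g x)\<^sup>2 \<partial>M) \<le> 2 * (\<integral>x. (f x)\<^sup>2 \<partial>M) + 2 * (\<integral>x. (g x)\<^sup>2 \<partial>M)"
proof -
  have "(\<integral>x. (f x + g x)\<^sup>2 \<partial>M) \<le> (\<integral>x. 2 * (f x)\<^sup>2 + 2 * (g x)\<^sup>2 \<partial>M)"
  proof (rule integral_mono)
    show "(f x + g x)\<^sup>2 \<le> 2 * (f x)\<^sup>2 + 2 * (g x)\<^sup>2" for x
      using sum_squares_bound[of "f x" "g x"] by (simp add: power2_sum)
  qed (use assms in_L2_add[OF assms] in \<open>auto simp: in_L2_def\<close>)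
  also have "\<dots> = 2 * (\<integral>x. (f x)\<^sup>2 \<partial>M) + 2 * (\<integral>x. (g x)\<^sup>2 \<partial>M)"
    using assms by (simp add: in_L2_def)
  finally show ?thesis .
qed

text \<open>Riesz-Fischer: a fast subsequence converges almost everywhere, and Fatou's lemma carries
  the Cauchy bounds of the whole sequence over to its limit.\<close>

lemma (in prob_space) L2_complete:
  fixes f :: "nat \<Rightarrow> 'a \<Rightarrow> real"
  assumes f: "\<And>n. in_L2 M (f n)"
    and Cauchy: "\<And>e. e > 0 \<Longrightarrow> \<exists>N. \<forall>m\<ge>N. \<forall>n\<ge>N. (\<integral>x. (f m x - f n x)\<^sup>2 \<partial>M) < e"
  obtains g where "in_L2 M g" "(\<lambda>n. \<integral>x. (f n x - g x)\<^sup>2 \<partial>M) \<longlonglongrightarrow> 0"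
proof -
  have [measurable]: "f n \<in> borel_measurable M" for n
    using f by (simp add: in_L2_def)
  have "\<exists>N. \<forall>j. \<forall>m\<ge>N j. \<forall>n\<ge>N j. (\<integral>x. (f m x - f n x)\<^sup>2 \<partial>M) < (1/4)^j"
    by (intro choice allI Cauchy) simp
  then obtain N where N: "\<And>j m n. m \<ge> N j \<Longrightarrow> n \<ge> N j \<Longrightarrow> (\<integral>x. (f m x - f n x)\<^sup>2 \<partial>M) < (1/4)^j"
    by blast
  \<comment> \<open>The sum puts both \<open>r j\<close> and \<open>r (Suc j)\<close> beyond
    \<open>N j\<close>; the extra \<open>j\<close> makes the indices unbounded. The bound
    \<open>(1/4)^j\<close> becomes the summable \<open>(1/2)^j\<close> after the square
    root.\<close>
  define r where "r j = j + (\<Sum>i\<le>j. N i)" for j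
  have r: "r j \<ge> N j" "r (Suc j) \<ge> N j" "r j \<ge> j" for j
    using member_le_sum[of j "{..j}" N] by (auto simp: r_def)
  define u where "u j = f (r j)" for j
  have [measurable]: "u j \<in> borel_measurable M" for j by (simp add: u_def)
  have u_L2: "in_L2 M (u j)" for j by (simp add: u_def f)
  have step: "(\<integral>x. \<bar>u (Suc j) x - u j x\<bar> \<partial>M) \<le> (1/2)^j" for j
  proof -
    have "(\<integral>x. \<bar>u (Suc j) x - u j x\<bar> \<partial>M) \<le> sqrt (\<integral>x. (u (Suc j) x - u j x)\<^sup>2 \<partial>M)"
      by (intro L1_norm_le_L2_norm in_L2_diff u_L2)
    also have "\<dots> \<le> sqrt ((1/4)^j)"
      unfolding u_def by (intro real_sqrt_le_mono less_imp_le N r)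
    also have "\<dots> = (1/2)^j"
      by (simp add: real_sqrt_power real_sqrt_divide)
    finally show ?thesis .
  qed
  have "(\<integral>\<^sup>+x. (\<Sum>j. ennreal \<bar>u (Suc j) x - u j x\<bar>) \<partial>M) = (\<Sum>j. \<integral>\<^sup>+x. ennreal \<bar>u (Suc j) x - u j x\<bar> \<partial>M)"
    by (intro nn_integral_suminf) simp
  also have "\<dots> \<le> (\<Sum>j. ennreal ((1/2)^j))"
  proof (intro suminf_le summableI)
    fix j
    have "(\<integral>\<^sup>+x. ennreal \<bar>u (Suc j) x - u j x\<bar> \<partial>M) = ennreal (\<integral>x. \<bar>u (Suc j) x - u j x\<bar> \<partial>M)"
      by (intro nn_integral_eq_integral integrable_abs in_L2_integrable in_L2_diff u_L2) simp
    then show "(\<integral>\<^sup>+x. ennreal \<bar>u (Suc j) x - u j x\<bar> \<partial>M) \<le> ennreal ((1/2)^j)"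
      using step[of j] by (simp add: ennreal_leI)
  qed
  also have "\<dots> = ennreal (\<Sum>j. (1/2)^j)"
    by (intro suminf_ennreal2) (auto intro: summable_geometric)
  finally have "(\<integral>\<^sup>+x. (\<Sum>j. ennreal \<bar>u (Suc j) x - u j x\<bar>) \<partial>M) \<noteq> \<infinity>"
    by (auto simp: top_unique)
  then have "AE x in M. (\<Sum>j. ennreal \<bar>u (Suc j) x - u j x\<bar>) \<noteq> \<infinity>"
    by (intro nn_integral_PInf_AE) auto
  then have conv: "AE x in M. (\<lambda>j. u j x) \<longlonglongrightarrow> lim (\<lambda>j. u j x)"
  proof eventually_elim
    case (elim x)
    then have "summable (\<lambda>j. \<bar>u (Suc j) x - u j x\<bar>)"
      by (intro summable_suminf_not_top) auto
    then have "summable (\<lambda>j. u (Suc j) x - u j x)"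
      by (rule summable_rabs_cancel)
    then have "convergent (\<lambda>n. u n x - u 0 x)"
      by (simp add: summable_iff_convergent sum_lessThan_telescope[of "\<lambda>j. u j x"])
    from convergent_add[OF this convergent_const[of "u 0 x"]] show ?case
      by (simp add: convergent_LIMSEQ_iff)
  qed
  define g where "g x = lim (\<lambda>j. u j x)" for x
  have [measurable]: "g \<in> borel_measurable M" unfolding g_def by measurable
  \<comment> \<open>One application of Fatou gives both the integrability of the difference, hence
    that of \<open>g\<close>, and the rate of convergence.\<close>
  have bound: "in_L2 M (\<lambda>x. f n x - g x) \<and> (\<integral>x. (f n x - g x)\<^sup>2 \<partial>M) \<le> e"
    if e: "e > 0" and K: "\<And>m n. m \<ge> K \<Longrightarrow> n \<ge> K \<Longrightarrow> (\<integral>x. (f m x - f n x)\<^sup>2 \<partial>M) < e"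
      and n: "n \<ge> K" for e n K
  proof -
    have "(\<integral>\<^sup>+x. ennreal ((f n x - g x)\<^sup>2) \<partial>M) = (\<integral>\<^sup>+x. liminf (\<lambda>j. ennreal ((f n x - u j x)\<^sup>2)) \<partial>M)"
    proof (rule nn_integral_cong_AE, use conv in eventually_elim)
      case (elim x)
      then have "(\<lambda>j. ennreal ((f n x - u j x)\<^sup>2)) \<longlonglongrightarrow> ennreal ((f n x - g x)\<^sup>2)"
        unfolding g_def by (intro tendsto_intros tendsto_ennrealI)
      then show ?case
        by (intro lim_imp_Liminf[symmetric]) auto
    qed
    also have "\<dots> \<le> liminf (\<lambda>j. \<integral>\<^sup>+x. ennreal ((f n x - u j x)\<^sup>2) \<partial>M)"
      by (intro nn_integral_liminf) measurable
    also have "\<dots> \<le> ennreal e"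
    proof -
      have "eventually (\<lambda>j. (\<integral>\<^sup>+x. ennreal ((f n x - u j x)\<^sup>2) \<partial>M) \<le> ennreal e) sequentially"
        using eventually_ge_at_top[of K]
      proof eventually_elim
        case (elim j)
        have "(\<integral>\<^sup>+x. ennreal ((f n x - u j x)\<^sup>2) \<partial>M) = ennreal (\<integral>x. (f n x - u j x)\<^sup>2 \<partial>M)"
          by (intro nn_integral_eq_integral in_L2_integrable_square in_L2_diff f u_L2) simp
        also have "\<dots> \<le> ennreal e"
          using K[of n "r j"] n elim r(3)[of j] by (intro ennreal_leI) (simp add: u_def)
        finally show ?case .
      qed
      then show ?thesis
        by (intro order_trans[OF Liminf_le_Limsup] Limsup_bounded) auto
    qed
    finally have le: "(\<integral>\<^sup>+x. ennreal ((f n x - g x)\<^sup>2) \<partial>M) \<le> ennreal e" .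
    then have "integrable M (\<lambda>x. (f n x - g x)\<^sup>2)"
      by (intro integrableI_bounded) (auto simp: top_unique less_top[symmetric])
    moreover from this le e have "(\<integral>x. (f n x - g x)\<^sup>2 \<partial>M) \<le> e"
      by (subst (asm) nn_integral_eq_integral) (auto simp: ennreal_le_iff)
    ultimately show ?thesis
      by (simp add: in_L2_def)
  qed
  have "in_L2 M g"
  proof -
    from Cauchy[of 1] obtain K where "\<And>m n. m \<ge> K \<Longrightarrow> n \<ge> K \<Longrightarrow> (\<integral>x. (f m x - f n x)\<^sup>2 \<partial>M) < 1"
      by auto
    with bound[of 1 K K] have "in_L2 M (\<lambda>x. f K x - g x)" by auto
    from in_L2_diff[OF f this, of K] show ?thesis by simp
  qed
  moreover have "(\<lambda>n. \<integral>x. (f n x - g x)\<^sup>2 \<partial>M) \<longlonglongrightarrow> 0"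
  proof (rule LIMSEQ_I)
    fix e :: real assume "e > 0"
    with Cauchy[of "e/2"] obtain K where "\<And>m n. m \<ge> K \<Longrightarrow> n \<ge> K \<Longrightarrow> (\<integral>x. (f m x - f n x)\<^sup>2 \<partial>M) < e/2"
      by auto
    with bound[of "e/2" K] \<open>e > 0\<close> show "\<exists>K. \<forall>n\<ge>K. norm ((\<integral>x. (f n x - g x)\<^sup>2 \<partial>M) - 0) < e"
      by (intro exI[of _ K]) force
  qed
  ultimately show ?thesis by (rule that)
qed

lemma L2_tendsto_inner:
  assumes f: "\<And>n. in_L2 M (f n)" and g: "in_L2 M g" and h: "in_L2 M h"
    and lim: "(\<lambda>n. \<integral>x. (f n x - g x)\<^sup>2 \<partial>M) \<longlonglongrightarrow> 0"
  shows "(\<lambda>n. \<integral>x. f n x * h x \<partial>M) \<longlonglongrightarrow> (\<integral>x. g x * h x \<partial>M)"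
proof (rule LIM_zero_cancel, rule Lim_null_comparison)
  show "\<forall>\<^sub>F n in sequentially. norm ((\<integral>x. f n x * h x \<partial>M) - (\<integral>x. g x * h x \<partial>M))
      \<le> sqrt (\<integral>x. (f n x - g x)\<^sup>2 \<partial>M) * sqrt (\<integral>x. (h x)\<^sup>2 \<partial>M)"
  proof (rule always_eventually, rule allI)
    fix n
    have "(\<integral>x. f n x * h x \<partial>M) - (\<integral>x. g x * h x \<partial>M) = (\<integral>x. (f n x - g x) * h x \<partial>M)"
      using in_L2_mult_integrable[OF f h, of n] in_L2_mult_integrable[OF g h]
      by (simp add: left_diff_distrib)
    then show "norm ((\<integral>x. f n x * h x \<partial>M) - (\<integral>x. g x * h x \<partial>M))
      \<le> sqrt (\<integral>x. (f n x - g x)\<^sup>2 \<partial>M) * sqrt (\<integral>x. (h x)\<^sup>2 \<partial>M)"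
      using in_L2_abs_integral_le[OF in_L2_diff[OF f g] h] by simp
  qed
  show "(\<lambda>n. sqrt (\<integral>x. (f n x - g x)\<^sup>2 \<partial>M) * sqrt (\<integral>x. (h x)\<^sup>2 \<partial>M)) \<longlonglongrightarrow> 0"
    by (intro tendsto_mult_left_zero) (use tendsto_real_sqrt[OF lim] in simp)
qed

lemma AE_zero_of_L2_norm_zero:
  assumes "in_L2 M f" "(\<integral>x. (f x)\<^sup>2 \<partial>M) = 0"
  shows "AE x in M. f x = 0"
  using assms integral_nonneg_eq_0_iff_AE[OF in_L2_integrable_square[OF assms(1)]] by auto

section \<open>Independent copies and conditional expectations\<close>

text \<open>With \<open>z\<close> an independent copy of \<open>x\<close>, averaging over
  \<open>z\<close> is conditioning on the coordinates in \<open>S\<close>.\<close>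

definition mix :: "'i set \<Rightarrow> ('i \<Rightarrow> 'v) \<Rightarrow> ('i \<Rightarrow> 'v) \<Rightarrow> 'i \<Rightarrow> 'v" where
  "mix S x z = (\<lambda>s. if s \<in> S then x s else z s)"

text \<open>Plays the part of measurability with respect to the coordinates in \<open>A\<close>. It
  is a pointwise condition on all functions, even those outside the space of the measure, so no null
  sets arise.\<close>

definition depends_on :: "'i set \<Rightarrow> (('i \<Rightarrow> 'v) \<Rightarrow> 'b) \<Rightarrow> bool" where
  "depends_on A f \<longleftrightarrow> (\<forall>x y. (\<forall>s\<in>A. x s = y s) \<longrightarrow> f x = f y)"

lemma depends_onD: "depends_on A f \<Longrightarrow> (\<And>s. s \<in> A \<Longrightarrow> x s = y s) \<Longrightarrow> f x = f y"
  by (auto simp: depends_on_def)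

lemma depends_on_mono: "depends_on A f \<Longrightarrow> A \<subseteq> B \<Longrightarrow> depends_on B f"
  by (auto simp: depends_on_def subset_iff)

locale iid_space = prob_space F for F :: "'v measure" +
  fixes Q :: "('i \<Rightarrow> 'v) measure"
  defines "Q \<equiv> PiM UNIV (\<lambda>_. F)"
begin

sublocale P: product_prob_space "\<lambda>_::'i. F" UNIV
  by (intro product_prob_spaceI prob_space_axioms)

sublocale Q: prob_space Q
  unfolding Q_def by (rule P.prob_space_axioms)

sublocale QQ: pair_prob_space Q Q ..

lemma component_measurable[measurable]: "(\<lambda>x. x i) \<in> measurable Q F"
  unfolding Q_def by measurable

lemma measurable_Q_iff: "f \<in> measurable N Q \<longleftrightarrow> (\<forall>i. (\<lambda>x. f x i) \<in> measurable N F)"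
proof safe
  show "f \<in> measurable N Q" if "\<forall>i. (\<lambda>x. f x i) \<in> measurable N F"
    unfolding Q_def using that measurable_space[of "\<lambda>x. f x _" N F]
    by (intro measurable_PiM_single') auto
qed (rule measurable_compose[OF _ component_measurable])

lemma mix_measurable[measurable]:
  assumes [measurable]: "f \<in> measurable N Q" "g \<in> measurable N Q"
  shows "(\<lambda>w. mix S (f w) (g w)) \<in> measurable N Q"
proof -
  have [measurable]: "(\<lambda>x. f x i) \<in> measurable N F" "(\<lambda>x. g x i) \<in> measurable N F" for i
    using assms by (auto simp: measurable_Q_iff)
  show ?thesis unfolding measurable_Q_iff mix_def by auto
qed

text \<open>A cylinder over \<open>J\<close> pulls back to a rectangle, with a cylinder over
  \<open>J \<inter> S\<close> in the first copy and one over \<open>J - S\<close> in the second; the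
  products of probabilities recombine.\<close>

lemma distr_mix: "distr (Q \<Otimes>\<^sub>M Q) Q (\<lambda>w. mix S (fst w) (snd w)) = Q"
proof -
  have "distr (Q \<Otimes>\<^sub>M Q) (PiM UNIV (\<lambda>_. F)) (\<lambda>w. mix S (fst w) (snd w)) = PiM UNIV (\<lambda>_. F)"
  proof (rule P.PiM_eq)
    fix J :: "'i set" and A assume J: "finite J" and A: "\<And>j. j \<in> J \<Longrightarrow> A j \<in> sets F"
    have [measurable]: "prod_emb UNIV (\<lambda>_. F) J (Pi\<^sub>E J A) \<in> sets Q"
      unfolding Q_def using J A by (intro sets_PiM_I) auto
    have m: "(\<lambda>w. mix S (fst w) (snd w)) \<in> measurable (Q \<Otimes>\<^sub>M Q) Q"
      by measurable
    let ?E = "\<lambda>K. prod_emb UNIV (\<lambda>_. F) K (Pi\<^sub>E K A)"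
    have E: "?E K = {x \<in> space Q. \<forall>i\<in>K. x i \<in> A i}" for K
      by (auto simp: prod_emb_def Q_def space_PiM)
    have "emeasure (distr (Q \<Otimes>\<^sub>M Q) Q (\<lambda>w. mix S (fst w) (snd w))) (?E J) =
       emeasure (Q \<Otimes>\<^sub>M Q) ((\<lambda>w. mix S (fst w) (snd w)) -` (?E J) \<inter> space (Q \<Otimes>\<^sub>M Q))"
      by (intro emeasure_distr m) simp
    also have "(\<lambda>w. mix S (fst w) (snd w)) -` (?E J) \<inter> space (Q \<Otimes>\<^sub>M Q) = ?E (J \<inter> S) \<times> ?E (J - S)"
      using measurable_space[OF m]
      by (auto simp: E space_pair_measure mix_def)
    also have "emeasure (Q \<Otimes>\<^sub>M Q) \<dots> = emeasure Q (?E (J \<inter> S)) * emeasure Q (?E (J - S))"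
      unfolding Q_def using J A by (intro Q.emeasure_pair_measure_Times[unfolded Q_def] sets_PiM_I) auto
    also have "\<dots> = (\<Prod>j\<in>J \<inter> S. emeasure F (A j)) * (\<Prod>j\<in>J - S. emeasure F (A j))"
      unfolding Q_def using J A by (subst (1 2) P.emeasure_PiM_emb) auto
    also have "\<dots> = (\<Prod>j\<in>(J \<inter> S) \<union> (J - S). emeasure F (A j))"
      using J by (intro prod.union_disjoint[symmetric]) auto
    also have "(J \<inter> S) \<union> (J - S) = J" by auto
    finally show "emeasure (distr (Q \<Otimes>\<^sub>M Q) (PiM UNIV (\<lambda>_. F)) (\<lambda>w. mix S (fst w) (snd w))) (?E J) = (\<Prod>j\<in>J. emeasure F (A j))"
      by (simp add: Q_def)
  qed simp
  then show ?thesis by (simp add: Q_def)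
qed

lemma distr_reindex:
  assumes "inj \<sigma>"
  shows "distr Q Q (\<lambda>x. x \<circ> \<sigma>) = Q"
  using distr_PiM_reindex[of UNIV "\<lambda>_. F" \<sigma> UNIV] assms prob_space_axioms
  by (simp add: Q_def comp_def restrict_UNIV)

lemma reindex_measurable[measurable]: "(\<lambda>x. x \<circ> \<sigma>) \<in> measurable Q Q"
  by (auto simp: measurable_Q_iff)

lemma integral_reindex:
  fixes f :: "_ \<Rightarrow> real"
  assumes "inj \<sigma>" "f \<in> borel_measurable Q"
  shows "(\<integral>x. f (x \<circ> \<sigma>) \<partial>Q) = (\<integral>x. f x \<partial>Q)"
  using integral_distr[OF reindex_measurable assms(2), of \<sigma>] distr_reindex[OF assms(1)] by simp

lemma in_L2_reindex:
  assumes "inj \<sigma>" "in_L2 Q f"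
  shows "in_L2 Q (\<lambda>x. f (x \<circ> \<sigma>))"
proof -
  have [measurable]: "f \<in> borel_measurable Q" using assms by (simp add: in_L2_def)
  then show ?thesis
    using assms(2) integrable_distr_eq[OF reindex_measurable, of "\<lambda>x. (f x)\<^sup>2" \<sigma>] distr_reindex[OF assms(1)]
    by (simp add: in_L2_def)
qed

lemma AE_reindex:
  assumes "inj \<sigma>" "AE x in Q. P x"
  shows "AE x in Q. P (x \<circ> \<sigma>)"
  by (rule AE_distrD[OF reindex_measurable, of P \<sigma>]) (subst distr_reindex[OF assms(1)], rule assms(2))

lemma distr_component: "distr Q F (\<lambda>x. x i) = F"
  unfolding Q_def by (rule P.PiM_component) simp

lemma integrable_component:
  fixes f :: "_ \<Rightarrow> real"
  shows "integrable F f \<Longrightarrow> integrable Q (\<lambda>x. f (x i))"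
  using integrable_distr[OF component_measurable, of i f] by (simp add: distr_component)

lemma integral_component:
  fixes f :: "_ \<Rightarrow> real"
  assumes "f \<in> borel_measurable F"
  shows "(\<integral>x. f (x i) \<partial>Q) = (\<integral>x. f x \<partial>F)"
  using integral_distr[OF component_measurable assms, of i] by (simp add: distr_component)

lemma in_L2_component: "in_L2 F f \<Longrightarrow> in_L2 Q (\<lambda>x. f (x i))"
  using integrable_component[of "\<lambda>x. (f x)\<^sup>2"] by (auto simp: in_L2_def)

lemma AE_component: "AE x in F. P x \<Longrightarrow> AE x in Q. P (x i)"
  by (rule AE_distrD[OF component_measurable, of P i]) (subst distr_component)

lemma distr_component_pair:
  assumes "i \<noteq> j"
  shows "distr Q (F \<Otimes>\<^sub>M F) (\<lambda>x. (x i, x j)) = F \<Otimes>\<^sub>M F"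
proof -
  interpret FF: pair_prob_space F F ..
  have "F \<Otimes>\<^sub>M F = distr Q (F \<Otimes>\<^sub>M F) (\<lambda>x. (x i, x j))"
  proof (rule pair_measure_eqI)
    fix A B assume AB[measurable]: "A \<in> sets F" "B \<in> sets F"
    have "emeasure (distr Q (F \<Otimes>\<^sub>M F) (\<lambda>x. (x i, x j))) (A \<times> B) =
        emeasure Q ((\<lambda>x. (x i, x j)) -` (A \<times> B) \<inter> space Q)"
      by (intro emeasure_distr) auto
    also have "(\<lambda>x. (x i, x j)) -` (A \<times> B) \<inter> space Q = prod_emb UNIV (\<lambda>_. F) {i, j} (Pi\<^sub>E {i,j} (\<lambda>k. if k = i then A else B))"
      using assms by (auto simp: prod_emb_def Q_def space_PiM PiE_iff split: if_splits)
    also have "emeasure Q \<dots> = (\<Prod>k\<in>{i,j}. emeasure F (if k = i then A else B))"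
      unfolding Q_def by (intro P.emeasure_PiM_emb) auto
    also have "\<dots> = emeasure F A * emeasure F B"
      using assms by simp
    finally show "emeasure F A * emeasure F B = emeasure (distr Q (F \<Otimes>\<^sub>M F) (\<lambda>x. (x i, x j))) (A \<times> B)"
      by simp
  qed (auto intro: sigma_finite_measure_axioms)
  then show ?thesis by simp
qed

lemma pair_component_measurable: "(\<lambda>x. (x i, x j)) \<in> measurable Q (F \<Otimes>\<^sub>M F)"
  by measurable

lemma in_L2_component_pair:
  assumes "i \<noteq> j" "in_L2 (F \<Otimes>\<^sub>M F) f"
  shows "in_L2 Q (\<lambda>x. f (x i, x j))"
proof -
  have [measurable]: "f \<in> borel_measurable (F \<Otimes>\<^sub>M F)" using assms by (simp add: in_L2_def)
  then show ?thesis
    using assms integrable_distr[OF pair_component_measurable, of i j "\<lambda>x. (f x)\<^sup>2"]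
    by (auto simp: in_L2_def distr_component_pair)
qed

lemma integral_component_pair:
  fixes f :: "_ \<Rightarrow> real"
  assumes "i \<noteq> j" "f \<in> borel_measurable (F \<Otimes>\<^sub>M F)"
  shows "(\<integral>x. f (x i, x j) \<partial>Q) = (\<integral>w. f w \<partial>(F \<Otimes>\<^sub>M F))"
  using integral_distr[OF pair_component_measurable assms(2), of i j] assms(1) 
  by (simp add: distr_component_pair)

text \<open>The conditional expectation given the coordinates in \<open>S\<close>.\<close>

definition cexp :: "'i set \<Rightarrow> (('i \<Rightarrow> 'v) \<Rightarrow> real) \<Rightarrow> ('i \<Rightarrow> 'v) \<Rightarrow> real" where
  "cexp S f x = (\<integral>z. f (mix S x z) \<partial>Q)"

lemma cexp_measurable[measurable]:
  assumes [measurable]: "f \<in> borel_measurable Q"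
  shows "cexp S f \<in> borel_measurable Q"
  unfolding cexp_def[abs_def] by measurable

lemma integrable_mix:
  fixes f :: "_ \<Rightarrow> real"
  assumes "integrable Q f"
  shows "integrable (Q \<Otimes>\<^sub>M Q) (\<lambda>w. f (mix S (fst w) (snd w)))"
  using assms distr_mix[of S] integrable_distr[of "\<lambda>w. mix S (fst w) (snd w)" "Q \<Otimes>\<^sub>M Q" Q f] by simp

lemma integral_mix:
  fixes f :: "_ \<Rightarrow> real"
  assumes "f \<in> borel_measurable Q"
  shows "(\<integral>w. f (mix S (fst w) (snd w)) \<partial>(Q \<Otimes>\<^sub>M Q)) = (\<integral>x. f x \<partial>Q)"
  using integral_distr[of "\<lambda>w. mix S (fst w) (snd w)" "Q \<Otimes>\<^sub>M Q" Q f] assms distr_mix[of S] by simp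

lemma AE_integrable_mix:
  fixes f :: "_ \<Rightarrow> real"
  assumes "integrable Q f"
  shows "AE x in Q. integrable Q (\<lambda>z. f (mix S x z))"
  using QQ.AE_integrable_fst'[OF integrable_mix[OF assms, of S]] by simp

lemma integral_cexp:
  assumes "integrable Q f"
  shows "(\<integral>x. cexp S f x \<partial>Q) = (\<integral>x. f x \<partial>Q)"
proof -
  have "(\<integral>x. cexp S f x \<partial>Q) = (\<integral>w. f (mix S (fst w) (snd w)) \<partial>(Q \<Otimes>\<^sub>M Q))"
    unfolding cexp_def using QQ.integral_fst'[OF integrable_mix[OF assms, of S]] by simp
  then show ?thesis using assms by (simp add: integral_mix)
qed

lemma integrable_cexp:
  assumes "integrable Q f"
  shows "integrable Q (cexp S f)"
  using QQ.integrable_fst'[OF integrable_mix[OF assms, of S]] by (simp add: cexp_def[abs_def])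

text \<open>Conditional Jensen, applied in each fibre of the product and then integrated.\<close>

lemma cexp_L2:
  assumes f: "in_L2 Q f"
  shows "in_L2 Q (cexp S f)" and "(\<integral>x. (cexp S f x)\<^sup>2 \<partial>Q) \<le> (\<integral>x. (f x)\<^sup>2 \<partial>Q)"
proof -
  note [measurable] = in_L2_measurable[OF f]
  have int: "integrable Q (\<lambda>x. (f x)\<^sup>2)" using f by (simp add: in_L2_def)
  have AE: "AE x in Q. (cexp S f x)\<^sup>2 \<le> cexp S (\<lambda>x. (f x)\<^sup>2) x"
    using AE_integrable_mix[OF int, of S] AE_space
  proof eventually_elim
    case (elim x)
    have "(\<lambda>z. f (mix S x z)) \<in> borel_measurable Q" using elim(2) by measurable
    with elim have "in_L2 Q (\<lambda>z. f (mix S x z))"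
      by (simp add: in_L2_def)
    from Q.square_integral_le[OF this] show ?case by (simp add: cexp_def)
  qed
  have i: "integrable Q (\<lambda>x. (cexp S f x)\<^sup>2)"
  proof (rule Bochner_Integration.integrable_bound[OF integrable_cexp[OF int, of S]])
    show "AE x in Q. norm ((cexp S f x)\<^sup>2) \<le> norm (cexp S (\<lambda>x. (f x)\<^sup>2) x)"
      using AE by eventually_elim auto
  qed measurable
  then show "in_L2 Q (cexp S f)" by (simp add: in_L2_def)
  have "(\<integral>x. (cexp S f x)\<^sup>2 \<partial>Q) \<le> (\<integral>x. cexp S (\<lambda>x. (f x)\<^sup>2) x \<partial>Q)"
    by (intro integral_mono_AE i integrable_cexp int AE)
  then show "(\<integral>x. (cexp S f x)\<^sup>2 \<partial>Q) \<le> (\<integral>x. (f x)\<^sup>2 \<partial>Q)"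
    by (simp add: integral_cexp int)
qed

lemma cexp_diff:
  assumes "integrable Q f" "integrable Q g"
  shows "AE x in Q. cexp S (\<lambda>x. f x - g x) x = cexp S f x - cexp S g x"
  using AE_integrable_mix[OF assms(1), of S] AE_integrable_mix[OF assms(2), of S]
  by eventually_elim (simp add: cexp_def)

lemma cexp_sum:
  assumes "finite I" "\<And>i. i \<in> I \<Longrightarrow> integrable Q (f i)"
  shows "AE x in Q. cexp S (\<lambda>x. \<Sum>i\<in>I. f i x) x = (\<Sum>i\<in>I. cexp S (f i) x)"
proof -
  have "AE x in Q. \<forall>i\<in>I. integrable Q (\<lambda>z. f i (mix S x z))"
    using assms by (intro AE_finite_allI AE_integrable_mix)
  then show ?thesis
    by eventually_elim (simp add: cexp_def)
qed

text \<open>Independence of the coordinates gives more than the tower property: \<open>S\<close> and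
  \<open>T\<close> need not be nested. Fubini needs an integrable section, hence the exceptional
  null set.\<close>

lemma cexp_cexp:
  assumes "integrable Q f"
  shows "AE x in Q. cexp S (cexp T f) x = cexp (S \<inter> T) f x"
  using AE_integrable_mix[OF assms, of "S \<inter> T"]
proof eventually_elim
  case (elim x)
  \<comment> \<open>A coordinate is inherited from \<open>x\<close> only if it lies in both sets;
    all others come from \<open>mix T z w\<close>, which is again a single independent copy.\<close>
  have mm: "mix T (mix S x z) w = mix (S \<inter> T) x (mix T z w)" for z w
    by (auto simp: mix_def)
  have "cexp S (cexp T f) x = (\<integral>z. \<integral>w. f (mix (S \<inter> T) x (mix T z w)) \<partial>Q \<partial>Q)"
    by (simp add: cexp_def mm)
  also have "\<dots> = (\<integral>w. f (mix (S \<inter> T) x (mix T (fst w) (snd w))) \<partial>(Q \<Otimes>\<^sub>M Q))"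
    using QQ.integral_fst'[OF integrable_mix[OF elim, of T]] by simp
  also have "\<dots> = cexp (S \<inter> T) f x"
    using integral_mix[of "\<lambda>u. f (mix (S \<inter> T) x u)" T] elim by (simp add: cexp_def)
  finally show ?case .
qed

lemma cexp_reindex:
  assumes "inj \<sigma>" "f \<in> borel_measurable Q" "x \<in> space Q"
  shows "cexp S (\<lambda>x. f (x \<circ> \<sigma>)) x = cexp (\<sigma> -` S) f (x \<circ> \<sigma>)"
proof -
  have "mix S x z \<circ> \<sigma> = mix (\<sigma> -` S) (x \<circ> \<sigma>) (z \<circ> \<sigma>)" for z
    by (auto simp: mix_def)
  moreover have "x \<circ> \<sigma> \<in> space Q"
    using measurable_space[OF reindex_measurable assms(3)] .
  ultimately show ?thesis
    using integral_reindex[OF assms(1), of "\<lambda>z. f (mix (\<sigma> -` S) (x \<circ> \<sigma>) z)"] assms(2)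
    by (simp add: cexp_def)
qed

lemma cexp_cong_depends:
  assumes "depends_on B f" "S \<inter> B = T \<inter> B"
  shows "cexp S f = cexp T f"
proof
  fix x
  have "f (mix S x z) = f (mix T x z)" for z
    using assms by (intro depends_onD[OF assms(1)]) (auto simp: mix_def)
  then show "cexp S f x = cexp T f x" by (simp add: cexp_def)
qed

lemma depends_on_cexp: "depends_on B f \<Longrightarrow> depends_on (S \<inter> B) (cexp S f)"
  unfolding cexp_def depends_on_def
  by (intro allI impI arg_cong[where f="integral\<^sup>L Q"] ext) (auto simp: mix_def)

text \<open>Condition on \<open>A\<close>: the factor \<open>f\<close> is constant in the fibre, and
  \<open>g\<close> sees only the part \<open>A \<inter> B\<close> of what is kept fixed.\<close>

lemma orthogonal_if_cexp_zero:
  assumes f: "in_L2 Q f" "depends_on A f" and g: "in_L2 Q g" "depends_on B g"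
    and zero: "AE x in Q. cexp (A \<inter> B) g x = 0"
  shows "(\<integral>x. f x * g x \<partial>Q) = 0"
proof -
  note [measurable] = in_L2_measurable[OF f(1)] in_L2_measurable[OF g(1)]
  have int: "integrable Q (\<lambda>x. f x * g x)"
    by (rule in_L2_mult_integrable[OF f(1) g(1)])
  have eq: "f (mix A x z) = f x" for x z
    by (intro depends_onD[OF f(2)]) (auto simp: mix_def)
  have "(\<integral>x. f x * g x \<partial>Q) = (\<integral>x. cexp A (\<lambda>x. f x * g x) x \<partial>Q)"
    by (rule integral_cexp[OF int, symmetric])
  also have "\<dots> = (\<integral>x. f x * cexp (A \<inter> B) g x \<partial>Q)"
    using cexp_cong_depends[OF g(2), of A "A \<inter> B"] by (simp add: cexp_def eq fun_eq_iff)
  also have "\<dots> = (\<integral>x. 0 \<partial>Q)"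
    by (intro integral_cong_AE) (use zero in auto)
  finally show ?thesis by simp
qed

end

section \<open>Counting subsets\<close>

lemma card_supersets:
  fixes A :: "nat set"
  assumes "A \<subseteq> {..<n}" "card A = a" "a \<le> m"
  shows "card {J. J \<subseteq> {..<n} \<and> card J = m \<and> A \<subseteq> J} = (n - a) choose (m - a)"
proof -
  have fin: "finite A" using assms finite_subset by blast
  have "bij_betw (\<lambda>B. A \<union> B) {B. B \<subseteq> {..<n} - A \<and> card B = m - a}
      {J. J \<subseteq> {..<n} \<and> card J = m \<and> A \<subseteq> J}"
  proof (rule bij_betwI[where g = "\<lambda>J. J - A"])
    show "(\<lambda>B. A \<union> B) \<in> {B. B \<subseteq> {..<n} - A \<and> card B = m - a} \<rightarrow>
        {J. J \<subseteq> {..<n} \<and> card J = m \<and> A \<subseteq> J}"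
    proof safe
      fix B assume B: "B \<subseteq> {..<n} - A" "card B = m - a"
      then have "finite B" "A \<inter> B = {}" using finite_subset by blast+
      with B assms fin show "card (A \<union> B) = m"
        by (subst card_Un_disjoint) auto
    qed (use assms in auto)
    show "(\<lambda>J. J - A) \<in> {J. J \<subseteq> {..<n} \<and> card J = m \<and> A \<subseteq> J} \<rightarrow>
        {B. B \<subseteq> {..<n} - A \<and> card B = m - a}"
      using assms fin by (auto simp: card_Diff_subset)
  qed auto
  then have "card {J. J \<subseteq> {..<n} \<and> card J = m \<and> A \<subseteq> J} =
      card {B. B \<subseteq> {..<n} - A \<and> card B = m - a}"
    by (rule bij_betw_same_card[symmetric])
  also have "\<dots> = card ({..<n} - A) choose (m - a)"
    by (rule n_subsets) simp
  also have "card ({..<n} - A) = n - a"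
    using assms fin by (simp add: card_Diff_subset)
  finally show ?thesis .
qed

text \<open>Union bound over the \<open>a\<close>-element subsets of \<open>I\<close> that
  \<open>J\<close> may contain, followed by the identity \<open>choose_mult\<close>. Multiplying by
  \<open>n choose a\<close> keeps the estimate among natural numbers.\<close>

lemma card_large_intersection_le:
  fixes I :: "nat set"
  assumes I: "I \<subseteq> {..<n}" "card I = m"
  shows "card {J. J \<subseteq> {..<n} \<and> card J = m \<and> a \<le> card (I \<inter> J)} * (n choose a)
     \<le> (m choose a)\<^sup>2 * (n choose m)"
proof (cases "a \<le> m")
  case False
  have "card (I \<inter> J) \<le> m" for J
    using I finite_subset[OF I(1)] by (auto intro: card_mono)
  with False have "\<not> a \<le> card (I \<inter> J)" for J
    using order_trans by blast
  then show ?thesis by simp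
next
  case True
  have fin: "finite I" using I finite_subset by blast
  have mn: "m \<le> n" using I card_mono[of "{..<n}" I] by simp
  have "{J. J \<subseteq> {..<n} \<and> card J = m \<and> a \<le> card (I \<inter> J)} \<subseteq>
     (\<Union>A\<in>{A. A \<subseteq> I \<and> card A = a}. {J. J \<subseteq> {..<n} \<and> card J = m \<and> A \<subseteq> J})"
  proof safe
    fix J assume J: "J \<subseteq> {..<n}" "m = card J" "a \<le> card (I \<inter> J)"
    then obtain A where "A \<subseteq> I \<inter> J" "card A = a"
      using obtain_subset_with_card_n[OF J(3)] by blast
    then show "J \<in> (\<Union>A\<in>{A. A \<subseteq> I \<and> card A = a}. {Ja. Ja \<subseteq> {..<n} \<and> card Ja = card J \<and> A \<subseteq> Ja})"
      using J by blast
  qed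
  then have "card {J. J \<subseteq> {..<n} \<and> card J = m \<and> a \<le> card (I \<inter> J)} \<le>
     card (\<Union>A\<in>{A. A \<subseteq> I \<and> card A = a}. {J. J \<subseteq> {..<n} \<and> card J = m \<and> A \<subseteq> J})"
    using fin by (intro card_mono) (auto intro!: finite_subset[of _ "Pow {..<n}"])
  also have "\<dots> \<le> (\<Sum>A\<in>{A. A \<subseteq> I \<and> card A = a}. card {J. J \<subseteq> {..<n} \<and> card J = m \<and> A \<subseteq> J})"
    using fin by (intro card_UN_le) simp
  also have "\<dots> = (\<Sum>A\<in>{A. A \<subseteq> I \<and> card A = a}. (n - a) choose (m - a))"
    using I True by (intro sum.cong refl card_supersets) auto
  also have "\<dots> = (m choose a) * ((n - a) choose (m - a))"
    using fin I by (simp add: n_subsets)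
  finally have "card {J. J \<subseteq> {..<n} \<and> card J = m \<and> a \<le> card (I \<inter> J)} * (n choose a) \<le>
     (m choose a) * ((n choose a) * ((n - a) choose (m - a)))"
    by (simp add: mult_le_mono1 mult.assoc mult.left_commute mult.commute[of "n choose a"])
  also have "\<dots> = (m choose a)\<^sup>2 * (n choose m)"
    using choose_mult[OF True mn] by (simp add: power2_eq_square ac_simps)
  finally show ?thesis .
qed

text \<open>Every \<open>e\<close> lies in exactly \<open>(n - b) choose (m - b)\<close> of the sets
  \<open>J\<close>.\<close>

lemma sum_subsets_double_count:
  fixes f :: "nat set \<Rightarrow> real"
  assumes "b \<le> m" "m \<le> n"
  shows "(\<Sum>J\<in>{J. J \<subseteq> {..<n} \<and> card J = m}. \<Sum>e\<in>{e. e \<subseteq> J \<and> card e = b}. f e) / real (n choose m)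
    = real (m choose b) / real (n choose b) * (\<Sum>e\<in>{e. e \<subseteq> {..<n} \<and> card e = b}. f e)"
proof -
  let ?JJ = "{J. J \<subseteq> {..<n} \<and> card J = m}" and ?E = "{e. e \<subseteq> {..<n} \<and> card e = b}"
  have fin: "finite ?JJ" "finite ?E" by auto
  have "(\<Sum>J\<in>?JJ. \<Sum>e\<in>{e. e \<subseteq> J \<and> card e = b}. f e) = (\<Sum>J\<in>?JJ. \<Sum>e\<in>{e\<in>?E. e \<subseteq> J}. f e)"
    by (intro sum.cong refl arg_cong[where f="sum f"]) auto
  also have "\<dots> = (\<Sum>e\<in>?E. \<Sum>J\<in>{J\<in>?JJ. e \<subseteq> J}. f e)"
    by (rule sum.swap_restrict[OF fin])
  also have "\<dots> = (\<Sum>e\<in>?E. real ((n - b) choose (m - b)) * f e)"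
  proof (intro sum.cong refl)
    fix e assume e: "e \<in> ?E"
    have "{J\<in>?JJ. e \<subseteq> J} = {J. J \<subseteq> {..<n} \<and> card J = m \<and> e \<subseteq> J}" by auto
    then show "(\<Sum>J\<in>{J\<in>?JJ. e \<subseteq> J}. f e) = real ((n - b) choose (m - b)) * f e"
      using card_supersets[of e n b m] e assms by simp
  qed
  also have "\<dots> = real ((n - b) choose (m - b)) * (\<Sum>e\<in>?E. f e)"
    by (simp add: sum_distrib_left)
  finally have *: "(\<Sum>J\<in>?JJ. \<Sum>e\<in>{e. e \<subseteq> J \<and> card e = b}. f e) =
    real ((n - b) choose (m - b)) * (\<Sum>e\<in>?E. f e)" .
  have "real (n choose m) * real (m choose b) = real (n choose b) * real ((n - b) choose (m - b))"
    using choose_mult[OF assms] by (simp flip: of_nat_mult)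
  moreover have "real (n choose m) > 0" "real (n choose b) > 0"
    using assms by (simp_all add: zero_less_binomial_iff)
  ultimately show ?thesis
    by (simp add: * field_simps)
qed

lemma integral_square_sum_bound:
  assumes "finite I" "\<And>i. i \<in> I \<Longrightarrow> in_L2 M (f i)" "\<And>i. i \<in> I \<Longrightarrow> (\<integral>x. (f i x)\<^sup>2 \<partial>M) \<le> v"
  shows "(\<integral>x. (\<Sum>i\<in>I. f i x)\<^sup>2 \<partial>M) \<le> (real (card I))\<^sup>2 * v"
proof -
  have "(\<integral>x. (\<Sum>i\<in>I. f i x)\<^sup>2 \<partial>M) \<le> (\<integral>x. real (card I) * (\<Sum>i\<in>I. (f i x)\<^sup>2) \<partial>M)"
  proof (rule integral_mono)
    show "integrable M (\<lambda>x. (\<Sum>i\<in>I. f i x)\<^sup>2)"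
      by (intro in_L2_integrable_square in_L2_sum assms)
    show "integrable M (\<lambda>x. real (card I) * (\<Sum>i\<in>I. (f i x)\<^sup>2))"
      using assms by (intro integrable_mult_right Bochner_Integration.integrable_sum) (auto simp: in_L2_def)
    show "(\<Sum>i\<in>I. f i x)\<^sup>2 \<le> real (card I) * (\<Sum>i\<in>I. (f i x)\<^sup>2)" for x
      using Cauchy_Schwarz_ineq_sum[of "\<lambda>i. 1" "\<lambda>i. f i x" I] by simp
  qed
  also have "\<dots> = real (card I) * (\<Sum>i\<in>I. \<integral>x. (f i x)\<^sup>2 \<partial>M)"
    using assms by (simp add: in_L2_def)
  also have "\<dots> \<le> real (card I) * (\<Sum>i\<in>I. v)"
    by (intro mult_left_mono sum_mono assms) auto
  finally show ?thesis by (simp add: power2_eq_square)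
qed

text \<open>Here \<open>B i\<close> collects the indices whose terms may be correlated with term
  \<open>i\<close>, and \<open>d\<close> bounds their share of all indices. Expanding the square
  leaves only these covariances, each at most \<open>v\<close> by Cauchy-Schwarz.\<close>

lemma second_moment_average_le:
  assumes fin: "finite A" and L2: "\<And>i. i \<in> A \<Longrightarrow> in_L2 M (R i)"
    and v: "\<And>i. i \<in> A \<Longrightarrow> (\<integral>x. (R i x)\<^sup>2 \<partial>M) \<le> v"
    and B: "\<And>i. i \<in> A \<Longrightarrow> B i \<subseteq> A"
    and orth: "\<And>i j. i \<in> A \<Longrightarrow> j \<in> A - B i \<Longrightarrow> (\<integral>x. R i x * R j x \<partial>M) = 0"
    and d: "\<And>i. i \<in> A \<Longrightarrow> real (card (B i)) \<le> d * real (card A)"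
    and A: "A \<noteq> {}"
  shows "(\<integral>x. ((\<Sum>i\<in>A. R i x) / real (card A))\<^sup>2 \<partial>M) \<le> d * v"
proof -
  have cov: "(\<integral>x. R i x * R j x \<partial>M) \<le> v" if "i \<in> A" "j \<in> A" for i j
  proof -
    have "\<bar>\<integral>x. R i x * R j x \<partial>M\<bar> \<le> sqrt (\<integral>x. (R i x)\<^sup>2 \<partial>M) * sqrt (\<integral>x. (R j x)\<^sup>2 \<partial>M)"
      by (intro in_L2_abs_integral_le L2 that)
    also have "\<dots> \<le> sqrt v * sqrt v"
      using order_trans[OF _ v[OF that(1)], of 0] by (intro mult_mono real_sqrt_le_mono v that) simp_all
    also have "\<dots> = v"
      using order_trans[OF _ v[OF that(1)], of 0] by simp
    finally show ?thesis by simp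
  qed
  have v0: "v \<ge> 0"
  proof -
    from A obtain i where "i \<in> A" by auto
    have "0 \<le> (\<integral>x. (R i x)\<^sup>2 \<partial>M)" by simp
    also have "\<dots> \<le> v" by (rule v) fact
    finally show ?thesis .
  qed
  have "(\<integral>x. (\<Sum>i\<in>A. R i x)\<^sup>2 \<partial>M) = (\<integral>x. (\<Sum>i\<in>A. \<Sum>j\<in>A. R i x * R j x) \<partial>M)"
    by (simp add: power2_eq_square sum_product)
  also have "\<dots> = (\<Sum>i\<in>A. \<Sum>j\<in>A. \<integral>x. R i x * R j x \<partial>M)"
    using in_L2_mult_integrable[OF L2 L2]
    by (simp add: Bochner_Integration.integral_sum Bochner_Integration.integrable_sum cong: sum.cong)
  also have "\<dots> = (\<Sum>i\<in>A. \<Sum>j\<in>B i. \<integral>x. R i x * R j x \<partial>M)"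
    using fin B orth by (intro sum.cong refl sum.mono_neutral_right) auto
  also have "\<dots> \<le> (\<Sum>i\<in>A. \<Sum>j\<in>B i. v)"
    using B by (intro sum_mono cov) auto
  also have "\<dots> = (\<Sum>i\<in>A. real (card (B i)) * v)" by simp
  also have "\<dots> \<le> (\<Sum>i\<in>A. d * real (card A) * v)"
    by (intro sum_mono mult_right_mono d v0)
  also have "\<dots> = d * v * (real (card A))\<^sup>2" by (simp add: power2_eq_square)
  finally have "(\<integral>x. (\<Sum>i\<in>A. R i x)\<^sup>2 \<partial>M) \<le> d * v * (real (card A))\<^sup>2" .
  moreover have "real (card A) > 0" using A fin by (simp add: card_gt_0_iff)
  ultimately show ?thesis
    by (simp add: power_divide divide_le_eq)
qed

text \<open>Reindexing preserves the product measure for injections of the whole index set, so an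
  enumeration of \<open>J\<close> has to be continued injectively to all of
  \<open>nat\<close>.\<close>

lemma ex_inj_extension:
  fixes J :: "nat set"
  assumes J: "finite J" "card J = m" and f: "inj_on f {..<b}" "f ` {..<b} \<subseteq> J"
  obtains \<sigma> :: "nat \<Rightarrow> nat" where "inj \<sigma>" "\<And>i. i < b \<Longrightarrow> \<sigma> i = f i" "\<sigma> ` {..<m} = J"
proof -
  have cf: "card (f ` {..<b}) = b" using f by (simp add: card_image)
  have bm: "b \<le> m" using card_mono[OF J(1) f(2)] J cf by simp
  have "card (J - f ` {..<b}) = card {b..<m}"
    using J f cf by (subst card_Diff_subset) auto
  then obtain g where g: "bij_betw g {b..<m} (J - f ` {..<b})"
    using finite_same_card_bij[of "{b..<m}" "J - f ` {..<b}"] J by auto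
  obtain N where N: "\<And>j. j \<in> J \<Longrightarrow> j < N" using J(1) finite_nat_set_iff_bounded by auto
  \<comment> \<open>\<open>N\<close> exceeds every element of \<open>J\<close>, so the shifted
    indices beyond \<open>m\<close> avoid the values already used.\<close>
  define \<sigma> where "\<sigma> i = (if i < b then f i else if i < m then g i else i + N)" for i
  have gi: "inj_on g {b..<m}" and gim: "g ` {b..<m} = J - f ` {..<b}" using g by (auto simp: bij_betw_def)
  have g1: "g i \<in> J" "g i \<notin> f ` {..<b}" if "\<not> i < b" "i < m" for i
  proof -
    have "g i \<in> g ` {b..<m}" using that by auto
    with gim show "g i \<in> J" "g i \<notin> f ` {..<b}" by auto
  qed
  have f1: "f i \<in> J" if "i < b" for i using f that by auto
  have J1: "j + N \<notin> J" for j using N[of "j + N"] by auto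
  have "inj \<sigma>"
  proof (rule linorder_injI)
    fix i j :: nat assume "i < j"
    show "\<sigma> i \<noteq> \<sigma> j"
    proof (cases "j < b")
      case True
      then show ?thesis using \<open>i < j\<close> f(1) by (auto simp: \<sigma>_def inj_on_def)
    next
      case jb: False
      show ?thesis
      proof (cases "j < m")
        case True
        show ?thesis
        proof (cases "i < b")
          case ib: True
          have "f i \<noteq> g j" using g1(2)[OF jb True] ib by (metis imageI lessThan_iff)
          then show ?thesis using True jb ib by (simp add: \<sigma>_def)
        next
          case False
          then show ?thesis using True jb inj_onD[OF gi, of i j] \<open>i < j\<close> by (auto simp: \<sigma>_def)
        qed
      next
        case False
        then show ?thesis using jb J1[of j] f1[of i] g1[of i] \<open>i < j\<close> by (auto simp: \<sigma>_def)
      qed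
    qed
  qed
  moreover have "\<sigma> ` {..<m} = J"
  proof -
    have "{..<m} = {..<b} \<union> {b..<m}" using bm by auto
    then have "\<sigma> ` {..<m} = \<sigma> ` {..<b} \<union> \<sigma> ` {b..<m}" by (simp add: image_Un)
    also have "\<sigma> ` {..<b} = f ` {..<b}" by (auto simp: \<sigma>_def)
    also have "\<sigma> ` {b..<m} = g ` {b..<m}" by (auto simp: \<sigma>_def image_iff)
    finally show ?thesis using gim f(2) by auto
  qed
  ultimately show ?thesis by (intro that[of \<sigma>]) (auto simp: \<sigma>_def)
qed

text \<open>The increasing enumeration of \<open>I\<close> and the given one differ by a permutation
  of \<open>{..<m}\<close>, which the symmetry of \<open>g\<close> absorbs.\<close>

lemma symmetric_enum_args:
  fixes g :: "(nat \<Rightarrow> 'v) \<Rightarrow> real"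
  assumes loc: "\<And>x x'. (\<forall>i<m. x i = x' i) \<Longrightarrow> g x = g x'"
    and sym: "\<And>\<pi> x. \<pi> permutes {..<m} \<Longrightarrow> g (x \<circ> \<pi>) = g x"
    and \<sigma>: "inj_on \<sigma> {..<m}" "\<sigma> ` {..<m} = I"
  shows "g (enum_args I x) = g (x \<circ> \<sigma>)"
proof -
  have I: "finite I" "card I = m" using \<sigma> by (auto simp: card_image)
  let ?e = "\<lambda>i. sorted_list_of_set I ! i"
  have e: "bij_betw ?e {..<m} I"
    using bij_betw_nth[of "sorted_list_of_set I" "{..<m}" I] I by (auto simp: lessThan_def)
  define \<pi> where "\<pi> i = (if i < m then inv_into {..<m} ?e (\<sigma> i) else i)" for i
  have b: "bij_betw (inv_into {..<m} ?e \<circ> \<sigma>) {..<m} {..<m}"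
    using \<sigma> bij_betw_inv_into[OF e] by (intro bij_betw_trans[of \<sigma> _ I]) (auto simp: bij_betw_def)
  have "bij_betw \<pi> {..<m} {..<m}"
    using b by (rule bij_betw_cong[THEN iffD1, rotated]) (auto simp: \<pi>_def)
  then have "\<pi> permutes {..<m}"
    by (rule bij_imp_permutes) (auto simp: \<pi>_def)
  then have "g (enum_args I x) = g (enum_args I x \<circ> \<pi>)"
    by (rule sym[symmetric])
  also have "\<dots> = g (x \<circ> \<sigma>)"
  proof (rule loc, safe)
    fix i assume i: "i < m"
    then have "?e (inv_into {..<m} ?e (\<sigma> i)) = \<sigma> i"
      using \<sigma> e by (intro f_inv_into_f) (auto simp: bij_betw_def)
    then show "(enum_args I x \<circ> \<pi>) i = (x \<circ> \<sigma>) i"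
      using i by (simp add: enum_args_def \<pi>_def)
  qed
  finally show ?thesis .
qed

section \<open>The two-sample kernel\<close>

text \<open>Under the null hypothesis both samples have law \<open>F\<close>, so controls
  (\<open>Inl\<close>) and cases (\<open>Inr\<close>) form one i.i.d. family. The arguments of
  \<open>h\<close> are total functions; \<open>h_local\<close> says that only finitely many entries
  matter.\<close>

locale two_sample = iid_space F Q for F :: "'v measure" and Q :: "(nat + nat \<Rightarrow> 'v) measure" +
  fixes m0 m1 :: nat and h :: "(nat \<Rightarrow> 'v) \<Rightarrow> (nat \<Rightarrow> 'v) \<Rightarrow> real"
  assumes h_local: "\<And>x x' y y'. (\<forall>i<m0. x i = x' i) \<Longrightarrow> (\<forall>j<m1. y j = y' j) \<Longrightarrow> h x y = h x' y'"
    and h_sym0: "\<And>\<pi> x y. \<pi> permutes {..<m0} \<Longrightarrow> h (x \<circ> \<pi>) y = h x y"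
    and h_sym1: "\<And>\<pi> x y. \<pi> permutes {..<m1} \<Longrightarrow> h x (y \<circ> \<pi>) = h x y"
    and h_meas: "(\<lambda>w. h (fst w) (snd w)) \<in>
                   borel_measurable (PiM {..<m0} (\<lambda>_. F) \<Otimes>\<^sub>M PiM {..<m1} (\<lambda>_. F))"
    and h_L2: "integrable (PiM {..<m0} (\<lambda>_. F) \<Otimes>\<^sub>M PiM {..<m1} (\<lambda>_. F))
                 (\<lambda>w. (h (fst w) (snd w))\<^sup>2)"
    and h_mean: "(\<integral>w. h (fst w) (snd w) \<partial>(PiM {..<m0} (\<lambda>_. F) \<Otimes>\<^sub>M PiM {..<m1} (\<lambda>_. F))) = 0"
begin

section \<open>Projections as conditional expectations on the product space\<close>

definition split_at :: "nat set \<Rightarrow> nat set \<Rightarrow> (nat + nat \<Rightarrow> 'v) \<Rightarrow> (nat \<Rightarrow> 'v) \<times> (nat \<Rightarrow> 'v)" where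
  "split_at A B z = (\<lambda>i\<in>A. z (Inl i), \<lambda>j\<in>B. z (Inr j))"

lemma split_at_measurable[measurable]:
  "split_at A B \<in> measurable Q (PiM A (\<lambda>_. F) \<Otimes>\<^sub>M PiM B (\<lambda>_. F))"
  unfolding split_at_def by measurable

text \<open>By \<open>distr_mix\<close> with \<open>S = range Inl\<close>, controls and cases may be
  drawn from two independent copies, which displays the law as a product.\<close>

lemma distr_split_at:
  "distr Q (PiM A (\<lambda>_. F) \<Otimes>\<^sub>M PiM B (\<lambda>_. F)) (split_at A B) = PiM A (\<lambda>_. F) \<Otimes>\<^sub>M PiM B (\<lambda>_. F)"
proof -
  let ?A = "PiM A (\<lambda>_. F)" and ?B = "PiM B (\<lambda>_. F)"
  have 1: "distr Q ?A (\<lambda>z. \<lambda>i\<in>A. z (Inl i)) = ?A"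
    unfolding Q_def using prob_space_axioms by (intro distr_PiM_reindex) auto
  have 2: "distr Q ?B (\<lambda>z. \<lambda>i\<in>B. z (Inr i)) = ?B"
    unfolding Q_def using prob_space_axioms by (intro distr_PiM_reindex) auto
  interpret B: prob_space ?B by (intro prob_space_PiM prob_space_axioms)
  have "distr Q (?A \<Otimes>\<^sub>M ?B) (split_at A B) =
      distr (distr (Q \<Otimes>\<^sub>M Q) Q (\<lambda>w. mix (range Inl) (fst w) (snd w))) (?A \<Otimes>\<^sub>M ?B) (split_at A B)"
    by (simp add: distr_mix)
  also have "\<dots> = distr (Q \<Otimes>\<^sub>M Q) (?A \<Otimes>\<^sub>M ?B) (\<lambda>(x, z). (\<lambda>i\<in>A. x (Inl i), \<lambda>i\<in>B. z (Inr i)))"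
  proof (subst distr_distr)
    show "distr (Q \<Otimes>\<^sub>M Q) (?A \<Otimes>\<^sub>M ?B) (split_at A B \<circ> (\<lambda>w. mix (range Inl) (fst w) (snd w))) =
        distr (Q \<Otimes>\<^sub>M Q) (?A \<Otimes>\<^sub>M ?B) (\<lambda>(x, z). (\<lambda>i\<in>A. x (Inl i), \<lambda>i\<in>B. z (Inr i)))"
      by (intro arg_cong[where f="distr (Q \<Otimes>\<^sub>M Q) (?A \<Otimes>\<^sub>M ?B)"] ext)
        (auto simp: split_at_def mix_def)
  qed measurable
  also have "\<dots> = distr Q ?A (\<lambda>z. \<lambda>i\<in>A. z (Inl i)) \<Otimes>\<^sub>M distr Q ?B (\<lambda>z. \<lambda>i\<in>B. z (Inr i))"
    by (intro pair_measure_distr[symmetric])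
      (auto simp: 2 intro!: measurable_restrict B.sigma_finite_measure_axioms)
  finally show ?thesis by (simp add: 1 2)
qed

definition H0 :: "(nat + nat \<Rightarrow> 'v) \<Rightarrow> real" where
  "H0 z = h (\<lambda>i. z (Inl i)) (\<lambda>j. z (Inr j))"

definition H :: "nat set \<Rightarrow> nat set \<Rightarrow> (nat + nat \<Rightarrow> 'v) \<Rightarrow> real" where
  "H I J z = h (enum_args I (\<lambda>i. z (Inl i))) (enum_args J (\<lambda>j. z (Inr j)))"

lemma H0_split: "H0 z = h (fst (split_at {..<m0} {..<m1} z)) (snd (split_at {..<m0} {..<m1} z))"
  unfolding H0_def split_at_def by (intro h_local) auto

lemma H0_measurable[measurable]: "H0 \<in> borel_measurable Q"
  unfolding H0_split[abs_def] using measurable_compose[OF split_at_measurable h_meas] .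

lemma H0_L2: "in_L2 Q H0"
  using integrable_distr[OF split_at_measurable, of "{..<m0}" "{..<m1}" "\<lambda>w. (h (fst w) (snd w))\<^sup>2"] h_L2
  by (simp add: in_L2_def distr_split_at H0_split[symmetric])

lemma H0_mean: "(\<integral>z. H0 z \<partial>Q) = 0"
  using integral_distr[OF split_at_measurable h_meas] h_mean
  by (simp add: distr_split_at H0_split[symmetric])

lemma H0_depends: "depends_on (Inl ` {..<m0} \<union> Inr ` {..<m1}) H0"
  unfolding depends_on_def H0_def by (auto intro!: h_local)

abbreviation base_set :: "nat \<Rightarrow> nat \<Rightarrow> (nat + nat) set" where
  "base_set a b \<equiv> Inl ` {..<a} \<union> Inr ` {..<b}"

text \<open>The arguments integrated out in \<open>proj\<close> are a marginal of \<open>Q\<close>.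
  Values of \<open>x\<close> and \<open>y\<close> outside the base set never enter
  \<open>cexp\<close>, so they may be arbitrary.\<close>

lemma proj_eq_cexp:
  assumes x: "\<And>i. i < a \<Longrightarrow> x i \<in> space F" and y: "\<And>j. j < b \<Longrightarrow> y j \<in> space F"
  shows "proj F m0 m1 h a b x y = cexp (base_set a b) H0 (case_sum x y)"
proof -
  let ?A = "PiM {a..<m0} (\<lambda>_. F)" and ?B = "PiM {b..<m1} (\<lambda>_. F)"
  let ?h = "\<lambda>z. h (\<lambda>i. if i < a then x i else fst z i) (\<lambda>j. if j < b then y j else snd z j)"
  have "(\<lambda>z. (\<lambda>i\<in>{..<m0}. if i < a then x i else fst z i, \<lambda>j\<in>{..<m1}. if j < b then y j else snd z j))
      \<in> measurable (?A \<Otimes>\<^sub>M ?B) (PiM {..<m0} (\<lambda>_. F) \<Otimes>\<^sub>M PiM {..<m1} (\<lambda>_. F))"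
  proof (intro measurable_Pair measurable_restrict)
    fix i assume "i \<in> {..<m0}"
    then show "(\<lambda>z. if i < a then x i else fst z i) \<in> measurable (?A \<Otimes>\<^sub>M ?B) F"
      using x by (cases "i < a") (auto intro: measurable_compose[OF measurable_fst] measurable_component_singleton)
  next
    fix i assume "i \<in> {..<m1}"
    then show "(\<lambda>z. if i < b then y i else snd z i) \<in> measurable (?A \<Otimes>\<^sub>M ?B) F"
      using y by (cases "i < b") (auto intro: measurable_compose[OF measurable_snd] measurable_component_singleton)
  qed
  from measurable_compose[OF this h_meas]
  have m: "?h \<in> borel_measurable (?A \<Otimes>\<^sub>M ?B)"
    by (rule measurable_cong[THEN iffD1, rotated]) (auto intro!: h_local)
  have "proj F m0 m1 h a b x y = (\<integral>z. ?h z \<partial>distr Q (?A \<Otimes>\<^sub>M ?B) (split_at {a..<m0} {b..<m1}))"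
    by (simp add: proj_def distr_split_at)
  also have "\<dots> = (\<integral>z. ?h (split_at {a..<m0} {b..<m1} z) \<partial>Q)"
    by (intro integral_distr m) measurable
  also have "\<dots> = cexp (base_set a b) H0 (case_sum x y)"
    unfolding cexp_def H0_def split_at_def mix_def
    by (intro arg_cong[where f="integral\<^sup>L Q"] ext h_local) (auto simp: image_iff)
  finally show ?thesis .
qed

lemma cexp_mean_zero: "(\<integral>x. cexp S H0 x \<partial>Q) = 0"
  by (simp add: integral_cexp Q.in_L2_integrable[OF H0_L2] H0_mean)

text \<open>All projections inherit the mean zero of \<open>h\<close>, so the variance is a second
  moment.\<close>

lemma xi_eq: "xi F m0 m1 h a b = (\<integral>x. (cexp (base_set a b) H0 x)\<^sup>2 \<partial>Q)"
proof -
  let ?A = "PiM {..<a} (\<lambda>_. F)" and ?B = "PiM {..<b} (\<lambda>_. F)"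
  let ?g = "\<lambda>w. proj F m0 m1 h a b (fst w) (snd w)"
  let ?g' = "\<lambda>w. cexp (base_set a b) H0 (case_sum (fst w) (snd w))"
  have gg: "?g w = ?g' w" if "w \<in> space (?A \<Otimes>\<^sub>M ?B)" for w
    using that by (intro proj_eq_cexp) (auto simp: space_pair_measure space_PiM PiE_iff)
  have [measurable]: "(\<lambda>w. mix (base_set a b) (case_sum (fst (fst w)) (snd (fst w))) (snd w)) \<in>
      measurable ((?A \<Otimes>\<^sub>M ?B) \<Otimes>\<^sub>M Q) Q"
    unfolding measurable_Q_iff
  proof
    fix s
    show "(\<lambda>w. mix (base_set a b) (case_sum (fst (fst w)) (snd (fst w))) (snd w) s) \<in>
      measurable ((?A \<Otimes>\<^sub>M ?B) \<Otimes>\<^sub>M Q) F"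
    proof (cases "s \<in> base_set a b")
      case True
      then show ?thesis by (auto simp: mix_def)
    next
      case False
      then show ?thesis by (simp add: mix_def)
    qed
  qed
  have [measurable]: "?g' \<in> borel_measurable (?A \<Otimes>\<^sub>M ?B)"
    unfolding cexp_def by measurable
  have m: "?g \<in> borel_measurable (?A \<Otimes>\<^sub>M ?B)"
    by (rule measurable_cong[THEN iffD2, of _ _ ?g']) (use gg in auto)
  have gs: "?g (split_at {..<a} {..<b} z) = cexp (base_set a b) H0 z" if "z \<in> space Q" for z
  proof -
    have "?g (split_at {..<a} {..<b} z) = ?g' (split_at {..<a} {..<b} z)"
      using measurable_space[OF split_at_measurable that] by (rule gg)
    also have "\<dots> = cexp (base_set a b) H0 z"
      unfolding cexp_def split_at_def
      by (intro arg_cong[where f="integral\<^sup>L Q"] arg_cong[where f=H0] ext) (auto simp: mix_def)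
    finally show ?thesis .
  qed
  have mean: "(\<integral>w. ?g w \<partial>(?A \<Otimes>\<^sub>M ?B)) = 0"
  proof -
    have "(\<integral>w. ?g w \<partial>(?A \<Otimes>\<^sub>M ?B)) = (\<integral>w. ?g w \<partial>distr Q (?A \<Otimes>\<^sub>M ?B) (split_at {..<a} {..<b}))"
      by (simp add: distr_split_at)
    also have "\<dots> = (\<integral>z. ?g (split_at {..<a} {..<b} z) \<partial>Q)"
      using m by (intro integral_distr) measurable
    also have "\<dots> = (\<integral>z. cexp (base_set a b) H0 z \<partial>Q)"
      by (intro Bochner_Integration.integral_cong gs refl)
    finally show ?thesis by (simp add: cexp_mean_zero)
  qed
  have "xi F m0 m1 h a b = (\<integral>w. (?g w)\<^sup>2 \<partial>(?A \<Otimes>\<^sub>M ?B))"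
    by (simp add: xi_def mean Let_def)
  also have "\<dots> = (\<integral>w. (?g w)\<^sup>2 \<partial>distr Q (?A \<Otimes>\<^sub>M ?B) (split_at {..<a} {..<b}))"
    by (simp add: distr_split_at)
  also have "\<dots> = (\<integral>z. (?g (split_at {..<a} {..<b} z))\<^sup>2 \<partial>Q)"
    using m by (intro integral_distr) measurable
  also have "\<dots> = (\<integral>z. (cexp (base_set a b) H0 z)\<^sup>2 \<partial>Q)"
    by (intro Bochner_Integration.integral_cong refl) (simp add: gs)
  finally show ?thesis .
qed

lemma AE_cexp_zero_of_xi_zero:
  assumes "xi F m0 m1 h a b = 0"
  shows "AE x in Q. cexp (base_set a b) H0 x = 0"
  using assms unfolding xi_eq by (intro AE_zero_of_L2_norm_zero cexp_L2 H0_L2)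

text \<open>Symmetry frees the summand from the sorted enumeration of its index sets; every summand
  becomes a reindexed copy of \<open>H0\<close>.\<close>

lemma H_eq_reindex:
  assumes "inj \<sigma>" "\<sigma> ` {..<m0} = I" "inj \<tau>" "\<tau> ` {..<m1} = J"
  shows "H I J z = H0 (z \<circ> map_sum \<sigma> \<tau>)"
proof -
  have "H I J z = h ((\<lambda>i. z (Inl i)) \<circ> \<sigma>) (enum_args J (\<lambda>j. z (Inr j)))"
    unfolding H_def
  proof (rule symmetric_enum_args[where g="\<lambda>x. h x (enum_args J (\<lambda>j. z (Inr j)))" and m=m0])
    show "h x (enum_args J (\<lambda>j. z (Inr j))) = h x' (enum_args J (\<lambda>j. z (Inr j)))"
      if "\<forall>i<m0. x i = x' i" for x x'
      using that by (intro h_local) auto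
  qed (use assms in \<open>auto intro: inj_on_subset h_sym0\<close>)
  also have "\<dots> = h ((\<lambda>i. z (Inl i)) \<circ> \<sigma>) ((\<lambda>j. z (Inr j)) \<circ> \<tau>)"
  proof (rule symmetric_enum_args[where m=m1])
    show "h ((\<lambda>i. z (Inl i)) \<circ> \<sigma>) y = h ((\<lambda>i. z (Inl i)) \<circ> \<sigma>) y'" if "\<forall>i<m1. y i = y' i" for y y'
      using that by (intro h_local) auto
  qed (use assms in \<open>auto intro: inj_on_subset h_sym1[unfolded comp_def] simp: comp_def\<close>)
  finally show ?thesis by (simp add: H0_def comp_def)
qed

lemma inj_map_sum: "inj \<sigma> \<Longrightarrow> inj \<tau> \<Longrightarrow> inj (map_sum \<sigma> \<tau>)"
  by (rule sum.inj_map)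

lemma ex_enumeration:
  assumes "finite (J :: nat set)" "card J = m" "A \<subseteq> J" "card A = b"
  obtains \<sigma> where "inj \<sigma>" "\<sigma> ` {..<b} = A" "\<sigma> ` {..<m} = J"
proof -
  have "finite A" using assms finite_subset by blast
  then obtain f where f: "bij_betw f {..<b} A"
    using finite_same_card_bij[of "{..<b}" A] assms by auto
  then have "inj_on f {..<b}" "f ` {..<b} \<subseteq> J" using assms by (auto simp: bij_betw_def)
  from ex_inj_extension[OF assms(1,2) this] obtain \<sigma> where
    \<sigma>: "inj \<sigma>" "\<And>i. i < b \<Longrightarrow> \<sigma> i = f i" "\<sigma> ` {..<m} = J" by auto
  have "\<sigma> ` {..<b} = f ` {..<b}" using \<sigma>(2) by (intro image_cong) auto
  with f \<sigma> show ?thesis by (intro that[of \<sigma>]) (auto simp: bij_betw_def)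
qed

lemma H_L2:
  assumes "finite I" "card I = m0" "finite J" "card J = m1"
  shows "in_L2 Q (H I J)" "(\<integral>z. (H I J z)\<^sup>2 \<partial>Q) = (\<integral>z. (H0 z)\<^sup>2 \<partial>Q)"
    "(\<integral>z. H I J z \<partial>Q) = 0"
proof -
  obtain \<sigma> where \<sigma>: "inj \<sigma>" "\<sigma> ` {..<m0} = I" using ex_enumeration[OF assms(1,2), of "{}" 0] by auto
  obtain \<tau> where \<tau>: "inj \<tau>" "\<tau> ` {..<m1} = J" using ex_enumeration[OF assms(3,4), of "{}" 0] by auto
  have eq: "H I J = (\<lambda>z. H0 (z \<circ> map_sum \<sigma> \<tau>))"
    using H_eq_reindex[OF \<sigma> \<tau>] by auto
  note inj = inj_map_sum[OF \<sigma>(1) \<tau>(1)]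
  show "in_L2 Q (H I J)" unfolding eq by (rule in_L2_reindex[OF inj H0_L2])
  show "(\<integral>z. (H I J z)\<^sup>2 \<partial>Q) = (\<integral>z. (H0 z)\<^sup>2 \<partial>Q)"
    unfolding eq by (rule integral_reindex[OF inj, of "\<lambda>z. (H0 z)\<^sup>2"]) measurable
  show "(\<integral>z. H I J z \<partial>Q) = 0"
    unfolding eq using integral_reindex[OF inj, of H0] H0_mean by simp
qed

lemma H_depends:
  assumes "finite I" "card I = m0" "finite J" "card J = m1"
  shows "depends_on (Inl ` I \<union> Inr ` J) (H I J)"
proof -
  obtain \<sigma> where \<sigma>: "inj \<sigma>" "\<sigma> ` {..<m0} = I" using ex_enumeration[OF assms(1,2), of "{}" 0] by auto
  obtain \<tau> where \<tau>: "inj \<tau>" "\<tau> ` {..<m1} = J" using ex_enumeration[OF assms(3,4), of "{}" 0] by auto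
  show ?thesis
    unfolding depends_on_def H_eq_reindex[OF \<sigma> \<tau>]
    by (intro allI impI depends_onD[OF H0_depends]) (use \<sigma> \<tau> in auto)
qed

lemma cexp_H_reindex:
  assumes "inj \<sigma>" "\<sigma> ` {..<m0} = I" "inj \<tau>" "\<tau> ` {..<m1} = J" "x \<in> space Q"
  shows "cexp (Inl ` \<sigma> ` {..<a} \<union> Inr ` \<tau> ` {..<b}) (H I J) x = cexp (base_set a b) H0 (x \<circ> map_sum \<sigma> \<tau>)"
proof -
  have eq: "H I J = (\<lambda>z. H0 (z \<circ> map_sum \<sigma> \<tau>))"
    using H_eq_reindex[OF assms(1-4)] by auto
  have "map_sum \<sigma> \<tau> -` (Inl ` \<sigma> ` {..<a} \<union> Inr ` \<tau> ` {..<b}) = base_set a b"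
  proof (intro set_eqI)
    fix s show "s \<in> map_sum \<sigma> \<tau> -` (Inl ` \<sigma> ` {..<a} \<union> Inr ` \<tau> ` {..<b}) \<longleftrightarrow> s \<in> base_set a b"
      by (cases s) (auto simp: image_iff dest: injD[OF assms(1)] injD[OF assms(3)])
  qed
  then show ?thesis
    unfolding eq using cexp_reindex[OF inj_map_sum[OF assms(1,3)] H0_measurable assms(5)] by simp
qed

text \<open>By exchangeability, whether a projection of a summand vanishes depends only on how many
  controls and how many cases are held fixed.\<close>

lemma AE_cexp_H_zero:
  assumes IJ: "finite I" "card I = m0" "finite J" "card J = m1"
    and A: "A \<subseteq> I" "card A = a" and B: "B \<subseteq> J" "card B = b"
    and zero: "AE x in Q. cexp (base_set a b) H0 x = 0"
  shows "AE x in Q. cexp (Inl ` A \<union> Inr ` B) (H I J) x = 0"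
proof -
  obtain \<sigma> where \<sigma>: "inj \<sigma>" "\<sigma> ` {..<a} = A" "\<sigma> ` {..<m0} = I"
    using ex_enumeration[OF IJ(1,2) A] by auto
  obtain \<tau> where \<tau>: "inj \<tau>" "\<tau> ` {..<b} = B" "\<tau> ` {..<m1} = J"
    using ex_enumeration[OF IJ(3,4) B] by auto
  from AE_reindex[OF inj_map_sum[OF \<sigma>(1) \<tau>(1)] zero] AE_space show ?thesis
    by eventually_elim (use cexp_H_reindex[OF \<sigma>(1,3) \<tau>(1,3), of _ a b] \<sigma>(2) \<tau>(2) in simp)
qed

text \<open>Only projections of order exactly \<open>b\<close> are subtracted. The Hoeffding
  decomposition would correct them by lower orders, but it is used where the projections onto fewer
  than \<open>b\<close> cases vanish.\<close>

definition resid :: "nat \<Rightarrow> nat set \<Rightarrow> nat set \<Rightarrow> (nat + nat \<Rightarrow> 'v) \<Rightarrow> real" where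
  "resid b I J x = H I J x - (\<Sum>e\<in>{e. e \<subseteq> J \<and> card e = b}. cexp (Inr ` e) (H I J) x)"

lemma resid_L2:
  assumes "finite I" "card I = m0" "finite J" "card J = m1"
  shows "in_L2 Q (resid b I J)"
    and "(\<integral>x. (resid b I J x)\<^sup>2 \<partial>Q) \<le> 2 * (1 + (real (m1 choose b))\<^sup>2) * (\<integral>z. (H0 z)\<^sup>2 \<partial>Q)"
    and "depends_on (Inl ` I \<union> Inr ` J) (resid b I J)"
proof -
  note HL = H_L2[OF assms] and Hd = H_depends[OF assms]
  let ?s = "\<lambda>x. \<Sum>e\<in>{e. e \<subseteq> J \<and> card e = b}. cexp (Inr ` e) (H I J) x"
  have s: "in_L2 Q ?s" by (intro in_L2_sum cexp_L2 HL)
  show "in_L2 Q (resid b I J)"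
    unfolding resid_def[abs_def] by (intro in_L2_diff HL s)
  have "(\<integral>x. (resid b I J x)\<^sup>2 \<partial>Q) = (\<integral>x. (H I J x + (- 1) * ?s x)\<^sup>2 \<partial>Q)"
    by (simp add: resid_def)
  also have "\<dots> \<le> 2 * (\<integral>x. (H I J x)\<^sup>2 \<partial>Q) + 2 * (\<integral>x. ((- 1) * ?s x)\<^sup>2 \<partial>Q)"
    by (intro integral_square_sum_le HL in_L2_cmult s)
  also have "(\<integral>x. ((- 1) * ?s x)\<^sup>2 \<partial>Q) \<le> (real (card {e. e \<subseteq> J \<and> card e = b}))\<^sup>2 * (\<integral>x. (H I J x)\<^sup>2 \<partial>Q)"
    using integral_square_sum_bound[of "{e. e \<subseteq> J \<and> card e = b}" Q "\<lambda>e. cexp (Inr ` e) (H I J)"]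
      assms cexp_L2[OF HL(1)] by simp
  finally show "(\<integral>x. (resid b I J x)\<^sup>2 \<partial>Q) \<le> 2 * (1 + (real (m1 choose b))\<^sup>2) * (\<integral>z. (H0 z)\<^sup>2 \<partial>Q)"
    using assms by (simp add: HL(2) n_subsets algebra_simps)
  have "depends_on (Inl ` I \<union> Inr ` J) (cexp (Inr ` e) (H I J))" for e
    using depends_on_cexp[OF Hd, of "Inr ` e"] by (rule depends_on_mono) auto
  with Hd show "depends_on (Inl ` I \<union> Inr ` J) (resid b I J)"
    unfolding depends_on_def resid_def by (intro allI impI arg_cong2[where f="(-)"] sum.cong refl) blast+
qed

lemma cexp_resid:
  assumes "finite I" "card I = m0" "finite J" "card J = m1"
  shows "AE x in Q. cexp S (resid b I J) x =
     cexp S (H I J) x - (\<Sum>e\<in>{e. e \<subseteq> J \<and> card e = b}. cexp (S \<inter> Inr ` e) (H I J) x)"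
proof -
  note HL = H_L2[OF assms]
  have i: "integrable Q (H I J)" by (intro Q.in_L2_integrable HL)
  have fin: "finite {e. e \<subseteq> J \<and> card e = b}" using assms by simp
  have "AE x in Q. \<forall>e\<in>{e. e \<subseteq> J \<and> card e = b}. cexp S (cexp (Inr ` e) (H I J)) x = cexp (S \<inter> Inr ` e) (H I J) x"
    by (intro AE_finite_allI fin cexp_cexp i)
  moreover have "AE x in Q. cexp S (resid b I J) x = cexp S (H I J) x -
      cexp S (\<lambda>x. \<Sum>e\<in>{e. e \<subseteq> J \<and> card e = b}. cexp (Inr ` e) (H I J) x) x"
    unfolding resid_def[abs_def]
    by (intro cexp_diff i Bochner_Integration.integrable_sum integrable_cexp)
  moreover have "AE x in Q. cexp S (\<lambda>x. \<Sum>e\<in>{e. e \<subseteq> J \<and> card e = b}. cexp (Inr ` e) (H I J) x) x =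
     (\<Sum>e\<in>{e. e \<subseteq> J \<and> card e = b}. cexp S (cexp (Inr ` e) (H I J)) x)"
    by (intro cexp_sum fin integrable_cexp i)
  ultimately show ?thesis
    by eventually_elim simp
qed

text \<open>A set \<open>e\<close> of size \<open>b\<close> other than \<open>B\<close> meets
  \<open>B\<close> in fewer than \<open>b\<close> elements, so its projection vanishes after
  conditioning on \<open>B\<close>. If \<open>B\<close> itself has size \<open>b\<close>, the term
  \<open>e = B\<close> cancels the projection of \<open>H\<close>; otherwise that projection is zero
  as well.\<close>

lemma cexp_resid_zero_Inr:
  assumes IJ: "finite I" "card I = m0" "finite J" "card J = m1"
    and B: "B \<subseteq> J" "card B \<le> b"
    and zero: "\<And>c. c < b \<Longrightarrow> AE x in Q. cexp (base_set 0 c) H0 x = 0"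
  shows "AE x in Q. cexp (Inr ` B) (resid b I J) x = 0"
proof -
  have small: "AE x in Q. cexp (Inr ` A) (H I J) x = 0" if "A \<subseteq> J" "card A < b" for A
    using AE_cexp_H_zero[OF IJ, of "{}" 0 A "card A"] zero[OF that(2)] that(1) by simp
  let ?E = "{e. e \<subseteq> J \<and> card e = b}"
  have finB: "finite B" using B(1) IJ(3) finite_subset by blast
  have int: "card (B \<inter> e) < b" if e: "e \<in> ?E" "e \<noteq> B" for e
  proof -
    have fe: "finite e" using e IJ(3) finite_subset by blast
    have "card (B \<inter> e) \<le> card e" using fe by (intro card_mono) auto
    moreover have "card (B \<inter> e) \<noteq> b"
    proof
      assume c: "card (B \<inter> e) = b"
      then have "B \<inter> e = e" using e fe by (intro card_subset_eq) auto
      moreover have "B \<inter> e = B"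
        using c B(2) card_mono[OF finB, of "B \<inter> e"] finB by (intro card_subset_eq) auto
      ultimately show False using e by auto
    qed
    ultimately show ?thesis using e by simp
  qed
  have "AE x in Q. \<forall>e\<in>?E - {B}. cexp (Inr ` (B \<inter> e)) (H I J) x = 0"
    using IJ B int by (intro AE_finite_allI small) auto
  moreover have "AE x in Q. card B < b \<longrightarrow> cexp (Inr ` B) (H I J) x = 0"
    using small[OF B(1)] by (cases "card B < b") auto
  ultimately show ?thesis using cexp_resid[OF IJ, of "Inr ` B" b]
  proof eventually_elim
    case (elim x)
    have im: "Inr ` B \<inter> Inr ` e = Inr ` (B \<inter> e)" for e by auto
    have finE: "finite ?E" using IJ by simp
    show ?case
    proof (cases "card B = b")
      case True
      then have "B \<in> ?E" using B by simp
      then show ?thesis using elim(1,3) unfolding im by (simp add: sum.remove[OF finE])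
    next
      case False
      then have "B \<notin> ?E" "card B < b" using B by auto
      then show ?thesis using elim unfolding im by simp
    qed
  qed
qed

text \<open>The subtracted projections depend on cases only, so conditioning them on a single
  control reduces them to means, which are zero.\<close>

lemma cexp_resid_zero_Inl:
  assumes IJ: "finite I" "card I = m0" "finite J" "card J = m1" and i: "i \<in> I"
    and zero: "AE x in Q. cexp (base_set 1 0) H0 x = 0"
  shows "AE x in Q. cexp (Inl ` {i}) (resid b I J) x = 0"
proof -
  have "AE x in Q. cexp (Inl ` {i} \<union> Inr ` {}) (H I J) x = 0"
    using i by (intro AE_cexp_H_zero[OF IJ, of _ 1 _ 0] zero) auto
  then show ?thesis using cexp_resid[OF IJ, of "Inl ` {i}" b]
  proof eventually_elim
    case (elim x)
    have e0: "Inl ` {i} \<inter> Inr ` e = {}" for e by auto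
    have "cexp {} (H I J) x = 0"
      using H_L2(3)[OF IJ] by (simp add: cexp_def mix_def)
    then show ?case using elim unfolding e0 by simp
  qed
qed

end

section \<open>The Hoeffding remainder\<close>

text \<open>The factor \<open>a ^ a\<close> comes from bounding \<open>n choose a\<close> below by
  \<open>(n / a) ^ a\<close>.\<close>

lemma card_large_intersection_frac:
  fixes I :: "nat set"
  assumes I: "I \<subseteq> {..<n}" "card I = m" and a: "1 \<le> a" "a \<le> n"
  shows "real (card {J. J \<subseteq> {..<n} \<and> card J = m \<and> a \<le> card (I \<inter> J)})
     \<le> (real ((m choose a)\<^sup>2 * a ^ a) / real n ^ a) * real (n choose m)"
proof -
  let ?c = "real (card {J. J \<subseteq> {..<n} \<and> card J = m \<and> a \<le> card (I \<inter> J)})"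
  have "?c * (real n / real a) ^ a \<le> ?c * real (n choose a)"
    using binomial_ge_n_over_k_pow_k[OF a(2), where 'a=real] by (intro mult_left_mono) auto
  also have "\<dots> \<le> real ((m choose a)\<^sup>2) * real (n choose m)"
    using card_large_intersection_le[OF I, of a] unfolding of_nat_mult[symmetric] of_nat_le_iff .
  finally show ?thesis
    using a by (simp add: field_simps)
qed

context two_sample
begin

definition U :: "nat \<Rightarrow> nat \<Rightarrow> (nat + nat \<Rightarrow> 'v) \<Rightarrow> real" where
  "U N0 N1 x = ustat m0 m1 h N0 N1 (\<lambda>i. x (Inl i)) (\<lambda>j. x (Inr j))"

definition pairs :: "nat \<Rightarrow> nat \<Rightarrow> (nat set \<times> nat set) set" where
  "pairs N0 N1 = {I. I \<subseteq> {..<N0} \<and> card I = m0} \<times> {J. J \<subseteq> {..<N1} \<and> card J = m1}"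

lemma card_pairs: "card (pairs N0 N1) = (N0 choose m0) * (N1 choose m1)"
  by (simp add: pairs_def card_cartesian_product n_subsets)

lemma U_eq: "U N0 N1 x = (\<Sum>(I,J)\<in>pairs N0 N1. H I J x) / real (card (pairs N0 N1))"
  unfolding U_def ustat_def card_pairs H_def
  by (simp add: pairs_def sum.cartesian_product divide_inverse mult.commute)

definition rem :: "nat \<Rightarrow> nat \<Rightarrow> nat \<Rightarrow> (nat + nat \<Rightarrow> 'v) \<Rightarrow> real" where
  "rem b N0 N1 x = (\<Sum>p\<in>pairs N0 N1. resid b (fst p) (snd p) x) / real (card (pairs N0 N1))"

lemma pairsD:
  assumes "p \<in> pairs N0 N1"
  shows "finite (fst p)" "card (fst p) = m0" "finite (snd p)" "card (snd p) = m1"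
    "fst p \<subseteq> {..<N0}" "snd p \<subseteq> {..<N1}"
proof -
  show 1: "card (fst p) = m0" "card (snd p) = m1" "fst p \<subseteq> {..<N0}" "snd p \<subseteq> {..<N1}"
    using assms by (auto simp: pairs_def)
  show "finite (fst p)" "finite (snd p)"
    using 1 finite_subset[OF _ finite_lessThan] by blast+
qed

lemma finite_pairs: "finite (pairs N0 N1)"
  by (simp add: pairs_def)

lemma rem_L2: "in_L2 Q (rem b N0 N1)"
  unfolding rem_def[abs_def] divide_inverse mult.commute[of _ "inverse _"]
  by (intro in_L2_cmult in_L2_sum resid_L2(1) pairsD)

text \<open>The projection onto \<open>e\<close> is the same for all summands whose case set
  contains \<open>e\<close>, so double counting turns the average into a U-statistic of order
  \<open>b\<close> in the cases.\<close>

lemma U_minus_rem: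
  assumes N: "m0 \<le> N0" "m1 \<le> N1" "b \<le> m1" and x: "x \<in> space Q"
    and D: "\<And>I J e. finite I \<Longrightarrow> card I = m0 \<Longrightarrow> finite J \<Longrightarrow> card J = m1 \<Longrightarrow> e \<subseteq> J \<Longrightarrow> card e = b \<Longrightarrow>
      cexp (Inr ` e) (H I J) x = D e"
  shows "U N0 N1 x - rem b N0 N1 x =
    real (m1 choose b) / real (N1 choose b) * (\<Sum>e\<in>{e. e \<subseteq> {..<N1} \<and> card e = b}. D e)"
proof -
  let ?c = "real (card (pairs N0 N1))"
  have "U N0 N1 x - rem b N0 N1 x = (\<Sum>p\<in>pairs N0 N1. H (fst p) (snd p) x - resid b (fst p) (snd p) x) / ?c"
    unfolding U_eq rem_def by (simp add: sum_subtractf diff_divide_distrib case_prod_beta)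
  also have "\<dots> = (\<Sum>p\<in>pairs N0 N1. \<Sum>e\<in>{e. e \<subseteq> snd p \<and> card e = b}. D e) / ?c"
    by (intro arg_cong2[where f="(/)"] sum.cong refl) (auto simp: resid_def intro!: sum.cong D pairsD)
  also have "(\<Sum>p\<in>pairs N0 N1. \<Sum>e\<in>{e. e \<subseteq> snd p \<and> card e = b}. D e) =
     real (N0 choose m0) * (\<Sum>J\<in>{J. J \<subseteq> {..<N1} \<and> card J = m1}. \<Sum>e\<in>{e. e \<subseteq> J \<and> card e = b}. D e)"
    unfolding pairs_def by (simp add: sum.cartesian_product[symmetric, of "\<lambda>x y. sum D {e. e \<subseteq> y \<and> card e = b}", unfolded case_prod_beta] n_subsets)
  also have "\<dots> / ?c = (\<Sum>J\<in>{J. J \<subseteq> {..<N1} \<and> card J = m1}. \<Sum>e\<in>{e. e \<subseteq> J \<and> card e = b}. D e) / real (N1 choose m1)"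
    using N by (simp add: card_pairs)
  also have "\<dots> = real (m1 choose b) / real (N1 choose b) * (\<Sum>e\<in>{e. e \<subseteq> {..<N1} \<and> card e = b}. D e)"
    by (rule sum_subsets_double_count[OF N(3,2)])
  finally show ?thesis .
qed

definition resid_bound :: "nat \<Rightarrow> real" where
  "resid_bound b = 2 * (1 + (real (m1 choose b))\<^sup>2) * (\<integral>z. (H0 z)\<^sup>2 \<partial>Q)"

lemma resid_second_moment_le:
  assumes "(I, J) \<in> pairs N0 N1"
  shows "(\<integral>x. (resid b I J x)\<^sup>2 \<partial>Q) \<le> resid_bound b"
  using resid_L2(2)[OF pairsD(1-4)[OF assms], of b] by (simp add: resid_bound_def)

text \<open>The two intersection conditions are independent in the count. With \<open>a = 0\<close>
  or \<open>c = 0\<close> the condition is void and its factor is 1, since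
  \<open>0 ^ 0 = 1\<close>.\<close>

lemma card_meeting_pairs_le:
  assumes p: "p \<in> pairs N0 N1" and N: "N0 \<ge> a" "N1 \<ge> c" "N0 \<ge> 1" "N1 \<ge> 1"
  shows "real (card {q\<in>pairs N0 N1. a \<le> card (fst p \<inter> fst q) \<and> c \<le> card (snd p \<inter> snd q)}) \<le>
    real ((m0 choose a)\<^sup>2 * a ^ a) / real N0 ^ a * (real ((m1 choose c)\<^sup>2 * c ^ c) / real N1 ^ c)
      * real (card (pairs N0 N1))"
proof -
  let ?A = "{I. I \<subseteq> {..<N0} \<and> card I = m0 \<and> a \<le> card (fst p \<inter> I)}"
  let ?B = "{J. J \<subseteq> {..<N1} \<and> card J = m1 \<and> c \<le> card (snd p \<inter> J)}"
  have A: "real (card ?A) \<le> real ((m0 choose a)\<^sup>2 * a ^ a) / real N0 ^ a * real (N0 choose m0)"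
  proof (cases "a = 0")
    case True then show ?thesis by (simp add: n_subsets)
  next
    case False with pairsD[OF p] N show ?thesis by (intro card_large_intersection_frac) auto
  qed
  have B: "real (card ?B) \<le> real ((m1 choose c)\<^sup>2 * c ^ c) / real N1 ^ c * real (N1 choose m1)"
  proof (cases "c = 0")
    case True then show ?thesis by (simp add: n_subsets)
  next
    case False with pairsD[OF p] N show ?thesis by (intro card_large_intersection_frac) auto
  qed
  have "{q\<in>pairs N0 N1. a \<le> card (fst p \<inter> fst q) \<and> c \<le> card (snd p \<inter> snd q)} = ?A \<times> ?B"
    by (auto simp: pairs_def)
  then have "real (card {q\<in>pairs N0 N1. a \<le> card (fst p \<inter> fst q) \<and> c \<le> card (snd p \<inter> snd q)}) =
      real (card ?A) * real (card ?B)"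
    by (simp add: card_cartesian_product)
  also have "\<dots> \<le> (real ((m0 choose a)\<^sup>2 * a ^ a) / real N0 ^ a * real (N0 choose m0)) *
      (real ((m1 choose c)\<^sup>2 * c ^ c) / real N1 ^ c * real (N1 choose m1))"
    by (intro mult_mono A B) auto
  finally show ?thesis by (simp add: card_pairs mult_ac)
qed

lemma resid_orthogonal_Inr:
  assumes p: "p \<in> pairs N0 N1" and q: "q \<in> pairs N0 N1"
    and zero: "\<And>c. c < b \<Longrightarrow> AE x in Q. cexp (base_set 0 c) H0 x = 0"
    and "fst p \<inter> fst q = {}" "card (snd p \<inter> snd q) \<le> b"
  shows "(\<integral>x. resid b (fst p) (snd p) x * resid b (fst q) (snd q) x \<partial>Q) = 0"
proof (rule orthogonal_if_cexp_zero)
  have "(Inl ` fst p \<union> Inr ` snd p) \<inter> (Inl ` fst q \<union> Inr ` snd q) = (Inr ` (snd p \<inter> snd q) :: (nat + nat) set)"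
    using assms(4) by auto
  then show "AE x in Q. cexp ((Inl ` fst p \<union> Inr ` snd p) \<inter> (Inl ` fst q \<union> Inr ` snd q)) (resid b (fst q) (snd q)) x = 0"
    using cexp_resid_zero_Inr[OF pairsD(1-4)[OF q], of "snd p \<inter> snd q" b] assms by simp
qed (rule resid_L2 pairsD[OF p] pairsD[OF q])+

lemma resid_orthogonal_Inl:
  assumes p: "p \<in> pairs N0 N1" and q: "q \<in> pairs N0 N1"
    and zero: "AE x in Q. cexp (base_set 1 0) H0 x = 0"
    and i: "card (fst p \<inter> fst q) = 1" "snd p \<inter> snd q = {}"
  shows "(\<integral>x. resid b (fst p) (snd p) x * resid b (fst q) (snd q) x \<partial>Q) = 0"
proof (rule orthogonal_if_cexp_zero)
  from i(1) obtain i where i1: "fst p \<inter> fst q = {i}" by (auto simp: card_1_singleton_iff)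
  then have "(Inl ` fst p \<union> Inr ` snd p) \<inter> (Inl ` fst q \<union> Inr ` snd q) = (Inl ` {i} :: (nat + nat) set)"
    using i(2) by auto
  then show "AE x in Q. cexp ((Inl ` fst p \<union> Inr ` snd p) \<inter> (Inl ` fst q \<union> Inr ` snd q)) (resid b (fst q) (snd q)) x = 0"
    using cexp_resid_zero_Inl[OF pairsD(1-4)[OF q] _ zero, of i b] i1 by auto
qed (rule resid_L2 pairsD[OF p] pairsD[OF q])+

lemma pairs_nonempty: "m0 \<le> N0 \<Longrightarrow> m1 \<le> N1 \<Longrightarrow> pairs N0 N1 \<noteq> {}"
  using card_pairs[of N0 N1] by auto

text \<open>Only summands sharing a control or more than \<open>b\<close> cases can be correlated;
  the two terms of the bound are the shares of these two kinds of pairs.\<close>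

lemma rem_second_moment_general:
  assumes zero: "\<And>c. c < b \<Longrightarrow> AE x in Q. cexp (base_set 0 c) H0 x = 0"
    and N: "m0 \<le> N0" "m1 \<le> N1" "1 \<le> N0" "Suc b \<le> N1"
  shows "(\<integral>x. (rem b N0 N1 x)\<^sup>2 \<partial>Q) \<le>
    (real (m0\<^sup>2) / real N0 + real ((m1 choose Suc b)\<^sup>2 * Suc b ^ Suc b) / real N1 ^ Suc b) * resid_bound b"
  unfolding rem_def
\<comment> \<open>The vacuous conditions \<open>0 \<le> card _\<close> give both sets the shape
  counted by \<open>card_meeting_pairs_le\<close>.\<close>
proof (rule second_moment_average_le[where B="\<lambda>p. {q\<in>pairs N0 N1. 1 \<le> card (fst p \<inter> fst q) \<and> 0 \<le> card (snd p \<inter> snd q)}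
      \<union> {q\<in>pairs N0 N1. 0 \<le> card (fst p \<inter> fst q) \<and> Suc b \<le> card (snd p \<inter> snd q)}"])
  fix p q assume p: "p \<in> pairs N0 N1" and "q \<in> pairs N0 N1 -
    ({q\<in>pairs N0 N1. 1 \<le> card (fst p \<inter> fst q) \<and> 0 \<le> card (snd p \<inter> snd q)}
      \<union> {q\<in>pairs N0 N1. 0 \<le> card (fst p \<inter> fst q) \<and> Suc b \<le> card (snd p \<inter> snd q)})"
  then have q: "q \<in> pairs N0 N1" "card (fst p \<inter> fst q) = 0" "card (snd p \<inter> snd q) \<le> b" by auto
  then show "(\<integral>x. resid b (fst p) (snd p) x * resid b (fst q) (snd q) x \<partial>Q) = 0"
    using pairsD[OF p] by (intro resid_orthogonal_Inr[OF p q(1) zero]) auto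
next
  fix p assume p: "p \<in> pairs N0 N1"
  show "real (card ({q\<in>pairs N0 N1. 1 \<le> card (fst p \<inter> fst q) \<and> 0 \<le> card (snd p \<inter> snd q)}
      \<union> {q\<in>pairs N0 N1. 0 \<le> card (fst p \<inter> fst q) \<and> Suc b \<le> card (snd p \<inter> snd q)})) \<le>
    (real (m0\<^sup>2) / real N0 + real ((m1 choose Suc b)\<^sup>2 * Suc b ^ Suc b) / real N1 ^ Suc b) * real (card (pairs N0 N1))"
    (is "real (card (?A \<union> ?B)) \<le> _")
  proof -
    have "real (card (?A \<union> ?B)) \<le> real (card ?A) + real (card ?B)"
      using card_Un_le[of ?A ?B] by linarith
    then show ?thesis
      using card_meeting_pairs_le[OF p, of 1 0] card_meeting_pairs_le[OF p, of 0 "Suc b"] N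
      by (simp add: algebra_simps)
  qed
qed (use N in \<open>auto simp: finite_pairs pairs_nonempty intro!: resid_L2(1) resid_second_moment_le dest: pairsD\<close>)

text \<open>Sharing one control and no case is now harmless. What remains are two shared controls, a
  shared control together with a shared case, or more than \<open>b\<close> shared cases, one for
  each term of the bound.\<close>

lemma rem_second_moment_degenerate:
  assumes zero: "\<And>c. c < b \<Longrightarrow> AE x in Q. cexp (base_set 0 c) H0 x = 0"
    and zero10: "AE x in Q. cexp (base_set 1 0) H0 x = 0"
    and N: "m0 \<le> N0" "m1 \<le> N1" "2 \<le> N0" "Suc b \<le> N1"
  shows "(\<integral>x. (rem b N0 N1 x)\<^sup>2 \<partial>Q) \<le>
    (real ((m0 choose 2)\<^sup>2 * 4) / real N0 ^ 2 + real (m0\<^sup>2) / real N0 * (real (m1\<^sup>2) / real N1)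
      + real ((m1 choose Suc b)\<^sup>2 * Suc b ^ Suc b) / real N1 ^ Suc b) * resid_bound b"
  unfolding rem_def
proof (rule second_moment_average_le[where B="\<lambda>p. {q\<in>pairs N0 N1. 2 \<le> card (fst p \<inter> fst q) \<and> 0 \<le> card (snd p \<inter> snd q)}
      \<union> {q\<in>pairs N0 N1. 1 \<le> card (fst p \<inter> fst q) \<and> 1 \<le> card (snd p \<inter> snd q)}
      \<union> {q\<in>pairs N0 N1. 0 \<le> card (fst p \<inter> fst q) \<and> Suc b \<le> card (snd p \<inter> snd q)}"])
  fix p q assume p: "p \<in> pairs N0 N1" and "q \<in> pairs N0 N1 -
    ({q\<in>pairs N0 N1. 2 \<le> card (fst p \<inter> fst q) \<and> 0 \<le> card (snd p \<inter> snd q)}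
      \<union> {q\<in>pairs N0 N1. 1 \<le> card (fst p \<inter> fst q) \<and> 1 \<le> card (snd p \<inter> snd q)}
      \<union> {q\<in>pairs N0 N1. 0 \<le> card (fst p \<inter> fst q) \<and> Suc b \<le> card (snd p \<inter> snd q)})"
  then have q: "q \<in> pairs N0 N1" "card (fst p \<inter> fst q) = 0 \<or> card (fst p \<inter> fst q) = 1 \<and> card (snd p \<inter> snd q) = 0"
    "card (snd p \<inter> snd q) \<le> b" by auto
  from q(2) show "(\<integral>x. resid b (fst p) (snd p) x * resid b (fst q) (snd q) x \<partial>Q) = 0"
  proof
    assume "card (fst p \<inter> fst q) = 0"
    with q show ?thesis
      using pairsD[OF p] by (intro resid_orthogonal_Inr[OF p q(1) zero]) auto
  next
    assume "card (fst p \<inter> fst q) = 1 \<and> card (snd p \<inter> snd q) = 0"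
    with q show ?thesis
      using pairsD[OF p] by (intro resid_orthogonal_Inl[OF p q(1) zero10]) auto
  qed
next
  fix p assume p: "p \<in> pairs N0 N1"
  show "real (card ({q\<in>pairs N0 N1. 2 \<le> card (fst p \<inter> fst q) \<and> 0 \<le> card (snd p \<inter> snd q)}
      \<union> {q\<in>pairs N0 N1. 1 \<le> card (fst p \<inter> fst q) \<and> 1 \<le> card (snd p \<inter> snd q)}
      \<union> {q\<in>pairs N0 N1. 0 \<le> card (fst p \<inter> fst q) \<and> Suc b \<le> card (snd p \<inter> snd q)})) \<le>
    (real ((m0 choose 2)\<^sup>2 * 4) / real N0 ^ 2 + real (m0\<^sup>2) / real N0 * (real (m1\<^sup>2) / real N1)
      + real ((m1 choose Suc b)\<^sup>2 * Suc b ^ Suc b) / real N1 ^ Suc b) * real (card (pairs N0 N1))"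
    (is "real (card (?A \<union> ?B \<union> ?C)) \<le> _")
  proof -
    have "real (card (?A \<union> ?B \<union> ?C)) \<le> real (card ?A) + real (card ?B) + real (card ?C)"
      using card_Un_le[of "?A \<union> ?B" ?C] card_Un_le[of ?A ?B] by linarith
    then show ?thesis
      using card_meeting_pairs_le[OF p, of 2 0] card_meeting_pairs_le[OF p, of 1 1]
        card_meeting_pairs_le[OF p, of 0 "Suc b"] N
      by (simp add: algebra_simps)
  qed
qed (use N in \<open>auto simp: finite_pairs pairs_nonempty intro!: resid_L2(1) resid_second_moment_le dest: pairsD\<close>)

end

lemma tendsto_inverse_nat_seq:
  assumes "filterlim n at_top sequentially"
  shows "(\<lambda>k. c / real (n k)) \<longlonglongrightarrow> 0"
  using tendsto_divide_0[OF tendsto_const filterlim_at_top_imp_at_infinity]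
    filterlim_compose[OF filterlim_real_sequentially assms] by blast

context two_sample
begin

lemma rem_tendsto_general:
  assumes zero: "\<And>c. c < b \<Longrightarrow> AE x in Q. cexp (base_set 0 c) H0 x = 0"
    and n0: "filterlim n0 at_top sequentially" and n1: "filterlim n1 at_top sequentially"
    and ratio: "(\<lambda>k. real (n1 k) ^ b / real (n0 k)) \<longlonglongrightarrow> 0"
  shows "(\<lambda>k. real (n1 k) ^ b * (\<integral>x. (rem b (n0 k) (n1 k) x)\<^sup>2 \<partial>Q)) \<longlonglongrightarrow> 0"
proof (rule tendsto_sandwich)
  let ?C = "real ((m1 choose Suc b)\<^sup>2 * Suc b ^ Suc b)"
  show "\<forall>\<^sub>F k in sequentially. 0 \<le> real (n1 k) ^ b * (\<integral>x. (rem b (n0 k) (n1 k) x)\<^sup>2 \<partial>Q)" by simp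
  show "\<forall>\<^sub>F k in sequentially. real (n1 k) ^ b * (\<integral>x. (rem b (n0 k) (n1 k) x)\<^sup>2 \<partial>Q) \<le>
    (real (m0\<^sup>2) * (real (n1 k) ^ b / real (n0 k)) + ?C / real (n1 k)) * resid_bound b"
    using filterlim_at_top[THEN iffD1, OF n0, rule_format, of "max m0 1"]
      filterlim_at_top[THEN iffD1, OF n1, rule_format, of "max m1 (Suc b)"]
  proof eventually_elim
    case (elim k)
    then have "real (n1 k) ^ b * (\<integral>x. (rem b (n0 k) (n1 k) x)\<^sup>2 \<partial>Q) \<le>
      real (n1 k) ^ b * ((real (m0\<^sup>2) / real (n0 k) + ?C / real (n1 k) ^ Suc b) * resid_bound b)"
      by (intro mult_left_mono rem_second_moment_general zero) auto
    also have "\<dots> = (real (m0\<^sup>2) * (real (n1 k) ^ b / real (n0 k)) + ?C / real (n1 k)) * resid_bound b"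
      using elim by (simp add: field_simps)
    finally show ?case .
  qed
  have "(\<lambda>k. (real (m0\<^sup>2) * (real (n1 k) ^ b / real (n0 k)) + ?C / real (n1 k)) * resid_bound b) \<longlonglongrightarrow> (real (m0\<^sup>2) * 0 + 0) * resid_bound b"
    by (intro tendsto_intros ratio tendsto_inverse_nat_seq n1)
  then show "(\<lambda>k. (real (m0\<^sup>2) * (real (n1 k) ^ b / real (n0 k)) + ?C / real (n1 k)) * resid_bound b) \<longlonglongrightarrow> 0" by simp
qed simp

lemma rem_tendsto_degenerate:
  assumes zero: "\<And>c. c < 2 \<Longrightarrow> AE x in Q. cexp (base_set 0 c) H0 x = 0"
    and zero10: "AE x in Q. cexp (base_set 1 0) H0 x = 0"
    and n0: "filterlim n0 at_top sequentially" and n1: "filterlim n1 at_top sequentially"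
    and ratio: "(\<lambda>k. real (n1 k) / real (n0 k)) \<longlonglongrightarrow> 0"
  shows "(\<lambda>k. real (n1 k) ^ 2 * (\<integral>x. (rem 2 (n0 k) (n1 k) x)\<^sup>2 \<partial>Q)) \<longlonglongrightarrow> 0"
proof (rule tendsto_sandwich)
  let ?C = "real ((m1 choose Suc 2)\<^sup>2 * Suc 2 ^ Suc 2)" and ?D = "real ((m0 choose 2)\<^sup>2 * 4)"
    and ?E = "real (m0\<^sup>2) * real (m1\<^sup>2)"
  let ?r = "\<lambda>k. real (n1 k) / real (n0 k)"
  show "\<forall>\<^sub>F k in sequentially. 0 \<le> real (n1 k) ^ 2 * (\<integral>x. (rem 2 (n0 k) (n1 k) x)\<^sup>2 \<partial>Q)" by simp
  show "\<forall>\<^sub>F k in sequentially. real (n1 k) ^ 2 * (\<integral>x. (rem 2 (n0 k) (n1 k) x)\<^sup>2 \<partial>Q) \<le>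
    (?D * (?r k)\<^sup>2 + ?E * ?r k + ?C / real (n1 k)) * resid_bound 2"
    using filterlim_at_top[THEN iffD1, OF n0, rule_format, of "max m0 2"]
      filterlim_at_top[THEN iffD1, OF n1, rule_format, of "max m1 (Suc 2)"]
  proof eventually_elim
    case (elim k)
    then have "real (n1 k) ^ 2 * (\<integral>x. (rem 2 (n0 k) (n1 k) x)\<^sup>2 \<partial>Q) \<le>
      real (n1 k) ^ 2 * ((?D / real (n0 k) ^ 2 + real (m0\<^sup>2) / real (n0 k) * (real (m1\<^sup>2) / real (n1 k)) + ?C / real (n1 k) ^ Suc 2) * resid_bound 2)"
      by (intro mult_left_mono rem_second_moment_degenerate zero zero10) auto
    also have "\<dots> = (?D * (?r k)\<^sup>2 + ?E * ?r k + ?C / real (n1 k)) * resid_bound 2"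
      using elim by (simp add: field_simps power2_eq_square power3_eq_cube)
    finally show ?case .
  qed
  have "(\<lambda>k. (?D * (?r k)\<^sup>2 + ?E * ?r k + ?C / real (n1 k)) * resid_bound 2) \<longlonglongrightarrow> (?D * 0\<^sup>2 + ?E * 0 + 0) * resid_bound 2"
    by (intro tendsto_intros ratio tendsto_inverse_nat_seq n1)
  then show "(\<lambda>k. (?D * (?r k)\<^sup>2 + ?E * ?r k + ?C / real (n1 k)) * resid_bound 2) \<longlonglongrightarrow> 0" by simp
qed simp

section \<open>Projections onto one and two cases\<close>

text \<open>With no control held fixed, \<open>proj\<close> never reads its control argument, so
  \<open>undefined\<close> can stand there.\<close>

definition kernel1 :: "'v \<Rightarrow> real" where
  "kernel1 u = proj F m0 m1 h 0 1 (\<lambda>_. undefined) (\<lambda>_. u)"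

definition kernel2 :: "'v \<Rightarrow> 'v \<Rightarrow> real" where
  "kernel2 u v = proj F m0 m1 h 0 2 (\<lambda>_. undefined) (\<lambda>j. if j = 0 then u else v)"

lemma cexp_cong_on: "(\<And>s. s \<in> S \<Longrightarrow> x s = y s) \<Longrightarrow> cexp S f x = cexp S f y"
  unfolding cexp_def mix_def by (intro arg_cong[where f="integral\<^sup>L Q"] ext arg_cong[where f=f]) auto

lemma space_Q_component: "x \<in> space Q \<Longrightarrow> x i \<in> space F"
  by (auto simp: Q_def space_PiM)

lemma cexp_H_kernel1:
  assumes IJ: "finite I" "card I = m0" "finite J" "card J = m1" and j: "j \<in> J" and x: "x \<in> space Q"
  shows "cexp (Inr ` {j}) (H I J) x = kernel1 (x (Inr j))"
proof -
  obtain \<sigma> where \<sigma>: "inj \<sigma>" "\<sigma> ` {..<m0} = I" using ex_enumeration[OF IJ(1,2), of "{}" 0] by auto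
  obtain \<tau> where \<tau>: "inj \<tau>" "\<tau> ` {..<1} = {j}" "\<tau> ` {..<m1} = J"
    using ex_enumeration[OF IJ(3,4), of "{j}" 1] j by auto
  have "cexp (Inr ` {j}) (H I J) x = cexp (base_set 0 1) H0 (x \<circ> map_sum \<sigma> \<tau>)"
    using cexp_H_reindex[OF \<sigma> \<tau>(1,3) x, of 0 1] \<tau>(2) by simp
  also have "\<dots> = cexp (base_set 0 1) H0 (case_sum (\<lambda>_. undefined) (\<lambda>_. x (Inr j)))"
    using \<tau>(2) by (intro cexp_cong_on) auto
  also have "\<dots> = kernel1 (x (Inr j))"
    unfolding kernel1_def using space_Q_component[OF x] by (intro proj_eq_cexp[symmetric]) auto
  finally show ?thesis .
qed

lemma cexp_H_kernel2:
  assumes IJ: "finite I" "card I = m0" "finite J" "card J = m1" and j: "i \<in> J" "j \<in> J" "i \<noteq> j" and x: "x \<in> space Q"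
  shows "cexp (Inr ` {i, j}) (H I J) x = kernel2 (x (Inr i)) (x (Inr j))"
proof -
  obtain \<sigma> where \<sigma>: "inj \<sigma>" "\<sigma> ` {..<m0} = I" using ex_enumeration[OF IJ(1,2), of "{}" 0] by auto
  have "inj_on (\<lambda>k::nat. if k = 0 then i else j) {..<2}" "(\<lambda>k::nat. if k = 0 then i else j) ` {..<2} \<subseteq> J"
    using j by (auto simp: inj_on_def)
  from ex_inj_extension[OF IJ(3,4) this] obtain \<tau> where
    \<tau>: "inj \<tau>" "\<And>k. k < 2 \<Longrightarrow> \<tau> k = (if k = 0 then i else j)" "\<tau> ` {..<m1} = J" by blast
  have \<tau>01: "\<tau> 0 = i" "\<tau> 1 = j" using \<tau>(2)[of 0] \<tau>(2)[of 1] by auto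
  have ij: "{i, j} = \<tau> ` {..<2}" using \<tau>01 by (auto simp: lessThan_Suc numeral_2_eq_2)
  have "cexp (Inr ` {i, j}) (H I J) x = cexp (base_set 0 2) H0 (x \<circ> map_sum \<sigma> \<tau>)"
    using cexp_H_reindex[OF \<sigma> \<tau>(1,3) x, of 0 2] by (simp add: ij)
  also have "\<dots> = cexp (base_set 0 2) H0 (case_sum (\<lambda>_. undefined) (\<lambda>k. if k = 0 then x (Inr i) else x (Inr j)))"
    using \<tau>(2) by (intro cexp_cong_on) auto
  also have "\<dots> = kernel2 (x (Inr i)) (x (Inr j))"
    unfolding kernel2_def using space_Q_component[OF x] by (intro proj_eq_cexp[symmetric]) auto
  finally show ?thesis .
qed

end

section \<open>Square-integrable kernels\<close>

locale L2_kernel_space = prob_space F for F :: "'v measure"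
begin

sublocale FF: pair_prob_space F F ..

abbreviation "FF \<equiv> F \<Otimes>\<^sub>M F"

definition app :: "('v \<times> 'v \<Rightarrow> real) \<Rightarrow> ('v \<Rightarrow> real) \<Rightarrow> 'v \<Rightarrow> real" where
  "app A g x = (\<integral>z. A (x, z) * g z \<partial>F)"

text \<open>The kernel of the product of the two integral operators.\<close>

definition kcomp :: "('v \<times> 'v \<Rightarrow> real) \<Rightarrow> ('v \<times> 'v \<Rightarrow> real) \<Rightarrow> 'v \<times> 'v \<Rightarrow> real" where
  "kcomp A K w = (\<integral>z. A (fst w, z) * K (z, snd w) \<partial>F)"

lemma kcomp_app: "kcomp A K (x, y) = app A (\<lambda>z. K (z, y)) x"
  by (simp add: kcomp_def app_def)

lemma app_measurable[measurable]:
  assumes [measurable]: "A \<in> borel_measurable FF" "g \<in> borel_measurable F"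
  shows "app A g \<in> borel_measurable F"
  unfolding app_def[abs_def] by measurable

lemma kcomp_measurable[measurable]:
  assumes [measurable]: "A \<in> borel_measurable FF" "K \<in> borel_measurable FF"
  shows "kcomp A K \<in> borel_measurable FF"
  unfolding kcomp_def[abs_def] by measurable

lemma AE_fst: "AE x in F. P x \<Longrightarrow> AE w in FF. P (fst w)"
  by (rule AE_distrD[OF measurable_fst, of P F F]) (subst distr_pair_fst)

lemma distr_snd: "distr FF F snd = F"
proof (rule measure_eqI)
  fix A assume A: "A \<in> sets (distr FF F snd)"
  then have "snd -` A \<inter> space FF = space F \<times> A"
    using sets.sets_into_space by (auto simp: space_pair_measure)
  with A show "emeasure (distr FF F snd) A = emeasure F A"
    by (simp add: emeasure_distr emeasure_pair_measure_Times emeasure_space_1)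
qed simp

lemma AE_snd: "AE x in F. P x \<Longrightarrow> AE w in FF. P (snd w)"
  by (rule AE_distrD[OF measurable_snd, of P F F]) (subst distr_snd)

lemma integrable_tensor:
  fixes f g :: "'v \<Rightarrow> real"
  assumes f: "integrable F f" and g: "integrable F g"
  shows "integrable FF (\<lambda>w. f (fst w) * g (snd w))"
proof (rule FF.Fubini_integrable)
  show "integrable F (\<lambda>x. \<integral>y. norm (f (fst (x, y)) * g (snd (x, y))) \<partial>F)"
    using f by (simp add: abs_mult)
qed (use f g in auto)

lemma tensor_L2:
  assumes "in_L2 F f" "in_L2 F g"
  shows "in_L2 FF (\<lambda>w. f (fst w) * g (snd w))"
proof -
  have [measurable]: "f \<in> borel_measurable F" "g \<in> borel_measurable F" using assms by (auto simp: in_L2_def)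
  have "integrable FF (\<lambda>w. (f (fst w))\<^sup>2 * (g (snd w))\<^sup>2)"
    by (intro integrable_tensor[of "\<lambda>x. (f x)\<^sup>2" "\<lambda>x. (g x)\<^sup>2"] in_L2_integrable_square assms)
  then show "in_L2 FF (\<lambda>w. f (fst w) * g (snd w))"
    by (simp add: in_L2_def power_mult_distrib)
qed

lemma
  assumes K: "in_L2 FF K"
  shows AE_row_L2: "AE x in F. in_L2 F (\<lambda>y. K (x, y))"
    and AE_col_L2: "AE y in F. in_L2 F (\<lambda>x. K (x, y))"
    and integrable_row: "integrable F (\<lambda>x. \<integral>y. (K (x, y))\<^sup>2 \<partial>F)"
    and integrable_col: "integrable F (\<lambda>y. \<integral>x. (K (x, y))\<^sup>2 \<partial>F)"
    and integral_row: "(\<integral>x. \<integral>y. (K (x, y))\<^sup>2 \<partial>F \<partial>F) = (\<integral>w. (K w)\<^sup>2 \<partial>FF)"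
    and integral_col: "(\<integral>y. \<integral>x. (K (x, y))\<^sup>2 \<partial>F \<partial>F) = (\<integral>w. (K w)\<^sup>2 \<partial>FF)"
proof -
  have [measurable]: "K \<in> borel_measurable FF" using K by (simp add: in_L2_def)
  note i = in_L2_integrable_square[OF K]
  then have i': "integrable FF (\<lambda>(x, y). (K (x, y))\<^sup>2)" by (simp add: case_prod_beta')
  show "AE x in F. in_L2 F (\<lambda>y. K (x, y))"
    using FF.AE_integrable_fst'[OF i] AE_space by eventually_elim (auto simp: in_L2_def)
  show "AE y in F. in_L2 F (\<lambda>x. K (x, y))"
    using FF.AE_integrable_snd[OF i'] AE_space by eventually_elim (auto simp: in_L2_def)
  show "integrable F (\<lambda>x. \<integral>y. (K (x, y))\<^sup>2 \<partial>F)" using FF.integrable_fst'[OF i] .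
  show "integrable F (\<lambda>y. \<integral>x. (K (x, y))\<^sup>2 \<partial>F)" using FF.integrable_snd[OF i'] .
  show "(\<integral>x. \<integral>y. (K (x, y))\<^sup>2 \<partial>F \<partial>F) = (\<integral>w. (K w)\<^sup>2 \<partial>FF)" using FF.integral_fst'[OF i] .
  show "(\<integral>y. \<integral>x. (K (x, y))\<^sup>2 \<partial>F \<partial>F) = (\<integral>w. (K w)\<^sup>2 \<partial>FF)" using FF.integral_snd[OF i'] by (simp add: case_prod_beta')
qed

lemma app_L2:
  assumes A: "in_L2 FF A" and g: "in_L2 F g"
  shows "in_L2 F (app A g)"
proof -
  have [measurable]: "A \<in> borel_measurable FF" "g \<in> borel_measurable F" using A g by (auto simp: in_L2_def)
  have "AE x in F. (app A g x)\<^sup>2 \<le> (\<integral>y. (A (x, y))\<^sup>2 \<partial>F) * (\<integral>y. (g y)\<^sup>2 \<partial>F)"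
    using AE_row_L2[OF A]
    by eventually_elim (auto simp: app_def intro: in_L2_Cauchy_Schwarz g)
  then have "AE x in F. norm ((app A g x)\<^sup>2) \<le> norm ((\<integral>y. (A (x, y))\<^sup>2 \<partial>F) * (\<integral>y. (g y)\<^sup>2 \<partial>F))"
    by eventually_elim auto
  then have "integrable F (\<lambda>x. (app A g x)\<^sup>2)"
    by (rule Bochner_Integration.integrable_bound[rotated 2])
      (auto intro!: integrable_mult_left integrable_row[OF A])
  then show ?thesis by (simp add: in_L2_def)
qed

text \<open>Submultiplicativity of the Hilbert-Schmidt norm: Cauchy-Schwarz bounds each entry by a
  row norm of \<open>A\<close> times a column norm of \<open>K\<close>.\<close>

lemma kcomp_L2:
  assumes A: "in_L2 FF A" and K: "in_L2 FF K"
  shows "in_L2 FF (kcomp A K)"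
    and "(\<integral>w. (kcomp A K w)\<^sup>2 \<partial>FF) \<le> (\<integral>w. (A w)\<^sup>2 \<partial>FF) * (\<integral>w. (K w)\<^sup>2 \<partial>FF)"
proof -
  have [measurable]: "A \<in> borel_measurable FF" "K \<in> borel_measurable FF" using A K by (auto simp: in_L2_def)
  let ?b = "\<lambda>w. (\<integral>z. (A (fst w, z))\<^sup>2 \<partial>F) * (\<integral>z. (K (z, snd w))\<^sup>2 \<partial>F)"
  have le: "AE w in FF. (kcomp A K w)\<^sup>2 \<le> ?b w"
    using AE_fst[OF AE_row_L2[OF A]] AE_snd[OF AE_col_L2[OF K]]
    by eventually_elim (auto simp: kcomp_def intro: in_L2_Cauchy_Schwarz)
  have i: "integrable FF ?b"
    by (rule integrable_tensor[OF integrable_row[OF A] integrable_col[OF K]])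
  have i2: "integrable FF (\<lambda>w. (kcomp A K w)\<^sup>2)"
    by (rule Bochner_Integration.integrable_bound[OF i]) (use le in \<open>auto elim!: eventually_mono\<close>)
  then show "in_L2 FF (kcomp A K)" by (simp add: in_L2_def)
  have "(\<integral>w. (kcomp A K w)\<^sup>2 \<partial>FF) \<le> (\<integral>w. ?b w \<partial>FF)"
    by (intro integral_mono_AE i i2 le)
  also have "\<dots> = (\<integral>x. (\<integral>z. (A (x, z))\<^sup>2 \<partial>F) \<partial>F) * (\<integral>y. (\<integral>z. (K (z, y))\<^sup>2 \<partial>F) \<partial>F)"
    using FF.integral_fst'[OF i] by simp
  finally show "(\<integral>w. (kcomp A K w)\<^sup>2 \<partial>FF) \<le> (\<integral>w. (A w)\<^sup>2 \<partial>FF) * (\<integral>w. (K w)\<^sup>2 \<partial>FF)"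
    by (simp add: integral_row[OF A] integral_col[OF K])
qed

text \<open>The two orders of integration of one double integral. Comparing them yields both
  self-adjointness and associativity below.\<close>

lemma
  assumes K: "in_L2 FF K" and a: "in_L2 F a" and g: "in_L2 F g"
  shows inner_app: "(\<integral>z. a z * app K g z \<partial>F) = (\<integral>w. K w * (a (fst w) * g (snd w)) \<partial>FF)"
    and inner_app': "(\<integral>w. (\<integral>z. a z * K (z, w) \<partial>F) * g w \<partial>F) = (\<integral>w. K w * (a (fst w) * g (snd w)) \<partial>FF)"
proof -
  have i: "integrable FF (\<lambda>w. K w * (a (fst w) * g (snd w)))"
    by (intro in_L2_mult_integrable K tensor_L2 a g)
  then have i': "integrable FF (\<lambda>(x, y). K (x, y) * (a x * g y))" by (simp add: case_prod_beta')
  have "(\<integral>z. a z * app K g z \<partial>F) = (\<integral>x. \<integral>y. K (x, y) * (a x * g y) \<partial>F \<partial>F)"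
    unfolding app_def by (subst integral_mult_right_zero[symmetric]) (simp add: mult_ac)
  then show "(\<integral>z. a z * app K g z \<partial>F) = (\<integral>w. K w * (a (fst w) * g (snd w)) \<partial>FF)"
    using FF.integral_fst'[OF i] by simp
  have "(\<integral>w. (\<integral>z. a z * K (z, w) \<partial>F) * g w \<partial>F) = (\<integral>y. \<integral>x. K (x, y) * (a x * g y) \<partial>F \<partial>F)"
    by (subst integral_mult_left_zero[symmetric]) (simp add: mult_ac)
  then show "(\<integral>w. (\<integral>z. a z * K (z, w) \<partial>F) * g w \<partial>F) = (\<integral>w. K w * (a (fst w) * g (snd w)) \<partial>FF)"
    using FF.integral_snd[OF i'] by (simp add: case_prod_beta')
qed

lemma app_self_adjoint:
  assumes A: "in_L2 FF A" and sym: "\<And>x y. A (x, y) = A (y, x)" and f: "in_L2 F f" and g: "in_L2 F g"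
  shows "(\<integral>x. app A f x * g x \<partial>F) = (\<integral>x. f x * app A g x \<partial>F)"
proof -
  have "(\<integral>x. f x * app A g x \<partial>F) = (\<integral>w. (\<integral>z. f z * A (z, w) \<partial>F) * g w \<partial>F)"
    by (simp add: inner_app[OF A f g] inner_app'[OF A f g])
  also have "(\<lambda>w. \<integral>z. f z * A (z, w) \<partial>F) = app A f"
    by (auto simp: app_def sym[of _ "_"] mult.commute)
  finally show ?thesis by simp
qed

text \<open>Stated for a single row of \<open>A\<close>, so that it can be used at almost every
  \<open>x\<close> without losing control of the exceptional set.\<close>

lemma kcomp_app_assoc:
  assumes A: "in_L2 F (\<lambda>z. A (x, z))" and K: "in_L2 FF K" and g: "in_L2 F g"
  shows "app A (app K g) x = app (kcomp A K) g x"
  using inner_app[OF K A g] inner_app'[OF K A g]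
  by (simp add: app_def[of A] app_def[of "kcomp A K"] kcomp_def)

lemma kcomp_assoc:
  assumes A: "in_L2 FF A" and K: "in_L2 FF K" and L: "in_L2 FF L"
  shows "AE w in FF. kcomp A (kcomp K L) w = kcomp (kcomp A K) L w"
  using AE_fst[OF AE_row_L2[OF A]] AE_snd[OF AE_col_L2[OF L]]
proof eventually_elim
  case (elim w)
  obtain x y where w: "w = (x, y)" by force
  have "(\<lambda>z. kcomp K L (z, y)) = app K (\<lambda>z. L (z, y))" by (auto simp: kcomp_app)
  then show ?case
    using kcomp_app_assoc[OF elim(1)[unfolded w fst_conv] K elim(2)[unfolded w snd_conv]] by (simp add: w kcomp_app)
qed

text \<open>Composition with \<open>A\<close> from the left acts on each column of a kernel as the
  operator \<open>app A\<close>; self-adjointness of the latter is integrated over the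
  columns.\<close>

lemma kcomp_self_adjoint:
  assumes A: "in_L2 FF A" and sym: "\<And>x y. A (x, y) = A (y, x)" and K: "in_L2 FF K" and L: "in_L2 FF L"
  shows "(\<integral>w. kcomp A K w * L w \<partial>FF) = (\<integral>w. K w * kcomp A L w \<partial>FF)"
proof -
  have [measurable]: "A \<in> borel_measurable FF" "K \<in> borel_measurable FF" "L \<in> borel_measurable FF"
    using A K L by (auto simp: in_L2_def)
  have i1: "integrable FF (\<lambda>(x, y). kcomp A K (x, y) * L (x, y))"
    using in_L2_mult_integrable[OF kcomp_L2(1)[OF A K] L] by (simp add: case_prod_beta')
  have i2: "integrable FF (\<lambda>(x, y). K (x, y) * kcomp A L (x, y))"
    using in_L2_mult_integrable[OF K kcomp_L2(1)[OF A L]] by (simp add: case_prod_beta')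
  have "(\<integral>w. kcomp A K w * L w \<partial>FF) = (\<integral>y. \<integral>x. app A (\<lambda>z. K (z, y)) x * L (x, y) \<partial>F \<partial>F)"
    using FF.integral_snd[OF i1, unfolded case_prod_beta' prod.collapse] by (simp add: kcomp_app)
  also have "\<dots> = (\<integral>y. \<integral>x. K (x, y) * app A (\<lambda>z. L (z, y)) x \<partial>F \<partial>F)"
  proof (rule integral_cong_AE)
    show "AE y in F. (\<integral>x. app A (\<lambda>z. K (z, y)) x * L (x, y) \<partial>F) = (\<integral>x. K (x, y) * app A (\<lambda>z. L (z, y)) x \<partial>F)"
      using AE_col_L2[OF K] AE_col_L2[OF L]
      by eventually_elim (rule app_self_adjoint[OF A sym])
  qed (simp_all add: kcomp_app[symmetric])
  also have "\<dots> = (\<integral>w. K w * kcomp A L w \<partial>FF)"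
    using FF.integral_snd[OF i2, unfolded case_prod_beta' prod.collapse] by (simp add: kcomp_app)
  finally show ?thesis .
qed

lemma kcomp_diff:
  assumes A: "in_L2 FF A" and K: "in_L2 FF K" and L: "in_L2 FF L"
  shows "AE w in FF. kcomp A (\<lambda>w. K w - c * L w) w = kcomp A K w - c * kcomp A L w"
  using AE_fst[OF AE_row_L2[OF A]] AE_snd[OF AE_col_L2[OF K]] AE_snd[OF AE_col_L2[OF L]]
proof eventually_elim
  case (elim w)
  have "integrable F (\<lambda>z. A (fst w, z) * K (z, snd w))" "integrable F (\<lambda>z. A (fst w, z) * L (z, snd w))"
    by (intro in_L2_mult_integrable elim)+
  then show ?case by (simp add: kcomp_def right_diff_distrib mult.left_commute)
qed

lemma app_linear:
  assumes A: "in_L2 FF A" and f: "in_L2 F f" and g: "in_L2 F g"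
  shows "AE x in F. app A (\<lambda>x. f x + c * g x) x = app A f x + c * app A g x"
  using AE_row_L2[OF A]
proof eventually_elim
  case (elim x)
  have "integrable F (\<lambda>z. A (x, z) * f z)" "integrable F (\<lambda>z. A (x, z) * g z)"
    by (intro in_L2_mult_integrable elim f g)+
  then show ?case by (simp add: app_def distrib_left mult.left_commute)
qed

text \<open>\<open>kcomp\<close> integrates along columns, so the exceptional set in the product has
  to be sliced into columns by Fubini.\<close>

lemma kcomp_cong_AE:
  assumes A: "A \<in> borel_measurable FF" and K: "K \<in> borel_measurable FF" and L: "L \<in> borel_measurable FF"
    and eq: "AE w in FF. K w = L w"
  shows "AE w in FF. kcomp A K w = kcomp A L w"
proof -
  note [measurable] = A K L
  have "AE x in F. AE y in F. K (x, y) = L (x, y)"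
    using FF.AE_pair[OF eq] .
  then have "AE y in F. AE x in F. K (x, y) = L (x, y)"
    by (subst (asm) FF.AE_commute) measurable
  from AE_snd[OF this] AE_space show ?thesis
  proof eventually_elim
    case (elim w)
    then have "snd w \<in> space F" "fst w \<in> space F" by (auto simp: space_pair_measure)
    then show ?case unfolding kcomp_def using elim(1)
      by (intro integral_cong_AE) auto
  qed
qed

text \<open>Indicators of rectangles are products of square-integrable functions; Dynkin's argument
  extends the vanishing integrals to all measurable sets, in particular to the sets where
  \<open>R\<close> is positive and where it is not.\<close>

lemma kernel_zero_if_rectangles_zero:
  assumes R: "in_L2 FF R"
    and zero: "\<And>f g. in_L2 F f \<Longrightarrow> in_L2 F g \<Longrightarrow> (\<integral>w. R w * (f (fst w) * g (snd w)) \<partial>FF) = 0"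
  shows "AE w in FF. R w = 0"
proof -
  have [measurable]: "R \<in> borel_measurable FF" using R by (simp add: in_L2_def)
  have iR: "integrable FF R" by (rule FF.P.in_L2_integrable[OF R])
  have ind: "in_L2 F (indicator A)" if "A \<in> sets F" for A
    using that by (auto simp: in_L2_def power2_eq_square less_top[symmetric] simp flip: indicator_inter_arith
        intro!: integrable_real_indicator)
  have whole: "(\<integral>w. R w \<partial>FF) = 0"
    using zero[OF in_L2_const in_L2_const, of 1 1] by simp
  have E: "(LINT w:E|FF. R w) = 0" if "E \<in> sets FF" for E
    using Int_stable_pair_measure_generator pair_measure_closed that
    unfolding sets_pair_measure
  proof (induct rule: sigma_sets_induct_disjoint)
    case (basic A)
    then obtain a b where ab: "A = a \<times> b" "a \<in> sets F" "b \<in> sets F" by auto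
    have "(LINT w:A|FF. R w) = (\<integral>w. R w * (indicator a (fst w) * indicator b (snd w)) \<partial>FF)"
      unfolding set_lebesgue_integral_def ab
      by (intro Bochner_Integration.integral_cong refl) (auto simp: indicator_def)
    also have "\<dots> = 0" by (intro zero ind ab)
    finally show ?case .
  next
    case empty
    then show ?case by (simp add: set_lebesgue_integral_def)
  next
    case (compl A)
    then have A: "A \<in> sets FF" by (simp add: sets_pair_measure)
    have "(LINT w:space F \<times> space F - A|FF. R w) = (\<integral>w. R w - indicator A w *\<^sub>R R w \<partial>FF)"
      unfolding set_lebesgue_integral_def
      by (intro Bochner_Integration.integral_cong refl) (auto simp: indicator_def space_pair_measure)
    also have "\<dots> = (\<integral>w. R w \<partial>FF) - (LINT w:A|FF. R w)"
      unfolding set_lebesgue_integral_def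
      using A iR by (intro Bochner_Integration.integral_diff integrable_mult_indicator) auto
    finally show ?case using compl whole by simp
  next
    case (union A)
    then have A: "\<And>i. A i \<in> sets FF" by (auto simp: sets_pair_measure)
    have "(LINT w:(\<Union>i. A i)|FF. R w) = (\<Sum>i. LINT w:A i|FF. R w)"
    proof (rule lebesgue_integral_countable_add)
      show "set_integrable FF (\<Union>i. A i) R"
        unfolding set_integrable_def using A iR by (intro integrable_mult_indicator) auto
    qed (use A union in \<open>auto simp: disjoint_family_on_def\<close>)
    then show ?case using union by simp
  qed
  have "(\<integral>w. \<bar>R w\<bar> \<partial>FF) = (\<integral>w. indicator {w\<in>space FF. R w > 0} w *\<^sub>R R w - indicator {w\<in>space FF. R w \<le> 0} w *\<^sub>R R w \<partial>FF)"
    by (intro Bochner_Integration.integral_cong refl) (auto simp: indicator_def)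
  also have "\<dots> = (LINT w:{w\<in>space FF. R w > 0}|FF. R w) - (LINT w:{w\<in>space FF. R w \<le> 0}|FF. R w)"
    unfolding set_lebesgue_integral_def
    using iR by (intro Bochner_Integration.integral_diff integrable_mult_indicator) auto
  also have "\<dots> = 0" by (simp add: E)
  finally show ?thesis
    using iR integral_nonneg_eq_0_iff_AE[of FF "\<lambda>w. \<bar>R w\<bar>"] by simp
qed

end

section \<open>Existence of an eigenfunction\<close>

text \<open>
  With \<open>a n\<close> the squared Hilbert-Schmidt norm of \<open>R\<^sup>n\<^sup>+\<^sup>1\<close>, log-convexity makes the ratios \<open>a (n+1) / a n\<close>
  increase to some \<open>r\<close>, and submultiplicativity forces \<open>a n \<ge> r\<^sup>n\<^sup>+\<^sup>1\<close>: otherwise the subsequence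
  \<open>a (2\<^sup>j (n+1) - 1) \<le> (a n)^(2\<^sup>j)\<close> would decay geometrically faster than the ratios allow.
\<close>

lemma log_convex_geometric_lower_bound:
  fixes a :: "nat \<Rightarrow> real"
  assumes pos: "\<And>n. a n > 0" and convex: "\<And>n. (a (Suc n))\<^sup>2 \<le> a n * a (Suc (Suc n))"
    and bound: "\<And>n. a (Suc n) \<le> B * a n"
    and submult: "\<And>n. a (2 * n + 1) \<le> (a n)\<^sup>2"
  obtains r s where "r > 0" "decseq (\<lambda>n. a n / r ^ n)" "(\<lambda>n. a n / r ^ n) \<longlonglongrightarrow> s" "s > 0"
proof -
  define \<rho> where "\<rho> n = a (Suc n) / a n" for n
  have \<rho>_pos: "\<rho> n > 0" for n using pos by (simp add: \<rho>_def)
  have "\<rho> n \<le> \<rho> (Suc n)" for n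
    using convex[of n] pos[of n] pos[of "Suc n"] by (simp add: \<rho>_def field_simps power2_eq_square)
  then have inc: "incseq \<rho>" by (rule incseq_SucI)
  have "\<rho> n \<le> B" for n using bound[of n] pos[of n] by (simp add: \<rho>_def field_simps)
  then obtain r where r: "\<rho> \<longlonglongrightarrow> r" "\<And>n. \<rho> n \<le> r"
    using incseq_convergent[OF inc, of B] by auto
  have r0: "r > 0" using r(2)[of 0] \<rho>_pos[of 0] by simp
  \<comment> \<open>The shift by one reflects that index \<open>n\<close> stands for the power
    \<open>n + 1\<close>; doubling the power sends the index to \<open>2 * n + 1\<close>.\<close>
  have pow2: "a (2 ^ j * Suc n - 1) \<le> a n ^ (2 ^ j)" for j n
  proof (induction j)
    case (Suc j)
    define N where "N = 2 ^ j * Suc n - 1"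
    have "Suc N = 2 ^ j * Suc n" by (simp add: N_def)
    then have "2 ^ Suc j * Suc n = 2 * Suc N" by (simp only: power_Suc mult.assoc)
    then have "2 ^ Suc j * Suc n - 1 = 2 * N + 1" by (simp only:) simp
    then have "a (2 ^ Suc j * Suc n - 1) \<le> (a N)\<^sup>2" using submult[of N] by simp
    also have "\<dots> \<le> (a n ^ (2 ^ j))\<^sup>2"
      using Suc pos[of N] by (intro power_mono) (auto simp: N_def less_imp_le)
    also have "\<dots> = a n ^ (2 ^ Suc j)" by (simp add: power_mult[symmetric] mult.commute)
    finally show ?case .
  qed simp
  have ge: "a n \<ge> q ^ Suc n" if q: "0 < q" "q < r" for q n
  proof (rule ccontr)
    assume "\<not> a n \<ge> q ^ Suc n"
    then have lt: "a n < q ^ Suc n" by simp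
    from order_tendstoD(1)[OF r(1) q(2)] obtain M where M: "\<And>i. i \<ge> M \<Longrightarrow> q < \<rho> i"
      by (auto simp: eventually_sequentially)
    have lower: "a M * q ^ i \<le> a (M + i)" for i
    proof (induction i)
      case (Suc i)
      have "a M * q ^ Suc i \<le> a (M + i) * q" using Suc q by (simp add: mult_right_mono)
      also have "\<dots> \<le> a (M + i) * \<rho> (M + i)"
        using M[of "M + i"] pos[of "M + i"] by (intro mult_left_mono) auto
      also have "\<dots> = a (M + Suc i)" using pos[of "M + i"] by (simp add: \<rho>_def)
      finally show ?case .
    qed simp
    define \<theta> where "\<theta> = a n / q ^ Suc n"
    have \<theta>: "0 \<le> \<theta>" "\<theta> < 1" using lt q pos[of n] by (auto simp: \<theta>_def)
    \<comment> \<open>This is the lower bound \<open>a M * q ^ (N - M)\<close> for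
      \<open>a N\<close>, divided by \<open>q ^ Suc N\<close>; it does not depend on
      \<open>N\<close>, whereas the upper bound tends to zero.\<close>
    define C where "C = a M / q ^ M / q"
    have Cpos: "C > 0" using pos q by (simp add: C_def)
    have bd: "C \<le> \<theta> ^ (2 ^ j)" if j: "2 ^ j * Suc n - 1 \<ge> M" for j
    proof -
      define N where "N = 2 ^ j * Suc n - 1"
      have N1: "Suc N = 2 ^ j * Suc n" by (simp add: N_def)
      have NM: "M \<le> N" using j by (simp only: N_def)
      have "a M / q ^ M * q ^ N \<le> a N"
        using lower[of "N - M"] NM q by (simp add: power_diff)
      also have "\<dots> \<le> a n ^ (2 ^ j)" using pow2[of j n] by (simp add: N_def)
      finally have "a M / q ^ M * q ^ N / q ^ Suc N \<le> a n ^ (2 ^ j) / q ^ Suc N"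
        using q by (intro divide_right_mono) auto
      also have "q ^ Suc N = (q ^ Suc n) ^ (2 ^ j)"
        unfolding N1 by (simp add: power_mult[symmetric] mult.commute del: power_Suc)
      finally have "a M / q ^ M * q ^ N / (q ^ Suc n) ^ (2 ^ j) \<le> \<theta> ^ (2 ^ j)"
        by (simp add: \<theta>_def power_divide)
      moreover have "a M / q ^ M * q ^ N / (q ^ Suc n) ^ (2 ^ j) = C"
      proof -
        have "(q ^ Suc n) ^ (2 ^ j) = q ^ Suc N"
          unfolding N1 by (simp add: power_mult[symmetric] mult.commute del: power_Suc)
        then show ?thesis using q by (simp add: C_def field_simps)
      qed
      ultimately show ?thesis by simp
    qed
    have "(\<lambda>j. \<theta> ^ (2 ^ j)) \<longlonglongrightarrow> 0"
    proof -
      have "strict_mono (\<lambda>j::nat. 2 ^ j :: nat)" by (auto intro: strict_monoI)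
      from LIMSEQ_subseq_LIMSEQ[OF LIMSEQ_power_zero this, of \<theta>] \<theta> show ?thesis
        by (simp add: comp_def)
    qed
    moreover have "\<forall>\<^sub>F j in sequentially. C \<le> \<theta> ^ (2 ^ j)"
    proof (rule eventually_sequentiallyI[of "Suc M"])
      fix j assume "Suc M \<le> j"
      moreover have "j < 2 ^ j" by (rule less_exp)
      moreover have "2 ^ j * 1 \<le> 2 ^ j * Suc n" by (intro mult_le_mono) auto
      ultimately have "M \<le> 2 ^ j * Suc n - 1" by linarith
      then show "C \<le> \<theta> ^ (2 ^ j)" by (rule bd)
    qed
    ultimately have "C \<le> 0"
      by (intro tendsto_lowerbound) auto
    then show False using Cpos by simp
  qed
  \<comment> \<open>The ratios are only known to exceed each \<open>q < r\<close> eventually, so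
    \<open>r\<close> itself is reached as a limit from the left.\<close>
  have ge_r: "a n \<ge> r ^ Suc n" for n
  proof (rule tendsto_upperbound)
    show "((\<lambda>q. q ^ Suc n) \<longlongrightarrow> r ^ Suc n) (at_left r)" by (intro tendsto_intros)
    show "\<forall>\<^sub>F q in at_left r. q ^ Suc n \<le> a n"
      using eventually_at_left_real[OF r0] by eventually_elim (use ge in auto)
  qed simp
  have dec: "decseq (\<lambda>n. a n / r ^ n)"
  proof (rule decseq_SucI)
    fix n
    have "a (Suc n) \<le> r * a n" using r(2)[of n] pos[of n] by (simp add: \<rho>_def field_simps)
    then show "a (Suc n) / r ^ Suc n \<le> a n / r ^ n" using r0 by (simp add: field_simps)
  qed
  \<comment> \<open>The surplus factor in \<open>r ^ Suc n\<close> bounds the normalized sequence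
    away from zero, which will keep the limit kernel nonzero.\<close>
  have low: "r \<le> a n / r ^ n" for n using ge_r[of n] r0 by (simp add: field_simps)
  obtain s where s: "(\<lambda>n. a n / r ^ n) \<longlonglongrightarrow> s"
    by (rule decseq_convergent[OF dec, of r]) (use low in blast)+
  have "r \<le> s" by (rule LIMSEQ_le_const[OF s]) (use low in auto)
  with r0 have "s > 0" by simp
  with r0 dec s show ?thesis by (rule that)
qed

context L2_kernel_space
begin

text \<open>Power iteration. Inner products of iterates depend only on the sum of their exponents,
  so the Cauchy property of the normalized kernels reduces to convergence of the scalar sequence
  \<open>a n / r ^ n\<close>.\<close>

lemma exists_eigenfunction:
  assumes R: "in_L2 FF R" and sym: "\<And>x y. R (x, y) = R (y, x)" and R0: "(\<integral>w. (R w)\<^sup>2 \<partial>FF) \<noteq> 0"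
  obtains \<mu> g where "\<mu> \<noteq> 0" "in_L2 F g" "(\<integral>x. (g x)\<^sup>2 \<partial>F) \<noteq> 0" "AE x in F. app R g x = \<mu> * g x"
proof -
  have [measurable]: "R \<in> borel_measurable FF" using R by (simp add: in_L2_def)
  \<comment> \<open>\<open>K n\<close> is the kernel of the power \<open>n + 1\<close> of the
    operator.\<close>
  define K where "K n = (kcomp R ^^ n) R" for n
  have K_Suc: "K (Suc n) = kcomp R (K n)" and K_0: "K 0 = R" for n by (simp_all add: K_def)
  have KL: "in_L2 FF (K n)" for n
    by (induction n) (auto simp: K_0 K_Suc R intro: kcomp_L2)
  have [measurable]: "K n \<in> borel_measurable FF" for n using KL by (simp add: in_L2_def)
  define \<tau> where "\<tau> k = (\<integral>w. K 0 w * K k w \<partial>FF)" for k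
  have inner: "(\<integral>w. K m w * K n w \<partial>FF) = \<tau> (m + n)" for m n
  proof (induction m arbitrary: n)
    case (Suc m)
    have "(\<integral>w. K (Suc m) w * K n w \<partial>FF) = (\<integral>w. K m w * K (Suc n) w \<partial>FF)"
      unfolding K_Suc by (rule kcomp_self_adjoint[OF R sym KL KL])
    then show ?case using Suc[of "Suc n"] by simp
  qed (simp add: \<tau>_def)
  define a where "a n = \<tau> (2 * n)" for n
  have a_norm: "a n = (\<integral>w. (K n w)\<^sup>2 \<partial>FF)" for n
    using inner[of n n] by (simp add: a_def power2_eq_square mult_2)
  have a_nonneg: "a n \<ge> 0" for n by (simp add: a_norm)
  have convex: "(a (Suc n))\<^sup>2 \<le> a n * a (Suc (Suc n))" for n
  proof -
    have "(a (Suc n))\<^sup>2 = (\<integral>w. K n w * K (Suc (Suc n)) w \<partial>FF)\<^sup>2"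
      by (simp add: inner a_def mult_2)
    also have "\<dots> \<le> a n * a (Suc (Suc n))"
      unfolding a_norm by (rule in_L2_Cauchy_Schwarz[OF KL KL])
    finally show ?thesis .
  qed
  have bound: "a (Suc n) \<le> a 0 * a n" for n
    unfolding a_norm K_Suc K_0 by (rule kcomp_L2(2)[OF R KL])
  \<comment> \<open>If the square of the operator vanished, self-adjointness would make the squared
    norm of \<open>app R g\<close> equal to the pairing of \<open>g\<close> with
    \<open>app R (app R g)\<close>, hence zero for every \<open>g\<close>, and \<open>R\<close>
    would vanish on all products.\<close>
  have a1: "a 1 \<noteq> 0"
  proof
    assume "a 1 = 0"
    then have z: "AE w in FF. kcomp R R w = 0"
      using KL[of 1] by (intro AE_zero_of_L2_norm_zero) (auto simp: a_norm K_Suc K_0)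
    have app0: "(\<integral>x. (app R g x)\<^sup>2 \<partial>F) = 0" if g: "in_L2 F g" for g
    proof -
      have [measurable]: "g \<in> borel_measurable F" using g by (simp add: in_L2_def)
      have "(\<integral>x. (app R g x)\<^sup>2 \<partial>F) = (\<integral>x. app R g x * app R g x \<partial>F)" by (simp add: power2_eq_square)
      also have "\<dots> = (\<integral>x. g x * app R (app R g) x \<partial>F)"
        by (rule app_self_adjoint[OF R sym g app_L2[OF R g]])
      also have "\<dots> = (\<integral>x. g x * app (kcomp R R) g x \<partial>F)"
      proof (rule integral_cong_AE)
        show "AE x in F. g x * app R (app R g) x = g x * app (kcomp R R) g x"
          using AE_row_L2[OF R] by eventually_elim (simp add: kcomp_app_assoc[OF _ R g])
      qed measurable
      also have "\<dots> = (\<integral>w. kcomp R R w * (g (fst w) * g (snd w)) \<partial>FF)"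
        by (rule inner_app[OF kcomp_L2(1)[OF R R] g g])
      also have "\<dots> = (\<integral>w. 0 \<partial>FF)"
        by (intro integral_cong_AE) (use z in auto)
      finally show ?thesis by simp
    qed
    have "AE w in FF. R w = 0"
    proof (rule kernel_zero_if_rectangles_zero[OF R])
      fix f g assume f: "in_L2 F f" and g: "in_L2 F g"
      have "(\<integral>w. R w * (f (fst w) * g (snd w)) \<partial>FF) = (\<integral>z. f z * app R g z \<partial>F)"
        by (rule inner_app[OF R f g, symmetric])
      also have "\<dots> = 0"
        using in_L2_Cauchy_Schwarz[OF f app_L2[OF R g]] app0[OF g] by simp
      finally show "(\<integral>w. R w * (f (fst w) * g (snd w)) \<partial>FF) = 0" .
    qed
    then have "(\<integral>w. (R w)\<^sup>2 \<partial>FF) = (\<integral>w. 0 \<partial>FF)"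
      by (intro integral_cong_AE) auto
    with R0 show False by simp
  qed
  \<comment> \<open>Log-convexity propagates positivity, but needs two consecutive positive terms to
    start.\<close>
  have pos2: "a n > 0 \<and> a (Suc n) > 0" for n
  proof (induction n)
    case 0
    then show ?case using R0 a1 a_nonneg[of 0] a_nonneg[of 1] by (auto simp: a_norm K_0 less_le)
  next
    case (Suc n)
    then have "a n * a (Suc (Suc n)) > 0" using convex[of n] by (auto intro: less_le_trans[rotated])
    then show ?case using Suc by (simp add: zero_less_mult_iff)
  qed
  have power: "AE w in FF. K (Suc (m + n)) w = kcomp (K m) (K n) w" for m n
  proof (induction m)
    case 0
    show ?case by (simp add: K_Suc K_0)
  next
    case (Suc m)
    have "AE w in FF. kcomp R (K (Suc (m + n))) w = kcomp R (kcomp (K m) (K n)) w"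
      by (intro kcomp_cong_AE Suc) auto
    with kcomp_assoc[OF R KL KL, of m n] show ?case
      by eventually_elim (simp add: K_Suc)
  qed
  have submult: "a (2 * n + 1) \<le> (a n)\<^sup>2" for n
  proof -
    have "a (2 * n + 1) = (\<integral>w. (kcomp (K n) (K n) w)\<^sup>2 \<partial>FF)"
      unfolding a_norm
      by (intro integral_cong_AE) (use power[of n n] in \<open>auto elim!: eventually_mono simp: mult_2\<close>)
    also have "\<dots> \<le> a n * a n"
      unfolding a_norm by (rule kcomp_L2(2)[OF KL KL])
    finally show ?thesis by (simp add: power2_eq_square)
  qed
  obtain r s where r: "r > 0" and dec: "decseq (\<lambda>n. a n / r ^ n)"
    and s: "(\<lambda>n. a n / r ^ n) \<longlonglongrightarrow> s" "s > 0"
    using log_convex_geometric_lower_bound[of a "a 0"] pos2 convex bound submult by blast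
  \<comment> \<open>Since \<open>a n\<close> is the squared norm of \<open>K n\<close>, the even
    indices make the inner product of \<open>P m\<close> and \<open>P n\<close> exactly
    \<open>a (m + n) / r ^ (m + n)\<close>.\<close>
  define P where "P n w = (1 / r ^ n) * K (2 * n) w" for n w
  have PL: "in_L2 FF (P n)" for n unfolding P_def by (intro in_L2_cmult KL)
  have [measurable]: "P n \<in> borel_measurable FF" for n using PL by (simp add: in_L2_def)
  have Pinner: "(\<integral>w. P m w * P n w \<partial>FF) = a (m + n) / r ^ (m + n)" for m n
  proof -
    have "(\<integral>w. P m w * P n w \<partial>FF) = (\<integral>w. (1 / r ^ m * (1 / r ^ n)) * (K (2 * m) w * K (2 * n) w) \<partial>FF)"
      by (intro Bochner_Integration.integral_cong refl) (simp add: P_def mult_ac)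
    also have "\<dots> = (1 / r ^ m * (1 / r ^ n)) * \<tau> (2 * m + 2 * n)"
      by (simp only: integral_mult_right_zero inner)
    finally show ?thesis by (simp add: a_def power_add distrib_left)
  qed
  have Pdiff: "(\<integral>w. (P m w - P n w)\<^sup>2 \<partial>FF) = a (2*m) / r ^ (2*m) - 2 * (a (m+n) / r ^ (m+n)) + a (2*n) / r ^ (2*n)" for m n
  proof -
    have "(\<integral>w. (P m w - P n w)\<^sup>2 \<partial>FF) = (\<integral>w. P m w * P m w - 2 * (P m w * P n w) + P n w * P n w \<partial>FF)"
      by (intro Bochner_Integration.integral_cong refl) (simp add: power2_eq_square algebra_simps)
    also have "\<dots> = (\<integral>w. P m w * P m w \<partial>FF) - 2 * (\<integral>w. P m w * P n w \<partial>FF) + (\<integral>w. P n w * P n w \<partial>FF)"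
      using in_L2_mult_integrable[OF PL PL] by simp
    finally show ?thesis by (simp only: Pinner mult_2)
  qed
  have "\<exists>N. \<forall>m\<ge>N. \<forall>n\<ge>N. (\<integral>w. (P m w - P n w)\<^sup>2 \<partial>FF) < e" if e: "e > 0" for e
  proof -
    have "e / 4 > 0" using e by simp
    from LIMSEQ_D[OF s(1) this] obtain N where N: "\<And>n. n \<ge> N \<Longrightarrow> \<bar>a n / r ^ n - s\<bar> < e / 4" by auto
    show ?thesis
    proof (intro exI[of _ N] allI impI)
      fix m n assume "m \<ge> N" "n \<ge> N"
      then show "(\<integral>w. (P m w - P n w)\<^sup>2 \<partial>FF) < e"
        unfolding Pdiff using N[of "2*m"] N[of "m+n"] N[of "2*n"] by linarith
    qed
  qed
  from FF.P.L2_complete[OF PL this] obtain L where L: "in_L2 FF L"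
    and lim: "(\<lambda>n. \<integral>w. (P n w - L w)\<^sup>2 \<partial>FF) \<longlonglongrightarrow> 0" by auto
  have [measurable]: "L \<in> borel_measurable FF" using L by (simp add: in_L2_def)
  have Lnorm: "(\<integral>w. (L w)\<^sup>2 \<partial>FF) \<noteq> 0"
  proof
    assume "(\<integral>w. (L w)\<^sup>2 \<partial>FF) = 0"
    then have "AE w in FF. L w = 0" by (rule AE_zero_of_L2_norm_zero[OF L])
    then have "(\<integral>w. (P n w - L w)\<^sup>2 \<partial>FF) = (\<integral>w. P n w * P n w \<partial>FF)" for n
      by (intro integral_cong_AE) (auto elim!: eventually_mono simp: power2_eq_square)
    with lim have "(\<lambda>n. a (n + n) / r ^ (n + n)) \<longlonglongrightarrow> 0" by (simp add: Pinner)
    moreover have "(\<lambda>n. a (n + n) / r ^ (n + n)) \<longlonglongrightarrow> s"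
      using LIMSEQ_subseq_LIMSEQ[OF s(1), of "\<lambda>n. n + n"] by (simp add: comp_def strict_mono_def)
    ultimately show False using LIMSEQ_unique s(2) by blast
  qed
  \<comment> \<open>Applying \<open>R\<close> twice sends \<open>P n\<close> to
    \<open>r * P (Suc n)\<close>, so the limit should satisfy this relation exactly. The difference
    is controlled by the errors \<open>D n\<close> and \<open>D (Suc n)\<close>.\<close>
  define G where "G w = kcomp R (kcomp R L) w - r * L w" for w
  have GL: "in_L2 FF G" unfolding G_def by (intro in_L2_diff in_L2_cmult kcomp_L2 R L)
  have "(\<integral>w. (G w)\<^sup>2 \<partial>FF) = 0"
  proof -
    define D where "D n w = L w - 1 * P n w" for n w
    have DL: "in_L2 FF (D n)" for n unfolding D_def by (intro in_L2_diff in_L2_cmult L PL)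
    have [measurable]: "D n \<in> borel_measurable FF" for n using DL by (simp add: in_L2_def)
    have Dlim: "(\<lambda>n. \<integral>w. (D n w)\<^sup>2 \<partial>FF) \<longlonglongrightarrow> 0"
      using lim by (simp add: D_def power2_commute)
    have RRP: "kcomp R (kcomp R (P n)) = (\<lambda>w. r * P (Suc n) w)" for n
    proof -
      have c: "kcomp R (\<lambda>w. c * M w) = (\<lambda>w. c * kcomp R M w)" for c M
        by (auto simp: kcomp_def mult.left_commute)
      show ?thesis using r unfolding P_def c by (auto simp: K_Suc)
    qed
    have dec: "AE w in FF. G w = kcomp R (kcomp R (D n)) w + (- r) * D (Suc n) w" for n
    proof -
      have 1: "AE w in FF. kcomp R (D n) w = kcomp R L w - 1 * kcomp R (P n) w"
        unfolding D_def by (rule kcomp_diff[OF R L PL])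
      have "AE w in FF. kcomp R (kcomp R (D n)) w = kcomp R (\<lambda>w. kcomp R L w - 1 * kcomp R (P n) w) w"
        by (rule kcomp_cong_AE[OF _ _ _ 1]) measurable
      moreover have "AE w in FF. kcomp R (\<lambda>w. kcomp R L w - 1 * kcomp R (P n) w) w =
          kcomp R (kcomp R L) w - 1 * kcomp R (kcomp R (P n)) w"
        by (intro kcomp_diff R kcomp_L2 L PL)
      ultimately show ?thesis
        by eventually_elim (simp add: RRP G_def D_def algebra_simps)
    qed
    have le: "(\<integral>w. (G w)\<^sup>2 \<partial>FF) \<le> 2 * (a 0 * (a 0 * (\<integral>w. (D n w)\<^sup>2 \<partial>FF))) + 2 * (r\<^sup>2 * (\<integral>w. (D (Suc n) w)\<^sup>2 \<partial>FF))" for n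
    proof -
      have "(\<integral>w. (G w)\<^sup>2 \<partial>FF) = (\<integral>w. (kcomp R (kcomp R (D n)) w + (- r) * D (Suc n) w)\<^sup>2 \<partial>FF)"
        using GL dec[of n] by (intro integral_cong_AE) (auto simp: in_L2_def elim!: eventually_mono)
      also have "\<dots> \<le> 2 * (\<integral>w. (kcomp R (kcomp R (D n)) w)\<^sup>2 \<partial>FF) + 2 * (\<integral>w. ((- r) * D (Suc n) w)\<^sup>2 \<partial>FF)"
        by (intro integral_square_sum_le kcomp_L2 R DL in_L2_cmult)
      also have "(\<integral>w. (kcomp R (kcomp R (D n)) w)\<^sup>2 \<partial>FF) \<le> a 0 * (\<integral>w. (kcomp R (D n) w)\<^sup>2 \<partial>FF)"
        unfolding a_norm K_0 by (intro kcomp_L2 R DL)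
      also have "(\<integral>w. (kcomp R (D n) w)\<^sup>2 \<partial>FF) \<le> a 0 * (\<integral>w. (D n w)\<^sup>2 \<partial>FF)"
        unfolding a_norm K_0 by (intro kcomp_L2 R DL)
      also have "(\<integral>w. ((- r) * D (Suc n) w)\<^sup>2 \<partial>FF) = r\<^sup>2 * (\<integral>w. (D (Suc n) w)\<^sup>2 \<partial>FF)"
        by (simp add: power_mult_distrib)
      finally show ?thesis using a_nonneg[of 0] by (simp add: mult_left_mono)
    qed
    have "(\<lambda>n. 2 * (a 0 * (a 0 * (\<integral>w. (D n w)\<^sup>2 \<partial>FF))) + 2 * (r\<^sup>2 * (\<integral>w. (D (Suc n) w)\<^sup>2 \<partial>FF)))
        \<longlonglongrightarrow> 2 * (a 0 * (a 0 * 0)) + 2 * (r\<^sup>2 * 0)"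
      by (intro tendsto_intros Dlim LIMSEQ_Suc)
    then have "(\<integral>w. (G w)\<^sup>2 \<partial>FF) \<le> 2 * (a 0 * (a 0 * 0)) + 2 * (r\<^sup>2 * 0)"
      by (rule LIMSEQ_le_const) (use le in auto)
    moreover have "0 \<le> (\<integral>w. (G w)\<^sup>2 \<partial>FF)" by simp
    ultimately show ?thesis by simp
  qed
  then have "AE w in FF. G w = 0" by (rule AE_zero_of_L2_norm_zero[OF GL])
  then have "AE x in F. AE y in F. G (x, y) = 0" by (rule FF.AE_pair)
  then have AEG: "AE y in F. AE x in F. G (x, y) = 0"
    using GL by (subst (asm) FF.AE_commute) (auto simp: in_L2_def)
  \<comment> \<open>If almost every good column of \<open>L\<close> had norm zero, \<open>L\<close>
    would vanish.\<close>
  obtain y where y: "in_L2 F (\<lambda>x. L (x, y))" "AE x in F. G (x, y) = 0" "(\<integral>x. (L (x, y))\<^sup>2 \<partial>F) \<noteq> 0"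
  proof (rule ccontr)
    assume no: "\<not> thesis"
    have "AE y in F. (\<integral>x. (L (x, y))\<^sup>2 \<partial>F) = 0"
      using AE_col_L2[OF L] AEG by eventually_elim (use no that in blast)
    then have "(\<integral>y. \<integral>x. (L (x, y))\<^sup>2 \<partial>F \<partial>F) = (\<integral>y. 0 \<partial>F)"
      by (intro integral_cong_AE) auto
    with Lnorm integral_col[OF L] show False by simp
  qed
  define g where "g x = L (x, y)" for x
  have gL: "in_L2 F g" using y(1) by (simp add: g_def[abs_def])
  have [measurable]: "g \<in> borel_measurable F" using gL by (simp add: in_L2_def)
  have g0: "(\<integral>x. (g x)\<^sup>2 \<partial>F) \<noteq> 0" using y(3) by (simp add: g_def)
  have AAg: "AE x in F. app R (app R g) x = r * g x"
  proof -
    have "(\<lambda>z. kcomp R L (z, y)) = app R g" by (auto simp: kcomp_app g_def[abs_def])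
    with y(2) show ?thesis by (simp add: G_def kcomp_app g_def[abs_def])
  qed
  define \<rho> where "\<rho> = sqrt r"
  have \<rho>: "\<rho> > 0" "\<rho> * \<rho> = r" using r by (auto simp: \<rho>_def)
  \<comment> \<open>Factor the square of \<open>R\<close> minus \<open>\<rho> * \<rho>\<close> as
    \<open>R - \<rho>\<close> times \<open>R + \<rho>\<close>: either \<open>u\<close> is an
    eigenfunction for \<open>\<rho>\<close>, or \<open>u = 0\<close> and \<open>g\<close> is one for
    \<open>- \<rho>\<close>.\<close>
  define u where "u x = app R g x + \<rho> * g x" for x
  have uL: "in_L2 F u" unfolding u_def by (intro in_L2_add in_L2_cmult app_L2 R gL)
  show thesis
  proof (cases "(\<integral>x. (u x)\<^sup>2 \<partial>F) = 0")
    case False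
    have "AE x in F. app R u x = \<rho> * u x"
      using app_linear[OF R app_L2[OF R gL] gL, of \<rho>] AAg
      by eventually_elim (simp add: u_def[abs_def] distrib_left mult.assoc[symmetric] \<rho>)
    with False uL \<rho> show ?thesis by (intro that[of \<rho> u]) auto
  next
    case True
    from AE_zero_of_L2_norm_zero[OF uL True] have "AE x in F. app R g x = (- \<rho>) * g x"
      by eventually_elim (simp add: u_def)
    with gL g0 \<rho> show ?thesis by (intro that[of "- \<rho>" g]) auto
  qed
qed

end

section \<open>Spectral expansion of a symmetric kernel\<close>

context L2_kernel_space
begin

lemma inner_tensor:
  assumes "in_L2 F f" "in_L2 F g" "in_L2 F f'" "in_L2 F g'"
  shows "(\<integral>w. (f (fst w) * g (snd w)) * (f' (fst w) * g' (snd w)) \<partial>FF) =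
    (\<integral>x. f x * f' x \<partial>F) * (\<integral>x. g x * g' x \<partial>F)"
proof -
  have i: "integrable FF (\<lambda>w. (f (fst w) * g (snd w)) * (f' (fst w) * g' (snd w)))"
    by (intro in_L2_mult_integrable tensor_L2 assms)
  have "(\<integral>w. (f (fst w) * g (snd w)) * (f' (fst w) * g' (snd w)) \<partial>FF) =
     (\<integral>x. \<integral>y. (f x * f' x) * (g y * g' y) \<partial>F \<partial>F)"
    using FF.integral_fst'[OF i] by (simp add: mult_ac)
  then show ?thesis by (simp only: integral_mult_right_zero integral_mult_left_zero)
qed

lemma swap_L2:
  assumes "in_L2 FF K"
  shows "in_L2 FF (\<lambda>w. K (snd w, fst w))"
    and "(\<integral>w. (K (snd w, fst w))\<^sup>2 \<partial>FF) = (\<integral>w. (K w)\<^sup>2 \<partial>FF)"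
proof -
  have [measurable]: "K \<in> borel_measurable FF" using assms by (simp add: in_L2_def)
  show "in_L2 FF (\<lambda>w. K (snd w, fst w))"
    using FF.integrable_product_swap[OF in_L2_integrable_square[OF assms]]
    by (simp add: in_L2_def case_prod_beta')
  show "(\<integral>w. (K (snd w, fst w))\<^sup>2 \<partial>FF) = (\<integral>w. (K w)\<^sup>2 \<partial>FF)"
    using FF.integral_product_swap[of "\<lambda>w. (K w)\<^sup>2"] by (simp add: case_prod_beta')
qed

text \<open>Suppose the part \<open>R\<close> of the kernel left over by the expansion were nonzero.
  An eigenfunction of \<open>R\<close> is orthogonal to all \<open>\<phi> j\<close>, hence an
  eigenfunction of \<open>k\<close> for the same eigenvalue; completeness of the enumeration then
  puts it in the span of the \<open>\<phi> j\<close>, so it is zero.\<close>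

theorem spectral_expansion:
  assumes sym: "\<And>x y. k x y = k y x" and kL: "in_L2 FF (\<lambda>w. k (fst w) (snd w))"
    and enum: "eigen_enum F k lam"
  obtains \<phi> where "\<And>j. in_L2 F (\<phi> j)" "\<And>j. lam j = 0 \<Longrightarrow> \<phi> j = (\<lambda>_. 0)"
    "\<And>i j. lam i \<noteq> 0 \<Longrightarrow> lam j \<noteq> 0 \<Longrightarrow> (\<integral>x. \<phi> i x * \<phi> j x \<partial>F) = (if i = j then 1 else 0)"
    "\<And>j. AE x in F. int_op F k (\<phi> j) x = lam j * \<phi> j x"
    "summable (\<lambda>j. (lam j)\<^sup>2)"
    "(\<lambda>N. \<integral>w. (k (fst w) (snd w) - (\<Sum>j<N. lam j * (\<phi> j (fst w) * \<phi> j (snd w))))\<^sup>2 \<partial>FF) \<longlonglongrightarrow> 0"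
proof -
  define A where "A w = k (fst w) (snd w)" for w
  have AL: "in_L2 FF A" using kL by (simp add: A_def[abs_def])
  have Asym: "A (x, y) = A (y, x)" for x y using sym by (simp add: A_def)
  have op: "int_op F k g = app A g" for g by (auto simp: int_op_def app_def A_def)
  from enum obtain \<phi>' where
    \<phi>'L: "\<And>j. lam j \<noteq> 0 \<Longrightarrow> in_L2 F (\<phi>' j)" and
    \<phi>'o: "\<And>i j. lam i \<noteq> 0 \<Longrightarrow> lam j \<noteq> 0 \<Longrightarrow> (\<integral>x. \<phi>' i x * \<phi>' j x \<partial>F) = (if i = j then 1 else 0)" and
    \<phi>'e: "\<And>j. lam j \<noteq> 0 \<Longrightarrow> AE x in F. int_op F k (\<phi>' j) x = lam j * \<phi>' j x" and
    fin: "\<And>\<mu>. \<mu> \<noteq> 0 \<Longrightarrow> finite {j. lam j = \<mu>}" and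
    complete: "\<And>\<mu> g. \<mu> \<noteq> 0 \<Longrightarrow> in_L2 F g \<Longrightarrow> (AE x in F. int_op F k g x = \<mu> * g x) \<Longrightarrow>
            (\<exists>c. AE x in F. g x = (\<Sum>j\<in>{j. lam j = \<mu>}. c j * \<phi>' j x))"
    unfolding eigen_enum_def by blast
  \<comment> \<open>\<open>eigen_enum\<close> leaves the functions with \<open>lam j = 0\<close>
    unspecified, possibly not even measurable; zero is a safe choice.\<close>
  define \<phi> where "\<phi> j = (if lam j = 0 then (\<lambda>_. 0) else \<phi>' j)" for j
  have \<phi>L: "in_L2 F (\<phi> j)" for j using \<phi>'L by (auto simp: \<phi>_def in_L2_zero)
  have \<phi>o: "(\<integral>x. \<phi> i x * \<phi> j x \<partial>F) = (if i = j then 1 else 0)" if "lam i \<noteq> 0" "lam j \<noteq> 0" for i j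
    using \<phi>'o[OF that] that by (simp add: \<phi>_def)
  have \<phi>e: "AE x in F. app A (\<phi> j) x = lam j * \<phi> j x" for j
    using \<phi>'e[of j] by (cases "lam j = 0") (auto simp: \<phi>_def op app_def)
  have [measurable]: "\<phi> j \<in> borel_measurable F" for j using \<phi>L by (simp add: in_L2_def)
  have [measurable]: "A \<in> borel_measurable FF" using AL by (simp add: in_L2_def)
  define T where "T j w = \<phi> j (fst w) * \<phi> j (snd w)" for j w
  have TL: "in_L2 FF (T j)" for j unfolding T_def by (rule tensor_L2[OF \<phi>L \<phi>L])
  have TT: "lam i * lam j * (\<integral>w. T i w * T j w \<partial>FF) = (if i = j then (lam i)\<^sup>2 else 0)" for i j
    unfolding T_def inner_tensor[OF \<phi>L \<phi>L \<phi>L \<phi>L] using \<phi>o[of i j] by (cases "lam i = 0"; cases "lam j = 0") (auto simp: power2_eq_square)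
  have inner_A: "(\<integral>w. A w * (f (fst w) * \<phi> j (snd w)) \<partial>FF) = lam j * (\<integral>x. f x * \<phi> j x \<partial>F)"
    if f: "in_L2 F f" for f j
  proof -
    have [measurable]: "f \<in> borel_measurable F" using f by (simp add: in_L2_def)
    have "(\<integral>w. A w * (f (fst w) * \<phi> j (snd w)) \<partial>FF) = (\<integral>x. f x * app A (\<phi> j) x \<partial>F)"
      by (rule inner_app[OF AL f \<phi>L, symmetric])
    also have "\<dots> = (\<integral>x. lam j * (f x * \<phi> j x) \<partial>F)"
      by (intro integral_cong_AE) (use \<phi>e[of j] in \<open>auto elim!: eventually_mono\<close>)
    finally show ?thesis by simp
  qed
  have AT: "lam j * (\<integral>w. A w * T j w \<partial>FF) = (lam j)\<^sup>2" for j
    unfolding T_def inner_A[OF \<phi>L] using \<phi>o[of j j] by (cases "lam j = 0") (auto simp: power2_eq_square)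
  define S where "S I w = (\<Sum>j\<in>I. lam j * T j w)" for I w
  have SL: "in_L2 FF (S I)" for I unfolding S_def by (intro in_L2_sum in_L2_cmult TL)
  have [measurable]: "S I \<in> borel_measurable FF" for I using SL by (simp add: in_L2_def)
  have SS: "(\<integral>w. (S I w)\<^sup>2 \<partial>FF) = (\<Sum>j\<in>I. (lam j)\<^sup>2)" if "finite I" for I
  proof -
    have "(\<integral>w. (S I w)\<^sup>2 \<partial>FF) = (\<integral>w. (\<Sum>i\<in>I. \<Sum>j\<in>I. lam i * lam j * (T i w * T j w)) \<partial>FF)"
      by (simp add: S_def power2_eq_square sum_product mult_ac)
    also have "\<dots> = (\<Sum>i\<in>I. \<Sum>j\<in>I. lam i * lam j * (\<integral>w. T i w * T j w \<partial>FF))"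
      using in_L2_mult_integrable[OF TL TL] by simp
    also have "\<dots> = (\<Sum>j\<in>I. (lam j)\<^sup>2)"
      using that by (simp add: TT)
    finally show ?thesis .
  qed
  have AS: "(\<integral>w. A w * S I w \<partial>FF) = (\<Sum>j\<in>I. (lam j)\<^sup>2)" for I
  proof -
    have "(\<integral>w. A w * S I w \<partial>FF) = (\<integral>w. (\<Sum>j\<in>I. lam j * (A w * T j w)) \<partial>FF)"
      by (simp add: S_def sum_distrib_left mult_ac)
    also have "\<dots> = (\<Sum>j\<in>I. lam j * (\<integral>w. A w * T j w \<partial>FF))"
      using in_L2_mult_integrable[OF AL TL] by simp
    finally show ?thesis by (simp add: AT)
  qed
  have Bessel: "(\<Sum>j\<in>I. (lam j)\<^sup>2) \<le> (\<integral>w. (A w)\<^sup>2 \<partial>FF)" if "finite I" for I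
  proof -
    have "0 \<le> (\<integral>w. (A w - S I w)\<^sup>2 \<partial>FF)" by simp
    also have "\<dots> = (\<integral>w. (A w)\<^sup>2 + (S I w)\<^sup>2 - 2 * (A w * S I w) \<partial>FF)"
      by (simp add: power2_diff mult.assoc)
    also have "\<dots> = (\<integral>w. (A w)\<^sup>2 \<partial>FF) + (\<integral>w. (S I w)\<^sup>2 \<partial>FF) - 2 * (\<integral>w. A w * S I w \<partial>FF)"
      using in_L2_mult_integrable[OF AL SL] in_L2_integrable_square[OF AL] in_L2_integrable_square[OF SL] by simp
    finally show ?thesis using SS[OF that] AS[of I] by simp
  qed
  have summ: "summable (\<lambda>j. (lam j)\<^sup>2)"
  proof (rule summableI_nonneg_bounded)
    show "(\<Sum>j<n. (lam j)\<^sup>2) \<le> (\<integral>w. (A w)\<^sup>2 \<partial>FF)" for n by (rule Bessel) simp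
  qed simp
  have diff: "(\<integral>w. (S {..<m} w - S {..<n} w)\<^sup>2 \<partial>FF) \<le> \<bar>(\<Sum>j<m. (lam j)\<^sup>2) - (\<Sum>j<n. (lam j)\<^sup>2)\<bar>" for m n
  proof -
    have main: "(\<integral>w. (S {..<n} w - S {..<m} w)\<^sup>2 \<partial>FF) = (\<Sum>j<n. (lam j)\<^sup>2) - (\<Sum>j<m. (lam j)\<^sup>2)" if "m \<le> n" for m n
    proof -
      have split: "sum f {..<n} = sum f {..<m} + sum f {m..<n}" for f :: "nat \<Rightarrow> real"
        using that by (simp add: sum.atLeastLessThan_concat lessThan_atLeast0)
      have "S {..<n} w - S {..<m} w = S {m..<n} w" for w
        unfolding S_def by (subst split) simp
      then show ?thesis using SS[of "{m..<n}"] split[of "\<lambda>j. (lam j)\<^sup>2"] by simp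
    qed
    show ?thesis using main[of m n] main[of n m] by (cases "m \<le> n") (auto simp: power2_commute)
  qed
  have "\<exists>N. \<forall>m\<ge>N. \<forall>n\<ge>N. (\<integral>w. (S {..<m} w - S {..<n} w)\<^sup>2 \<partial>FF) < e" if "e > 0" for e
  proof -
    have "Cauchy (\<lambda>n. \<Sum>j<n. (lam j)\<^sup>2)"
      using summ by (simp add: summable_iff_convergent Cauchy_convergent_iff)
    from CauchyD[OF this that] obtain N where
      N: "\<forall>m\<ge>N. \<forall>n\<ge>N. norm ((\<Sum>j<m. (lam j)\<^sup>2) - (\<Sum>j<n. (lam j)\<^sup>2)) < e" ..
    show ?thesis
    proof (intro exI[of _ N] allI impI)
      fix m n assume "N \<le> m" "N \<le> n"
      with N have "\<bar>(\<Sum>j<m. (lam j)\<^sup>2) - (\<Sum>j<n. (lam j)\<^sup>2)\<bar> < e" by (simp only: real_norm_def)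
      with diff show "(\<integral>w. (S {..<m} w - S {..<n} w)\<^sup>2 \<partial>FF) < e" by (rule le_less_trans)
    qed
  qed
  from FF.P.L2_complete[OF SL this] obtain L' where L': "in_L2 FF L'"
    and lim': "(\<lambda>n. \<integral>w. (S {..<n} w - L' w)\<^sup>2 \<partial>FF) \<longlonglongrightarrow> 0" by auto
  \<comment> \<open>The limit \<open>L'\<close> is symmetric only almost everywhere, while
    \<open>exists_eigenfunction\<close> asks for pointwise symmetry. Averaging with the transpose
    restores it without increasing the error.\<close>
  define L where "L w = (1/2) * L' w + (1/2) * L' (snd w, fst w)" for w
  have LL: "in_L2 FF L" unfolding L_def by (intro in_L2_add in_L2_cmult L' swap_L2)
  have Lsym: "L (x, y) = L (y, x)" for x y by (simp add: L_def)
  have lim: "(\<lambda>n. \<integral>w. (S {..<n} w - L w)\<^sup>2 \<partial>FF) \<longlonglongrightarrow> 0"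
  proof (rule tendsto_sandwich[OF _ _ tendsto_const lim'])
    show "\<forall>\<^sub>F n in sequentially. (\<integral>w. (S {..<n} w - L w)\<^sup>2 \<partial>FF) \<le> (\<integral>w. (S {..<n} w - L' w)\<^sup>2 \<partial>FF)"
    proof (rule always_eventually, rule allI)
      fix n
      let ?D = "\<lambda>w. S {..<n} w - L' w"
      have DL: "in_L2 FF ?D" by (intro in_L2_diff SL L')
      have "S {..<n} w - L w = (1/2) * ?D w + (1/2) * ?D (snd w, fst w)" for w
        by (simp add: L_def S_def T_def mult_ac) (simp add: field_simps)
      then have "(\<integral>w. (S {..<n} w - L w)\<^sup>2 \<partial>FF) = (\<integral>w. ((1/2) * ?D w + (1/2) * ?D (snd w, fst w))\<^sup>2 \<partial>FF)"
        by simp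
      also have "\<dots> \<le> 2 * (\<integral>w. ((1/2) * ?D w)\<^sup>2 \<partial>FF) + 2 * (\<integral>w. ((1/2) * ?D (snd w, fst w))\<^sup>2 \<partial>FF)"
        using swap_L2(1)[OF DL] DL by (intro integral_square_sum_le in_L2_cmult) auto
      also have "\<dots> = (\<integral>w. (?D w)\<^sup>2 \<partial>FF)"
        using swap_L2(2)[OF DL] unfolding power_mult_distrib by (simp add: power2_eq_square)
      finally show "(\<integral>w. (S {..<n} w - L w)\<^sup>2 \<partial>FF) \<le> (\<integral>w. (?D w)\<^sup>2 \<partial>FF)" .
    qed
  qed simp
  have [measurable]: "L \<in> borel_measurable FF" using LL by (simp add: in_L2_def)
  define R where "R w = A w - L w" for w
  have RL: "in_L2 FF R" unfolding R_def by (intro in_L2_diff AL LL)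
  have Rsym: "R (x, y) = R (y, x)" for x y using Asym[of x y] Lsym[of x y] by (simp add: R_def)
  have innerS: "(\<integral>w. S {..<n} w * (f (fst w) * g (snd w)) \<partial>FF) =
      (\<Sum>j<n. lam j * ((\<integral>x. \<phi> j x * f x \<partial>F) * (\<integral>x. \<phi> j x * g x \<partial>F)))"
    if "in_L2 F f" "in_L2 F g" for f g n
  proof -
    have "(\<integral>w. S {..<n} w * (f (fst w) * g (snd w)) \<partial>FF) =
      (\<integral>w. (\<Sum>j<n. lam j * (T j w * (f (fst w) * g (snd w)))) \<partial>FF)"
      by (simp add: S_def sum_distrib_right mult.assoc)
    also have "\<dots> = (\<Sum>j<n. lam j * (\<integral>w. T j w * (f (fst w) * g (snd w)) \<partial>FF))"
      using in_L2_mult_integrable[OF TL tensor_L2[OF that]] by simp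
    finally show ?thesis unfolding T_def inner_tensor[OF \<phi>L \<phi>L that] .
  qed
  have limS: "(\<lambda>n. \<integral>w. S {..<n} w * (f (fst w) * g (snd w)) \<partial>FF) \<longlonglongrightarrow> (\<integral>w. L w * (f (fst w) * g (snd w)) \<partial>FF)"
    if "in_L2 F f" "in_L2 F g" for f g
    by (rule L2_tendsto_inner[OF SL LL tensor_L2[OF that] lim])
  have "(\<integral>w. (R w)\<^sup>2 \<partial>FF) = 0"
  proof (rule ccontr)
    assume "(\<integral>w. (R w)\<^sup>2 \<partial>FF) \<noteq> 0"
    from exists_eigenfunction[OF RL Rsym this] obtain \<mu> g where
      \<mu>: "\<mu> \<noteq> 0" and g: "in_L2 F g" and g0: "(\<integral>x. (g x)\<^sup>2 \<partial>F) \<noteq> 0" and e: "AE x in F. app R g x = \<mu> * g x" by blast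
    have [measurable]: "g \<in> borel_measurable F" using g by (simp add: in_L2_def)
    \<comment> \<open>\<open>A\<close> and \<open>L\<close> act alike on \<open>\<phi> j\<close>
      when paired with \<open>g\<close>, so the pairing with \<open>app R (\<phi> j)\<close> is
      zero; moving \<open>R\<close> to \<open>g\<close> produces the factor
      \<open>\<mu>\<close>.\<close>
    have orth: "(\<integral>x. \<phi> j x * g x \<partial>F) = 0" for j
    proof (cases "lam j = 0")
      case True then show ?thesis by (simp add: \<phi>_def)
    next
      case False
      have "(\<lambda>n. \<integral>w. S {..<n} w * (g (fst w) * \<phi> j (snd w)) \<partial>FF) \<longlonglongrightarrow> lam j * (\<integral>x. \<phi> j x * g x \<partial>F)"
      proof (rule tendsto_eventually, rule eventually_sequentiallyI[of "Suc j"])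
        fix n assume "Suc j \<le> n"
        have "(\<integral>w. S {..<n} w * (g (fst w) * \<phi> j (snd w)) \<partial>FF) =
          (\<Sum>i<n. lam i * ((\<integral>x. \<phi> i x * g x \<partial>F) * (\<integral>x. \<phi> i x * \<phi> j x \<partial>F)))"
          by (rule innerS[OF g \<phi>L])
        also have "\<dots> = (\<Sum>i<n. if i = j then lam j * (\<integral>x. \<phi> j x * g x \<partial>F) else 0)"
          using \<phi>o[OF _ False] by (intro sum.cong refl) auto
        also have "\<dots> = lam j * (\<integral>x. \<phi> j x * g x \<partial>F)"
          using \<open>Suc j \<le> n\<close> by simp
        finally show "(\<integral>w. S {..<n} w * (g (fst w) * \<phi> j (snd w)) \<partial>FF) = lam j * (\<integral>x. \<phi> j x * g x \<partial>F)" .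
      qed
      from LIMSEQ_unique[OF limS[OF g \<phi>L] this]
      have L1: "(\<integral>w. L w * (g (fst w) * \<phi> j (snd w)) \<partial>FF) = lam j * (\<integral>x. \<phi> j x * g x \<partial>F)" .
      have "(\<integral>x. g x * app R (\<phi> j) x \<partial>F) = (\<integral>w. R w * (g (fst w) * \<phi> j (snd w)) \<partial>FF)"
        by (rule inner_app[OF RL g \<phi>L])
      also have "\<dots> = (\<integral>w. A w * (g (fst w) * \<phi> j (snd w)) \<partial>FF) - (\<integral>w. L w * (g (fst w) * \<phi> j (snd w)) \<partial>FF)"
        unfolding R_def left_diff_distrib
        by (intro Bochner_Integration.integral_diff in_L2_mult_integrable AL LL tensor_L2 g \<phi>L)
      also have "\<dots> = 0"
        unfolding L1 inner_A[OF g] by (simp add: mult.commute)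
      finally have "(\<integral>x. app R g x * \<phi> j x \<partial>F) = 0"
        using app_self_adjoint[OF RL Rsym g \<phi>L] by simp
      moreover have "(\<integral>x. app R g x * \<phi> j x \<partial>F) = (\<integral>x. \<mu> * (\<phi> j x * g x) \<partial>F)"
        using RL by (intro integral_cong_AE) (use e in \<open>auto simp: in_L2_def elim!: eventually_mono\<close>)
      ultimately show ?thesis using \<mu> by simp
    qed
    \<comment> \<open>The squared norm is the limit of pairings of the partial sums with
      \<open>app L g\<close> and \<open>g\<close>; each term contains a factor that
      \<open>orth\<close> makes zero.\<close>
    have "(\<integral>x. (app L g x)\<^sup>2 \<partial>F) = 0"
    proof -
      have "(\<integral>x. (app L g x)\<^sup>2 \<partial>F) = (\<integral>x. app L g x * app L g x \<partial>F)" by (simp add: power2_eq_square)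
      also have "\<dots> = (\<integral>w. L w * (app L g (fst w) * g (snd w)) \<partial>FF)"
        by (rule inner_app[OF LL app_L2[OF LL g] g])
      also have "\<dots> = 0"
        using limS[OF app_L2[OF LL g] g] LIMSEQ_unique[OF _ tendsto_const]
        unfolding innerS[OF app_L2[OF LL g] g] orth by simp
      finally show ?thesis .
    qed
    then have Lg: "AE x in F. app L g x = 0" by (rule AE_zero_of_L2_norm_zero[OF app_L2[OF LL g]])
    have "AE x in F. int_op F k g x = \<mu> * g x"
      using Lg e AE_row_L2[OF AL] AE_row_L2[OF LL]
    proof eventually_elim
      case (elim x)
      have "app R g x = app A g x - app L g x"
        unfolding app_def R_def left_diff_distrib
        by (intro Bochner_Integration.integral_diff in_L2_mult_integrable elim g)
      then show ?case using elim by (simp add: op)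
    qed
    from complete[OF \<mu> g this] obtain c where c: "AE x in F. g x = (\<Sum>j\<in>{j. lam j = \<mu>}. c j * \<phi>' j x)" by blast
    have "(\<integral>x. (g x)\<^sup>2 \<partial>F) = (\<integral>x. (\<Sum>j\<in>{j. lam j = \<mu>}. c j * (\<phi> j x * g x)) \<partial>F)"
    proof (rule integral_cong_AE)
      show "AE x in F. (g x)\<^sup>2 = (\<Sum>j\<in>{j. lam j = \<mu>}. c j * (\<phi> j x * g x))"
        using c
      proof eventually_elim
        case (elim x)
        have "(g x)\<^sup>2 = (\<Sum>j\<in>{j. lam j = \<mu>}. c j * \<phi>' j x) * g x"
          using elim by (simp add: power2_eq_square)
        also have "\<dots> = (\<Sum>j\<in>{j. lam j = \<mu>}. c j * (\<phi> j x * g x))"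
          unfolding sum_distrib_right using \<mu> by (intro sum.cong refl) (auto simp: \<phi>_def)
        finally show ?case .
      qed
    qed measurable
    also have "\<dots> = (\<Sum>j\<in>{j. lam j = \<mu>}. c j * (\<integral>x. \<phi> j x * g x \<partial>F))"
      using in_L2_mult_integrable[OF \<phi>L g] by simp
    also have "\<dots> = 0" by (simp add: orth)
    finally show False using g0 by simp
  qed
  then have "AE w in FF. R w = 0" by (rule AE_zero_of_L2_norm_zero[OF RL])
  then have AE_eq: "AE w in FF. A w = L w" by eventually_elim (simp add: R_def)
  have "(\<integral>w. (A w - S {..<n} w)\<^sup>2 \<partial>FF) = (\<integral>w. (S {..<n} w - L w)\<^sup>2 \<partial>FF)" for n
    by (intro integral_cong_AE) (use AE_eq in \<open>auto simp: power2_commute elim!: eventually_mono\<close>)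
  with lim have "(\<lambda>n. \<integral>w. (A w - S {..<n} w)\<^sup>2 \<partial>FF) \<longlonglongrightarrow> 0" by simp
  then show ?thesis
    using \<phi>L \<phi>o \<phi>e summ
    by (intro that[of \<phi>]) (auto simp: A_def S_def T_def op[symmetric] \<phi>_def[of j for j])
qed

end

section \<open>Random series\<close>

locale iid_seq = iid_space F Q for F :: "'v measure" and Q :: "(nat \<Rightarrow> 'v) measure"
begin

context
  fixes \<psi> :: "'v \<Rightarrow> real" and c :: "nat \<Rightarrow> real"
  assumes \<psi>: "in_L2 F \<psi>" and mean: "(\<integral>x. \<psi> x \<partial>F) = 0"
begin

lemma \<psi>_measurable[measurable]: "\<psi> \<in> borel_measurable F"
  using \<psi> by (simp add: in_L2_def)

definition psum :: "nat set \<Rightarrow> (nat \<Rightarrow> 'v) \<Rightarrow> real" where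
  "psum I x = (\<Sum>j\<in>I. c j * \<psi> (x j))"

lemma psum_L2: "in_L2 Q (psum I)"
  unfolding psum_def[abs_def] by (intro in_L2_sum in_L2_cmult in_L2_component \<psi>)

lemma psum_measurable[measurable]: "psum I \<in> borel_measurable Q"
  using psum_L2 by (simp add: in_L2_def)

lemma psum_depends: "depends_on I (psum I)"
  by (auto simp: depends_on_def psum_def intro!: sum.cong)

lemma psum_mean: "(\<integral>x. psum I x \<partial>Q) = 0"
proof -
  have "(\<integral>x. psum I x \<partial>Q) = (\<Sum>j\<in>I. \<integral>x. c j * \<psi> (x j) \<partial>Q)"
    unfolding psum_def using integrable_component[OF in_L2_integrable[OF \<psi>]]
    by (intro Bochner_Integration.integral_sum integrable_mult_right) auto
  also have "\<dots> = 0" by (simp add: integral_component mean)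
  finally show ?thesis .
qed

lemma psum_orthogonal:
  assumes "in_L2 Q f" "depends_on A f" "A \<inter> I = {}"
  shows "(\<integral>x. f x * psum I x \<partial>Q) = 0"
  using assms psum_mean[of I]
  by (intro orthogonal_if_cexp_zero[OF assms(1,2) psum_L2 psum_depends]) (simp add: cexp_def mix_def)

lemma psum_second_moment:
  assumes "finite I"
  shows "(\<integral>x. (psum I x)\<^sup>2 \<partial>Q) = (\<integral>x. (\<psi> x)\<^sup>2 \<partial>F) * (\<Sum>j\<in>I. (c j)\<^sup>2)"
  using assms
proof (induction I rule: finite_induct)
  case empty
  then show ?case by (simp add: psum_def)
next
  case (insert i I)
  have eq: "psum (insert i I) x = psum {i} x + psum I x" for x
    using insert by (simp add: psum_def)
  have "(\<integral>x. (psum (insert i I) x)\<^sup>2 \<partial>Q) =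
      (\<integral>x. (psum {i} x)\<^sup>2 + (psum I x)\<^sup>2 + 2 * (psum {i} x * psum I x) \<partial>Q)"
    by (simp add: eq power2_sum mult.assoc)
  also have "\<dots> = (\<integral>x. (psum {i} x)\<^sup>2 \<partial>Q) + (\<integral>x. (psum I x)\<^sup>2 \<partial>Q) + 2 * (\<integral>x. psum {i} x * psum I x \<partial>Q)"
    using in_L2_mult_integrable[OF psum_L2 psum_L2] in_L2_integrable_square[OF psum_L2] by simp
  also have "(\<integral>x. psum {i} x * psum I x \<partial>Q) = 0"
    using insert by (intro psum_orthogonal[OF psum_L2 psum_depends]) auto
  also have "(\<integral>x. (psum {i} x)\<^sup>2 \<partial>Q) = (c i)\<^sup>2 * (\<integral>x. (\<psi> x)\<^sup>2 \<partial>F)"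
    using integral_component[of "\<lambda>x. (\<psi> x)\<^sup>2" i] by (simp add: psum_def power_mult_distrib)
  finally show ?case using insert by (simp add: algebra_simps)
qed

text \<open>Split according to the first index \<open>k\<close> at which the sum reaches
  \<open>e\<close>. On \<open>A k\<close> the later increment \<open>g\<close> is uncorrelated with
  the sum up to then, so the final second moment dominates that at time \<open>k\<close>.\<close>

lemma Kolmogorov_maximal_inequality:
  assumes e: "e > 0"
  shows "measure Q {x\<in>space Q. \<exists>k\<le>n. e \<le> \<bar>psum {m..<m+k} x\<bar>} \<le>
    (\<integral>x. (\<psi> x)\<^sup>2 \<partial>F) * (\<Sum>j\<in>{m..<m+n}. (c j)\<^sup>2) / e\<^sup>2"
proof -
  define W where "W k = psum {m..<m+k}" for k
  have [measurable]: "W k \<in> borel_measurable Q" for k by (simp add: W_def)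
  define A where "A k = {x\<in>space Q. e \<le> \<bar>W k x\<bar> \<and> (\<forall>i\<in>{..<k}. \<bar>W i x\<bar> < e)}" for k
  have [measurable]: "A k \<in> sets Q" for k unfolding A_def by measurable
  have disj: "disjoint_family_on A {..n}"
    unfolding disjoint_family_on_def
  proof safe
    fix k l x assume "k \<noteq> l" "x \<in> A k" "x \<in> A l"
    then show "x \<in> {}" by (cases k l rule: linorder_cases) (force simp: A_def)+
  qed
  have un: "{x\<in>space Q. \<exists>k\<le>n. e \<le> \<bar>psum {m..<m+k} x\<bar>} = (\<Union>k\<le>n. A k)"
  proof safe
    fix x k assume x: "x \<in> space Q" "k \<le> n" "e \<le> \<bar>psum {m..<m+k} x\<bar>"
    define l where "l = (LEAST l. e \<le> \<bar>W l x\<bar>)"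
    have "e \<le> \<bar>W k x\<bar>" using x by (simp add: W_def)
    then have l: "e \<le> \<bar>W l x\<bar>" "l \<le> k"
      unfolding l_def by (rule LeastI[where P="\<lambda>l. e \<le> \<bar>W l x\<bar>"], rule Least_le)
    have "\<forall>i\<in>{..<l}. \<bar>W i x\<bar> < e" using not_less_Least[of _ "\<lambda>l. e \<le> \<bar>W l x\<bar>"] by (auto simp: l_def not_le)
    then show "x \<in> (\<Union>k\<le>n. A k)" using l x by (auto simp: A_def intro!: bexI[of _ l])
  qed (auto simp: A_def W_def)
  have AL: "e\<^sup>2 * measure Q (A k) \<le> (\<integral>x. (W n x)\<^sup>2 * indicator (A k) x \<partial>Q)" if k: "k \<le> n" for k
  proof -
    define f where "f x = W k x * indicator (A k) x" for x
    have fL: "in_L2 Q f"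
    proof -
      have "integrable Q (\<lambda>x. (W k x)\<^sup>2 * indicator (A k) x)"
        using in_L2_integrable_square[OF psum_L2] by (intro integrable_real_mult_indicator) (auto simp: W_def)
      also have "(\<lambda>x. (W k x)\<^sup>2 * indicator (A k) x) = (\<lambda>x. (f x)\<^sup>2)"
        by (auto simp: f_def power_mult_distrib power2_eq_square indicator_def)
      finally show ?thesis by (simp add: in_L2_def f_def[abs_def])
    qed
    \<comment> \<open>The event \<open>A k\<close> includes membership in \<open>space Q\<close>,
      which involves every coordinate. Dropping it gives a function that depends only on the first
      \<open>m + k\<close> coordinates in the sense of \<open>depends_on\<close>.\<close>
    define f' where "f' x = W k x * (if e \<le> \<bar>W k x\<bar> \<and> (\<forall>i\<in>{..<k}. \<bar>W i x\<bar> < e) then 1 else 0)" for x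
    have ff: "f x = f' x" if "x \<in> space Q" for x using that by (simp add: f_def f'_def A_def)
    have f'L: "in_L2 Q f'"
    proof (rule in_L2_cong_AE[OF fL])
      show "f' \<in> borel_measurable Q" unfolding f'_def by measurable
      show "AE x in Q. f x = f' x" using AE_space by eventually_elim (rule ff)
    qed
    have Wd: "W i x = W i y" if "\<forall>s\<in>{..<m+k}. x s = y s" "i \<le> k" for i x y
      unfolding W_def using that by (intro depends_onD[OF psum_depends]) auto
    have dep: "depends_on {..<m+k} f'"
      unfolding depends_on_def
    proof (intro allI impI)
      fix x y :: "nat \<Rightarrow> 'v" assume "\<forall>s\<in>{..<m + k}. x s = y s"
      from Wd[OF this] have "W i x = W i y" if "i \<le> k" for i using that by simp
      then show "f' x = f' y" by (simp add: f'_def)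
    qed
    define g where "g = psum {m+k..<m+n}"
    have Wn: "W n x = W k x + g x" for x
    proof -
      have "{m..<m+n} = {m..<m+k} \<union> {m+k..<m+n}" using k by auto
      then show ?thesis unfolding W_def g_def psum_def by (subst sum.union_disjoint[symmetric]) auto
    qed
    have cross: "(\<integral>x. f x * g x \<partial>Q) = 0"
    proof -
      have "(\<integral>x. f x * g x \<partial>Q) = (\<integral>x. f' x * g x \<partial>Q)"
        by (intro Bochner_Integration.integral_cong refl) (simp add: ff)
      also have "\<dots> = 0" unfolding g_def by (rule psum_orthogonal[OF f'L dep]) auto
      finally show ?thesis .
    qed
    have i: "integrable Q (\<lambda>x. e\<^sup>2 * indicator (A k) x)" "integrable Q (\<lambda>x. 2 * (f x * g x))"
      unfolding g_def
      by (intro integrable_mult_right integrable_real_indicator in_L2_mult_integrable fL psum_L2;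
          simp add: less_top[symmetric])+
    have "e\<^sup>2 * measure Q (A k) = (\<integral>x. e\<^sup>2 * indicator (A k) x + 2 * (f x * g x) \<partial>Q)"
      using i cross by simp
    also have "\<dots> \<le> (\<integral>x. (W n x)\<^sup>2 * indicator (A k) x \<partial>Q)"
    proof (rule integral_mono)
      show "integrable Q (\<lambda>x. e\<^sup>2 * indicator (A k) x + 2 * (f x * g x))"
        by (intro Bochner_Integration.integrable_add i)
      show "integrable Q (\<lambda>x. (W n x)\<^sup>2 * indicator (A k) x)"
        using in_L2_integrable_square[OF psum_L2] by (intro integrable_real_mult_indicator) (auto simp: W_def)
      fix x
      show "e\<^sup>2 * indicator (A k) x + 2 * (f x * g x) \<le> (W n x)\<^sup>2 * indicator (A k) x"
      proof (cases "x \<in> A k")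
        case True
        then have "e\<^sup>2 \<le> (W k x)\<^sup>2" using e by (auto simp: A_def abs_le_square_iff[symmetric])
        then show ?thesis using True zero_le_power2[of "g x"] by (simp add: f_def Wn power2_sum add_increasing2)
      qed (simp add: f_def)
    qed
    finally show ?thesis .
  qed
  have "e\<^sup>2 * measure Q {x\<in>space Q. \<exists>k\<le>n. e \<le> \<bar>psum {m..<m+k} x\<bar>} = (\<Sum>k\<le>n. e\<^sup>2 * measure Q (A k))"
    unfolding un by (subst Q.finite_measure_finite_Union[OF _ _ disj]) (auto simp: sum_distrib_left)
  also have "\<dots> \<le> (\<Sum>k\<le>n. \<integral>x. (W n x)\<^sup>2 * indicator (A k) x \<partial>Q)"
    by (intro sum_mono AL) auto
  also have "\<dots> = (\<integral>x. (\<Sum>k\<le>n. (W n x)\<^sup>2 * indicator (A k) x) \<partial>Q)"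
    using in_L2_integrable_square[OF psum_L2]
    by (intro Bochner_Integration.integral_sum[symmetric] integrable_real_mult_indicator) (auto simp: W_def)
  also have "\<dots> \<le> (\<integral>x. (W n x)\<^sup>2 \<partial>Q)"
  proof (rule integral_mono)
    show "integrable Q (\<lambda>x. \<Sum>k\<le>n. (W n x)\<^sup>2 * indicator (A k) x)"
      using in_L2_integrable_square[OF psum_L2]
      by (intro Bochner_Integration.integrable_sum integrable_real_mult_indicator) (auto simp: W_def)
    show "integrable Q (\<lambda>x. (W n x)\<^sup>2)" using in_L2_integrable_square[OF psum_L2] by (simp add: W_def)
    fix x
    have "(\<Sum>k\<le>n. (W n x)\<^sup>2 * indicator (A k) x) = (W n x)\<^sup>2 * indicator (\<Union>k\<le>n. A k) x"
    proof (cases "x \<in> (\<Union>k\<le>n. A k)")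
      case True
      then obtain k where k: "k \<le> n" "x \<in> A k" by auto
      have "x \<notin> A i" if "i \<le> n" "i \<noteq> k" for i
        using disj k that by (auto simp: disjoint_family_on_def)
      then have "(\<Sum>i\<le>n. (W n x)\<^sup>2 * indicator (A i) x) = (\<Sum>i\<le>n. if i = k then (W n x)\<^sup>2 else 0)"
        using k by (intro sum.cong refl) auto
      then show ?thesis using True k by simp
    qed auto
    also have "\<dots> \<le> (W n x)\<^sup>2" by (simp add: indicator_def)
    finally show "(\<Sum>k\<le>n. (W n x)\<^sup>2 * indicator (A k) x) \<le> (W n x)\<^sup>2" .
  qed
  also have "\<dots> = (\<integral>x. (\<psi> x)\<^sup>2 \<partial>F) * (\<Sum>j\<in>{m..<m+n}. (c j)\<^sup>2)"
    unfolding W_def by (rule psum_second_moment) simp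
  finally show ?thesis using e by (simp add: field_simps)
qed

text \<open>The maximal inequality bounds the probability of a large oscillation after
  \<open>m\<close> by a tail of the sum of the \<open>(c j)\<^sup>2\<close>; almost surely the
  partial sums are therefore Cauchy.\<close>

lemma AE_summable_random_series:
  assumes c: "summable (\<lambda>j. (c j)\<^sup>2)"
  shows "AE x in Q. summable (\<lambda>j. c j * \<psi> (x j))"
proof -
  let ?v = "\<integral>x. (\<psi> x)\<^sup>2 \<partial>F"
  define B where "B m e = {x\<in>space Q. \<exists>k. e \<le> \<bar>psum {m..<m+k} x\<bar>}" for m :: nat and e :: real
  have [measurable]: "B m e \<in> sets Q" for m e unfolding B_def by measurable
  have Bm: "measure Q (B m e) \<le> ?v * (\<Sum>j. (c (j + m))\<^sup>2) / e\<^sup>2" if e: "e > 0" for m e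
  proof -
    let ?B = "\<lambda>n. {x\<in>space Q. \<exists>k\<le>n. e \<le> \<bar>psum {m..<m+k} x\<bar>}"
    have "(\<lambda>n. measure Q (?B n)) \<longlonglongrightarrow> measure Q (\<Union>n. ?B n)"
      by (intro Q.finite_Lim_measure_incseq) (auto simp: incseq_def intro: le_trans)
    moreover have "(\<Union>n. ?B n) = B m e" by (auto simp: B_def)
    moreover have "measure Q (?B n) \<le> ?v * (\<Sum>j. (c (j + m))\<^sup>2) / e\<^sup>2" for n
    proof -
      have "(\<Sum>j\<in>{m..<m+n}. (c j)\<^sup>2) = (\<Sum>j<n. (c (j + m))\<^sup>2)"
        using sum.shift_bounds_nat_ivl[of "\<lambda>j. (c j)\<^sup>2" 0 m n] by (simp add: lessThan_atLeast0 add.commute)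
      also have "\<dots> \<le> (\<Sum>j. (c (j + m))\<^sup>2)"
        using c by (intro sum_le_suminf) (auto simp: summable_iff_shift[of "\<lambda>j. (c j)\<^sup>2"])
      finally have "?v * (\<Sum>j\<in>{m..<m+n}. (c j)\<^sup>2) / e\<^sup>2 \<le> ?v * (\<Sum>j. (c (j + m))\<^sup>2) / e\<^sup>2"
        by (intro divide_right_mono mult_left_mono) auto
      then show ?thesis using Kolmogorov_maximal_inequality[OF e, of n m] by linarith
    qed
    ultimately show ?thesis by (intro LIMSEQ_le_const2[of _ "measure Q (B m e)"]) auto
  qed
  have null: "AE x in Q. \<exists>m. x \<notin> B m e" if e: "e > 0" for e
  proof -
    have "measure Q (\<Inter>m. B m e) \<le> ?v * (\<Sum>j. (c (j + m))\<^sup>2) / e\<^sup>2" for m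
      by (rule order_trans[OF Q.finite_measure_mono Bm[OF e]]) auto
    moreover have "(\<lambda>m. ?v * (\<Sum>j. (c (j + m))\<^sup>2) / e\<^sup>2) \<longlonglongrightarrow> ?v * 0 / e\<^sup>2"
      by (intro tendsto_intros suminf_exist_split2 c) (use e in auto)
    ultimately have "measure Q (\<Inter>m. B m e) \<le> ?v * 0 / e\<^sup>2"
      by (intro LIMSEQ_le_const) auto
    then have "measure Q (\<Inter>m. B m e) = 0" by (simp add: measure_le_0_iff)
    then have "emeasure Q (\<Inter>m. B m e) = 0" by (simp add: Q.emeasure_eq_measure)
    then have "(\<Inter>m. B m e) \<in> null_sets Q" by (intro null_setsI) auto
    from AE_not_in[OF this] show ?thesis by simp
  qed
  have "AE x in Q. \<forall>p. \<exists>m. x \<notin> B m (inverse (real (Suc p)))"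
    by (subst AE_all_countable) (intro allI null, simp)
  then show ?thesis using AE_space
  proof eventually_elim
    case (elim x)
    show ?case
      unfolding summable_Cauchy
    proof (intro allI impI)
      fix e :: real assume "e > 0"
      then obtain p where p: "inverse (real (Suc p)) < e / 2" using reals_Archimedean[of "e/2"] by auto
      from elim obtain N where "x \<notin> B N (inverse (real (Suc p)))" by auto
      then have N: "\<bar>psum {N..<N+k} x\<bar> < e / 2" for k
        using elim(2) less_trans[OF _ p] by (simp add: B_def not_le)
      show "\<exists>N. \<forall>m\<ge>N. \<forall>n. norm (sum (\<lambda>j. c j * \<psi> (x j)) {m..<n}) < e"
      proof (intro exI[of _ N] allI impI)
        fix m n assume "m \<ge> N"
        show "norm (sum (\<lambda>j. c j * \<psi> (x j)) {m..<n}) < e"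
        proof (cases "m \<le> n")
          case True
          have "psum {N..<n} x = psum {N..<m} x + psum {m..<n} x"
            unfolding psum_def using \<open>m \<ge> N\<close> True by (simp add: sum.atLeastLessThan_concat)
          moreover have "\<bar>psum {N..<n} x\<bar> < e / 2" "\<bar>psum {N..<m} x\<bar> < e / 2"
            using N[of "n - N"] N[of "m - N"] \<open>m \<ge> N\<close> True by simp_all
          ultimately have "\<bar>psum {m..<n} x\<bar> < e" by linarith
          then show ?thesis by (simp add: psum_def)
        qed (use \<open>e > 0\<close> in simp)
      qed
    qed
  qed
qed

end

text \<open>Outside the context these rules acquire \<open>in_L2\<close> premises, on which the measurability prover loops.\<close>

declare \<psi>_measurable[measurable del] psum_measurable[measurable del]

end

section \<open>Gaussian mixtures and laws of large numbers\<close>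

abbreviation std_gauss :: "(nat \<Rightarrow> real) measure" where
  "std_gauss \<equiv> PiM UNIV (\<lambda>_. std_normal_distribution)"

lemma prob_space_std_normal: "prob_space std_normal_distribution"
  using real_dist_normal_dist by (simp add: real_distribution_def)

interpretation G: iid_seq std_normal_distribution std_gauss
  unfolding iid_seq_def by (rule iid_space.intro) (rule prob_space_std_normal)

lemma cmod_iexp_diff_le: "cmod (iexp a - iexp b) \<le> \<bar>a - b\<bar>"
proof -
  have "iexp a - iexp b = iexp b * (iexp (a - b) - 1)"
    by (simp add: right_diff_distrib exp_add[symmetric] of_real_diff)
  then have "cmod (iexp a - iexp b) = cmod (iexp (a - b) - 1)"
    by (simp add: norm_mult)
  also have "\<dots> \<le> \<bar>a - b\<bar>"
    using iexp_approx1[of "a - b" 0] by simp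
  finally show ?thesis .
qed

lemma (in prob_space) char_diff_le:
  fixes X Y :: "'a \<Rightarrow> real"
  assumes [measurable]: "X \<in> borel_measurable M" "Y \<in> borel_measurable M"
    and int: "integrable M (\<lambda>x. \<bar>X x - Y x\<bar>)"
  shows "cmod ((\<integral>x. iexp (X x) \<partial>M) - (\<integral>x. iexp (Y x) \<partial>M)) \<le> (\<integral>x. \<bar>X x - Y x\<bar> \<partial>M)"
proof -
  have i: "integrable M (\<lambda>x. iexp (X x))" "integrable M (\<lambda>x. iexp (Y x))"
    by (auto intro!: integrable_const_bound[where B=1])
  have "cmod ((\<integral>x. iexp (X x) \<partial>M) - (\<integral>x. iexp (Y x) \<partial>M)) = cmod (\<integral>x. iexp (X x) - iexp (Y x) \<partial>M)"
    using i by simp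
  also have "\<dots> \<le> (\<integral>x. cmod (iexp (X x) - iexp (Y x)) \<partial>M)"
    by (rule integral_norm_bound)
  also have "\<dots> \<le> (\<integral>x. \<bar>X x - Y x\<bar> \<partial>M)"
    using i int by (intro integral_mono cmod_iexp_diff_le integrable_norm Bochner_Integration.integrable_diff)
  finally show ?thesis .
qed

text \<open>The linear form in \<open>z\<close> factorizes over independent coordinates, and each
  factor is the standard normal characteristic function at \<open>sqrt (a j) * s j\<close>.\<close>

lemma gauss_mixture:
  assumes J: "finite J" and a: "\<And>j. j \<in> J \<Longrightarrow> a j \<ge> 0"
  shows "(\<integral>z. iexp (\<Sum>j\<in>J. sqrt (a j) * s j * z j) \<partial>std_gauss) = complex_of_real (exp (- (\<Sum>j\<in>J. a j * (s j)\<^sup>2) / 2))"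
proof -
  let ?f = "\<lambda>j (y::real). iexp (sqrt (a j) * s j * y)"
  have m: "(\<lambda>z. \<Prod>j\<in>J. ?f j (z j)) \<in> borel_measurable (PiM J (\<lambda>_. std_normal_distribution))"
    by (intro borel_measurable_prod borel_measurable_exp borel_measurable_times borel_measurable_const
      measurable_compose[OF measurable_component_singleton]) auto
  have "(\<integral>z. iexp (\<Sum>j\<in>J. sqrt (a j) * s j * z j) \<partial>std_gauss) = (\<integral>z. (\<Prod>j\<in>J. ?f j ((restrict z J) j)) \<partial>std_gauss)"
    by (simp add: sum_distrib_left exp_sum[OF J] cong: prod.cong)
  also have "\<dots> = (\<integral>z. (\<Prod>j\<in>J. ?f j (z j)) \<partial>distr std_gauss (PiM J (\<lambda>_. std_normal_distribution)) (\<lambda>z. restrict z J))"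
    by (rule integral_distr[symmetric, OF measurable_restrict_subset m]) simp
  also have "distr std_gauss (PiM J (\<lambda>_. std_normal_distribution)) (\<lambda>z. restrict z J) = PiM J (\<lambda>_. std_normal_distribution)"
    using J by (intro G.P.distr_PiM_restrict_finite) auto
  also have "(\<integral>z. (\<Prod>j\<in>J. ?f j (z j)) \<partial>PiM J (\<lambda>_. std_normal_distribution)) = (\<Prod>j\<in>J. integral\<^sup>L std_normal_distribution (?f j))"
    using J by (intro G.P.product_integral_prod) (auto intro!: G.integrable_const_bound[where B=1])
  also have "\<dots> = (\<Prod>j\<in>J. complex_of_real (exp (- (a j * (s j)\<^sup>2) / 2)))"
  proof (intro prod.cong refl)
    fix j assume j: "j \<in> J"
    have "integral\<^sup>L std_normal_distribution (?f j) = char std_normal_distribution (sqrt (a j) * s j)"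
      by (simp add: char_def)
    also have "\<dots> = complex_of_real (exp (- (a j * (s j)\<^sup>2) / 2))"
      using a[OF j] by (simp add: char_std_normal_distribution power_mult_distrib)
    finally show "integral\<^sup>L std_normal_distribution (?f j) = complex_of_real (exp (- (a j * (s j)\<^sup>2) / 2))" .
  qed
  also have "\<dots> = complex_of_real (exp (- (\<Sum>j\<in>J. a j * (s j)\<^sup>2) / 2))"
    using J by (simp add: of_real_prod[symmetric] exp_sum[symmetric] sum_negf sum_divide_distrib del: of_real_prod)
  finally show ?thesis .
qed

text \<open>
  In the variable \<open>y = exp (- s\<^sup>2) \<in> [0, 1]\<close> the oscillating factor is continuous once \<open>ln y\<close> is cut off
  at \<open>- K\<close>, so Weierstrass' theorem applies; the cut-off costs at most \<open>2 \<le> e s\<^sup>2\<close> where \<open>s\<^sup>2 > K\<close>.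
\<close>

lemma approx_osc_by_gaussians:
  fixes \<theta> e :: real
  assumes e: "e > 0"
  obtains d and c :: "nat \<Rightarrow> complex"
  where "\<And>s. cmod (iexp (\<theta> * s\<^sup>2) - (\<Sum>m\<le>d. c m * complex_of_real (exp (- (real m * s\<^sup>2))))) \<le> e * (1 + s\<^sup>2)"
proof -
  define K where "K = 2 / e"
  have K: "K > 0" using e by (simp add: K_def)
  define L where "L y = \<theta> * (- ln (max y (exp (- K))))" for y :: real
  have maxpos: "max y (exp (- K)) > 0" for y :: real by (simp add: less_max_iff_disj)
  have cont: "continuous_on {0..1} L" unfolding L_def
    using maxpos by (intro continuous_intros) (metis less_irrefl)
  have "continuous_on {0..1} (\<lambda>y. cos (L y))" "continuous_on {0..1} (\<lambda>y. sin (L y))"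
    using cont by (auto intro: continuous_intros)
  note cs = this
  from Stone_Weierstrass_real_polynomial_function[OF compact_Icc cs(1), of "e/2"] e obtain p where
    p: "real_polynomial_function p" "\<And>y. y \<in> {0..1} \<Longrightarrow> \<bar>cos (L y) - p y\<bar> < e/2" by auto
  from Stone_Weierstrass_real_polynomial_function[OF compact_Icc cs(2), of "e/2"] e obtain q where
    q: "real_polynomial_function q" "\<And>y. y \<in> {0..1} \<Longrightarrow> \<bar>sin (L y) - q y\<bar> < e/2" by auto
  from p(1) obtain a n where a: "p = (\<lambda>x. \<Sum>i\<le>n. a i * x ^ i)" by (auto simp: real_polynomial_function_iff_sum)
  from q(1) obtain b n' where b: "q = (\<lambda>x. \<Sum>i\<le>n'. b i * x ^ i)" by (auto simp: real_polynomial_function_iff_sum)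
  define d where "d = max n n'"
  define a' where "a' i = (if i \<le> n then a i else 0)" for i
  define b' where "b' i = (if i \<le> n' then b i else 0)" for i
  have a': "p y = (\<Sum>i\<le>d. a' i * y ^ i)" for y
    unfolding a d_def a'_def by (intro sum.mono_neutral_cong_left) auto
  have b': "q y = (\<Sum>i\<le>d. b' i * y ^ i)" for y
    unfolding b d_def b'_def by (intro sum.mono_neutral_cong_left) auto
  define c where "c m = complex_of_real (a' m) + \<i> * complex_of_real (b' m)" for m
  show ?thesis
  proof (rule that[of c d])
    fix s :: real
    define y where "y = exp (- (s\<^sup>2))"
    have y: "y \<in> {0..1}" by (simp add: y_def)
    have ym: "exp (- (real m * s\<^sup>2)) = y ^ m" for m
      by (simp add: y_def exp_of_nat_mult[symmetric])
    have sum: "(\<Sum>m\<le>d. c m * complex_of_real (exp (- (real m * s\<^sup>2)))) = complex_of_real (p y) + \<i> * complex_of_real (q y)"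
      by (simp add: a' b' c_def ym sum.distrib sum_distrib_left distrib_right mult.assoc)
    have "cmod (iexp (L y) - (complex_of_real (p y) + \<i> * complex_of_real (q y))) =
       cmod (complex_of_real (cos (L y) - p y) + \<i> * complex_of_real (sin (L y) - q y))"
      by (simp add: exp_Euler cos_of_real sin_of_real algebra_simps)
    also have "\<dots> \<le> cmod (complex_of_real (cos (L y) - p y)) + cmod (\<i> * complex_of_real (sin (L y) - q y))"
      by (rule norm_triangle_ineq)
    also have "\<dots> = \<bar>cos (L y) - p y\<bar> + \<bar>sin (L y) - q y\<bar>"
      unfolding norm_mult norm_of_real by simp
    also have "\<dots> \<le> e" using p(2)[OF y] q(2)[OF y] by simp
    finally have 1: "cmod (iexp (L y) - (complex_of_real (p y) + \<i> * complex_of_real (q y))) \<le> e" .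
    have 2: "cmod (iexp (\<theta> * s\<^sup>2) - iexp (L y)) \<le> e * s\<^sup>2"
    proof (cases "s\<^sup>2 \<le> K")
      case True
      then have "max y (exp (- K)) = y" by (simp add: y_def)
      then have "L y = \<theta> * s\<^sup>2" by (simp add: L_def y_def)
      then show ?thesis using e by simp
    next
      case False
      have "cmod (iexp (\<theta> * s\<^sup>2) - iexp (L y)) \<le> cmod (iexp (\<theta> * s\<^sup>2)) + cmod (iexp (L y))"
        by (rule norm_triangle_ineq4)
      also have "\<dots> = 2" unfolding norm_exp_i_times by simp
      also have "\<dots> = e * K" using e by (simp add: K_def)
      also have "\<dots> \<le> e * s\<^sup>2" using False e by (intro mult_left_mono) auto
      finally show ?thesis .
    qed
    have "cmod (iexp (\<theta> * s\<^sup>2) - (complex_of_real (p y) + \<i> * complex_of_real (q y))) \<le>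
      cmod (iexp (\<theta> * s\<^sup>2) - iexp (L y)) + cmod (iexp (L y) - (complex_of_real (p y) + \<i> * complex_of_real (q y)))"
      using norm_triangle_ineq[of "iexp (\<theta> * s\<^sup>2) - iexp (L y)" "iexp (L y) - (complex_of_real (p y) + \<i> * complex_of_real (q y))"]
      by (simp only: diff_add_cancel add_diff_eq diff_add_eq)
    also have "\<dots> \<le> e * s\<^sup>2 + e" by (intro add_mono 1 2)
    finally show "cmod (iexp (\<theta> * s\<^sup>2) - (\<Sum>m\<le>d. c m * complex_of_real (exp (- (real m * s\<^sup>2))))) \<le> e * (1 + s\<^sup>2)"
      unfolding sum by (simp add: algebra_simps)
  qed
qed

section \<open>Central limit theorem and weak law on the product space\<close>

context iid_seq
begin

lemma indep_coordinates: "Q.indep_vars (\<lambda>_. F) (\<lambda>i x. x i) UNIV"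
proof (subst Q.indep_vars_iff_distr_eq_PiM)
  have "distr Q (PiM UNIV (\<lambda>_. F)) (\<lambda>x. \<lambda>i\<in>UNIV. x i) = Q"
    by (simp add: Q_def restrict_UNIV distr_id[of "PiM UNIV (\<lambda>_. F)", simplified])
  then show "distr Q (PiM UNIV (\<lambda>_. F)) (\<lambda>x. \<lambda>i\<in>UNIV. x i) = (\<Pi>\<^sub>M i\<in>UNIV. distr Q F (\<lambda>x. x i))"
    by (simp only: distr_component Q_def[symmetric])
qed auto

text \<open>Evaluating the standardized limit at \<open>sqrt v\<close> undoes the division by the
  standard deviation. Zero variance is treated apart, since it cannot be standardized.\<close>

lemma clt_char:
  assumes f: "in_L2 F f" and mean: "(\<integral>x. f x \<partial>F) = 0"
  shows "(\<lambda>n. \<integral>x. iexp ((\<Sum>i<n. f (x i)) / sqrt (real n)) \<partial>Q) \<longlonglongrightarrow> complex_of_real (exp (- (\<integral>x. (f x)\<^sup>2 \<partial>F) / 2))"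
proof (cases "(\<integral>x. (f x)\<^sup>2 \<partial>F) = 0")
  case True
  have [measurable]: "f \<in> borel_measurable F" using f by (simp add: in_L2_def)
  have "AE x in Q. f (x i) = 0" for i
    using AE_component[OF AE_zero_of_L2_norm_zero[OF f True]] .
  then have z: "AE x in Q. \<forall>i. f (x i) = 0" by (simp add: AE_all_countable)
  have "(\<integral>x. iexp ((\<Sum>i<n. f (x i)) / sqrt (real n)) \<partial>Q) = (\<integral>x. 1 \<partial>Q)" for n
    by (intro integral_cong_AE) (use z in \<open>auto elim!: eventually_mono\<close>)
  then show ?thesis using True by (simp add: Q.prob_space)
next
  case False
  have [measurable]: "f \<in> borel_measurable F" using f by (simp add: in_L2_def)
  define v where "v = (\<integral>x. (f x)\<^sup>2 \<partial>F)"
  have v: "v > 0" using False by (simp add: v_def less_le)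
  define X where "X i x = f (x i)" for i :: nat and x
  have indep: "Q.indep_vars (\<lambda>i. borel) X UNIV"
    unfolding X_def[abs_def] using indep_coordinates by (rule Q.indep_vars_compose2) auto
  have meanX: "Q.expectation (X n) = 0" for n
    unfolding X_def using mean by (simp add: integral_component)
  have "weak_conv_m (\<lambda>n. distr Q borel (\<lambda>x. (\<Sum>i<n. X i x) / sqrt (real n * (sqrt v)\<^sup>2))) std_normal_distribution"
  proof (rule Q.central_limit_theorem_zero_mean[OF indep, where \<mu>="distr F borel f"])
    show "integrable Q (\<lambda>x. (X n x)\<^sup>2)" for n
      using in_L2_component[OF f, of n] by (simp add: X_def in_L2_def)
    show "Q.variance (X n) = (sqrt v)\<^sup>2" for n
      using v integral_component[of "\<lambda>x. (f x)\<^sup>2" n] by (simp add: meanX X_def v_def)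
    show "distr Q borel (X n) = distr F borel f" for n
    proof -
      have "distr F borel f = distr (distr Q F (\<lambda>x. x n)) borel f" by (simp add: distr_component)
      also have "\<dots> = distr Q borel (X n)" by (subst distr_distr) (auto simp: X_def[abs_def] comp_def)
      finally show ?thesis by simp
    qed
  qed (use meanX v in auto)
  from levy_continuity1[OF _ real_dist_normal_dist this, of "sqrt v"]
  have "(\<lambda>n. char (distr Q borel (\<lambda>x. (\<Sum>i<n. X i x) / sqrt (real n * (sqrt v)\<^sup>2))) (sqrt v))
      \<longlonglongrightarrow> complex_of_real (exp (- ((sqrt v)\<^sup>2) / 2))"
    by (simp add: char_std_normal_distribution Q.real_distribution_distr X_def[abs_def])
  moreover have "char (distr Q borel (\<lambda>x. (\<Sum>i<n. X i x) / sqrt (real n * (sqrt v)\<^sup>2))) (sqrt v) =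
    (\<integral>x. iexp ((\<Sum>i<n. f (x i)) / sqrt (real n)) \<partial>Q)" for n
    unfolding char_def X_def using v
    by (subst integral_distr) (auto simp: real_sqrt_mult)
  ultimately show ?thesis using v by (simp add: v_def)
qed

text \<open>Applied later to squares of eigenfunctions, which are integrable but may lack a
  variance. Hence the truncation: the bounded part is handled by its variance, and the rest is small
  in L1 uniformly in \<open>n\<close>.\<close>

lemma weak_law_L1:
  assumes f: "integrable F f"
  shows "(\<lambda>n. \<integral>x. \<bar>(\<Sum>i<n. f (x i)) / real n - (\<integral>y. f y \<partial>F)\<bar> \<partial>Q) \<longlonglongrightarrow> 0"
proof (rule LIMSEQ_I)
  fix e :: real assume e: "e > 0"
  note [measurable] = borel_measurable_integrable[OF f]
  define g where "g K x = (if \<bar>f x\<bar> \<le> real K then f x else 0)" for K :: nat and x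
  have [measurable]: "g K \<in> borel_measurable F" for K unfolding g_def by measurable
  have "(\<lambda>K. \<integral>x. \<bar>f x - g K x\<bar> \<partial>F) \<longlonglongrightarrow> (\<integral>x. 0 \<partial>F)"
  proof (rule integral_dominated_convergence[where w="\<lambda>x. \<bar>f x\<bar>"])
    have "(\<lambda>K. \<bar>f x - g K x\<bar>) \<longlonglongrightarrow> 0" for x
    proof (rule tendsto_eventually)
      show "\<forall>\<^sub>F K in sequentially. \<bar>f x - g K x\<bar> = 0"
      proof (rule eventually_sequentiallyI[of "nat \<lceil>\<bar>f x\<bar>\<rceil>"])
        fix K assume "nat \<lceil>\<bar>f x\<bar>\<rceil> \<le> K"
        then have "\<bar>f x\<bar> \<le> real K" by linarith
        then show "\<bar>f x - g K x\<bar> = 0" by (simp add: g_def)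
      qed
    qed
    then show "AE x in F. (\<lambda>K. \<bar>f x - g K x\<bar>) \<longlonglongrightarrow> 0" by simp
    show "AE x in F. norm \<bar>f x - g K x\<bar> \<le> \<bar>f x\<bar>" for K by (simp add: g_def)
  qed (use f in auto)
  then have "(\<lambda>K. \<integral>x. \<bar>f x - g K x\<bar> \<partial>F) \<longlonglongrightarrow> 0" by simp
  \<comment> \<open>The truncation error is paid twice, once in the sample mean and once in the
    expectation, leaving \<open>e/2\<close> for the fluctuation.\<close>
  from LIMSEQ_D[OF this, of "e/4"] e obtain K where K: "(\<integral>x. \<bar>f x - g K x\<bar> \<partial>F) < e/4" by auto
  have gL: "in_L2 F (g K)"
  proof -
    have "integrable F (\<lambda>x. (g K x)\<^sup>2)"
    proof (rule integrable_const_bound[where B="(real K)\<^sup>2"])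
      have "\<bar>g K x\<bar> \<le> real K" for x by (simp add: g_def)
      then show "AE x in F. norm ((g K x)\<^sup>2) \<le> (real K)\<^sup>2"
        using power_mono[of "\<bar>g K x\<bar>" "real K" 2 for x] by simp
    qed simp
    then show ?thesis by (simp add: in_L2_def)
  qed
  define \<mu> where "\<mu> = (\<integral>y. g K y \<partial>F)"
  define \<psi> where "\<psi> x = g K x - \<mu>" for x
  have \<psi>L: "in_L2 F \<psi>" unfolding \<psi>_def by (intro in_L2_diff gL in_L2_const)
  have \<psi>m: "(\<integral>x. \<psi> x \<partial>F) = 0"
    unfolding \<psi>_def using in_L2_integrable[OF gL] by (simp add: \<mu>_def prob_space)
  let ?v = "\<integral>x. (\<psi> x)\<^sup>2 \<partial>F"
  have main: "(\<integral>x. \<bar>(\<Sum>i<n. f (x i)) / real n - (\<integral>y. f y \<partial>F)\<bar> \<partial>Q) \<le> e/2 + sqrt (?v / real n)" if n: "n > 0" for n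
  proof -
    define p where "p = psum \<psi> (\<lambda>_. 1 / real n) {..<n}"
    have pL: "in_L2 Q p" unfolding p_def by (rule psum_L2[OF \<psi>L \<psi>m])
    have p2: "(\<integral>x. (p x)\<^sup>2 \<partial>Q) = ?v / real n"
      unfolding p_def using n by (subst psum_second_moment[OF \<psi>L \<psi>m]) (auto simp: power2_eq_square)
    have intd: "integrable F (\<lambda>x. \<bar>f x - g K x\<bar>)"
      using f in_L2_integrable[OF gL] by (intro integrable_abs Bochner_Integration.integrable_diff)
    have mu_le: "\<bar>\<mu> - (\<integral>y. f y \<partial>F)\<bar> \<le> e/4"
    proof -
      have "\<bar>\<mu> - (\<integral>y. f y \<partial>F)\<bar> = \<bar>\<integral>y. f y - g K y \<partial>F\<bar>"
        using f in_L2_integrable[OF gL] by (simp add: \<mu>_def)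
      also have "\<dots> \<le> (\<integral>y. \<bar>f y - g K y\<bar> \<partial>F)" by (rule integral_abs_bound)
      finally show ?thesis using K by simp
    qed
    have "(\<integral>x. \<bar>(\<Sum>i<n. f (x i)) / real n - (\<integral>y. f y \<partial>F)\<bar> \<partial>Q) \<le>
       (\<integral>x. (\<Sum>i<n. \<bar>f (x i) - g K (x i)\<bar> / real n) + \<bar>p x\<bar> + \<bar>\<mu> - (\<integral>y. f y \<partial>F)\<bar> \<partial>Q)"
    proof (rule integral_mono)
      show "integrable Q (\<lambda>x. \<bar>(\<Sum>i<n. f (x i)) / real n - (\<integral>y. f y \<partial>F)\<bar>)"
        using integrable_component[OF f] by auto
      show "integrable Q (\<lambda>x. (\<Sum>i<n. \<bar>f (x i) - g K (x i)\<bar> / real n) + \<bar>p x\<bar> + \<bar>\<mu> - (\<integral>y. f y \<partial>F)\<bar>)"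
        using integrable_component[OF intd] Q.in_L2_integrable[OF pL] by auto
      fix x
      have px: "p x = (\<Sum>i<n. g K (x i)) / real n - \<mu>"
        using n by (simp add: p_def psum_def[OF \<psi>L \<psi>m] \<psi>_def sum_subtractf diff_divide_distrib sum_divide_distrib[symmetric])
      have "(\<Sum>i<n. f (x i)) / real n - (\<integral>y. f y \<partial>F) =
        (\<Sum>i<n. (f (x i) - g K (x i)) / real n) + p x + (\<mu> - (\<integral>y. f y \<partial>F))"
        by (simp add: px sum_subtractf diff_divide_distrib sum_divide_distrib[symmetric])
      moreover have "\<bar>\<Sum>i<n. (f (x i) - g K (x i)) / real n\<bar> \<le> (\<Sum>i<n. \<bar>f (x i) - g K (x i)\<bar> / real n)"
        by (rule order_trans[OF sum_abs]) simp
      ultimately show "\<bar>(\<Sum>i<n. f (x i)) / real n - (\<integral>y. f y \<partial>F)\<bar> \<le>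
         (\<Sum>i<n. \<bar>f (x i) - g K (x i)\<bar> / real n) + \<bar>p x\<bar> + \<bar>\<mu> - (\<integral>y. f y \<partial>F)\<bar>" by linarith
    qed
    also have "\<dots> = (\<integral>x. \<bar>f x - g K x\<bar> \<partial>F) + (\<integral>x. \<bar>p x\<bar> \<partial>Q) + \<bar>\<mu> - (\<integral>y. f y \<partial>F)\<bar>"
      using integrable_component[OF intd] Q.in_L2_integrable[OF pL] n
        integral_component[of "\<lambda>x. \<bar>f x - g K x\<bar>"] by (simp add: Q.prob_space)
    also have "\<dots> \<le> e/4 + sqrt (?v / real n) + e/4"
      using Q.L1_norm_le_L2_norm[OF pL] K mu_le by (simp add: p2)
    finally show ?thesis by simp
  qed
  have "(\<lambda>n. sqrt (?v / real n)) \<longlonglongrightarrow> sqrt 0"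
    by (intro tendsto_real_sqrt tendsto_divide_0[OF tendsto_const] filterlim_at_top_imp_at_infinity filterlim_real_sequentially)
  then have "(\<lambda>n. sqrt (?v / real n)) \<longlonglongrightarrow> 0" by simp
  from LIMSEQ_D[OF this, of "e/2"] e obtain n0 where n0: "\<And>n. n \<ge> n0 \<Longrightarrow> sqrt (?v / real n) < e/2" by auto
  show "\<exists>n0. \<forall>n\<ge>n0. norm ((\<integral>x. \<bar>(\<Sum>i<n. f (x i)) / real n - (\<integral>y. f y \<partial>F)\<bar> \<partial>Q) - 0) < e"
  proof (intro exI[of _ "max n0 1"] allI impI)
    fix n assume "max n0 1 \<le> n"
    then have "(\<integral>x. \<bar>(\<Sum>i<n. f (x i)) / real n - (\<integral>y. f y \<partial>F)\<bar> \<partial>Q) < e"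
      using main[of n] n0[of n] by simp
    then show "norm ((\<integral>x. \<bar>(\<Sum>i<n. f (x i)) / real n - (\<integral>y. f y \<partial>F)\<bar> \<partial>Q) - 0) < e"
      by simp
  qed
qed

end

section \<open>Joint limits of normalized sums\<close>

lemma tendsto_by_approximation:
  fixes A :: "nat \<Rightarrow> complex"
  assumes "\<And>e. e > 0 \<Longrightarrow> \<exists>B b. B \<longlonglongrightarrow> b \<and> (\<forall>\<^sub>F n in sequentially. cmod (A n - B n) \<le> e) \<and> cmod (a - b) \<le> e"
  shows "A \<longlonglongrightarrow> a"
proof (rule tendstoI)
  fix e :: real assume e: "e > 0"
  from assms[of "e/4"] e obtain B b where B: "B \<longlonglongrightarrow> b" "\<forall>\<^sub>F n in sequentially. cmod (A n - B n) \<le> e/4" "cmod (a - b) \<le> e/4"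
    by auto
  from tendstoD[OF B(1), of "e/4"] e have "\<forall>\<^sub>F n in sequentially. dist (B n) b < e/4" by simp
  with B(2) show "\<forall>\<^sub>F n in sequentially. dist (A n) a < e"
  proof eventually_elim
    case (elim n)
    have "dist (A n) a \<le> dist (A n) (B n) + dist (B n) b + dist b a"
      using dist_triangle[of "A n" a "B n"] dist_triangle[of "B n" a b] by linarith
    then show ?case using elim B(3) e by (simp add: dist_norm norm_minus_commute)
  qed
qed

lemma gauss_component_measurable[measurable]: "(\<lambda>z. z j) \<in> borel_measurable std_gauss"
  using G.component_measurable[of j] by simp

lemma std_gauss_space: "measure std_gauss (space std_gauss) = 1"
  by (intro prob_space.prob_space prob_space_PiM prob_space_std_normal)

lemma std_normal_L2: "in_L2 std_normal_distribution (\<lambda>x. x)"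
  using integrable_std_normal_distribution_moment[of 2] by (simp add: in_L2_def)

lemma std_normal_second_moment: "(\<integral>x. x\<^sup>2 \<partial>std_normal_distribution) = 1"
  using std_normal_distribution_even_moments(1)[of 1] by simp

lemma gauss_second_moment: "integrable std_gauss (\<lambda>z. (z j)\<^sup>2)" "(\<integral>z. (z j)\<^sup>2 \<partial>std_gauss) = 1"
  using G.integrable_component[of "\<lambda>x. x\<^sup>2" j] G.integral_component[of "\<lambda>x. x\<^sup>2" j]
    std_normal_L2 std_normal_second_moment by (simp_all add: in_L2_def)

context iid_seq
begin

definition nsum :: "('v \<Rightarrow> real) \<Rightarrow> nat \<Rightarrow> (nat \<Rightarrow> 'v) \<Rightarrow> real" where
  "nsum f n x = (\<Sum>i<n. f (x i)) / sqrt (real n)"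

lemma nsum_measurable[measurable (raw)]:
  assumes [measurable]: "f \<in> borel_measurable F" "g \<in> measurable N Q"
  shows "(\<lambda>w. nsum f n (g w)) \<in> borel_measurable N"
proof -
  have [measurable]: "(\<lambda>w. g w i) \<in> measurable N F" for i
    using assms(2) by (simp add: measurable_Q_iff)
  show ?thesis unfolding nsum_def by measurable
qed

lemma nsum_second_moment:
  assumes f: "in_L2 F f" "(\<integral>x. f x \<partial>F) = 0"
  shows "in_L2 Q (nsum f n)"
    and "n > 0 \<Longrightarrow> (\<integral>x. (nsum f n x)\<^sup>2 \<partial>Q) = (\<integral>x. (f x)\<^sup>2 \<partial>F)"
proof -
  have eq: "nsum f n = psum f (\<lambda>_. 1 / sqrt (real n)) {..<n}"
    by (auto simp: nsum_def psum_def[OF f] sum_divide_distrib)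
  show "in_L2 Q (nsum f n)" unfolding eq by (rule psum_L2[OF f])
  show "n > 0 \<Longrightarrow> (\<integral>x. (nsum f n x)\<^sup>2 \<partial>Q) = (\<integral>x. (f x)\<^sup>2 \<partial>F)"
    unfolding eq by (subst psum_second_moment[OF f]) (auto simp: power_divide)
qed

context
  fixes J :: "nat set" and \<phi> :: "nat \<Rightarrow> 'v \<Rightarrow> real"
  assumes J: "finite J" and \<phi>L: "\<And>j. j \<in> J \<Longrightarrow> in_L2 F (\<phi> j)" and \<phi>m: "\<And>j. j \<in> J \<Longrightarrow> (\<integral>x. \<phi> j x \<partial>F) = 0"
    and \<phi>o: "\<And>i j. i \<in> J \<Longrightarrow> j \<in> J \<Longrightarrow> (\<integral>x. \<phi> i x * \<phi> j x \<partial>F) = (if i = j then 1 else 0)"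
begin

lemma orthonormal_combination:
  shows "in_L2 F (\<lambda>y. \<Sum>j\<in>J. u j * \<phi> j y)" "(\<integral>y. (\<Sum>j\<in>J. u j * \<phi> j y) \<partial>F) = 0"
    "(\<integral>y. (\<Sum>j\<in>J. u j * \<phi> j y)\<^sup>2 \<partial>F) = (\<Sum>j\<in>J. (u j)\<^sup>2)"
proof -
  show "in_L2 F (\<lambda>y. \<Sum>j\<in>J. u j * \<phi> j y)" by (intro in_L2_sum in_L2_cmult \<phi>L)
  show "(\<integral>y. (\<Sum>j\<in>J. u j * \<phi> j y) \<partial>F) = 0"
    using in_L2_integrable[OF \<phi>L] by (simp add: \<phi>m)
  have "(\<integral>y. (\<Sum>j\<in>J. u j * \<phi> j y)\<^sup>2 \<partial>F) = (\<integral>y. (\<Sum>i\<in>J. \<Sum>j\<in>J. (u i * u j) * (\<phi> i y * \<phi> j y)) \<partial>F)"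
    by (simp add: power2_eq_square sum_product mult_ac)
  also have "\<dots> = (\<Sum>i\<in>J. \<Sum>j\<in>J. (u i * u j) * (\<integral>y. \<phi> i y * \<phi> j y \<partial>F))"
    using in_L2_mult_integrable[OF \<phi>L \<phi>L] by simp
  also have "\<dots> = (\<Sum>i\<in>J. \<Sum>j\<in>J. if i = j then (u i)\<^sup>2 else 0)"
    by (intro sum.cong refl) (auto simp: \<phi>o power2_eq_square)
  also have "\<dots> = (\<Sum>j\<in>J. (u j)\<^sup>2)" using J by simp
  finally show "(\<integral>y. (\<Sum>j\<in>J. u j * \<phi> j y)\<^sup>2 \<partial>F) = (\<Sum>j\<in>J. (u j)\<^sup>2)" .
qed

text \<open>After the two integrals are swapped, \<open>z\<close> is fixed and a single linear
  combination of the \<open>\<phi> j\<close> remains. By orthonormality its limiting variance is a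
  quadratic form in \<open>z\<close>, so the auxiliary Gaussian weights become the limiting normal
  variables.\<close>

lemma laplace_conv:
  assumes b: "\<And>j. j \<in> J \<Longrightarrow> b j \<ge> (0::real)"
  shows "(\<lambda>n. \<integral>x. complex_of_real (exp (- (\<Sum>j\<in>J. b j * (nsum (\<phi> j) n x)\<^sup>2))) \<partial>Q)
    \<longlonglongrightarrow> (\<integral>z. complex_of_real (exp (- (\<Sum>j\<in>J. b j * (z j)\<^sup>2))) \<partial>std_gauss)"
proof -
  have [measurable]: "\<And>j. j \<in> J \<Longrightarrow> \<phi> j \<in> borel_measurable F" using \<phi>L by (simp add: in_L2_def)
  interpret QG: pair_prob_space Q std_gauss ..
  \<comment> \<open>The factor 2 cancels the 1/2 in the exponent of the normal characteristic
    function.\<close>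
  define r where "r j = sqrt (2 * b j)" for j
  define E where "E n w = iexp (\<Sum>j\<in>J. r j * nsum (\<phi> j) n (fst w) * (snd w) j)" for n w
  have mE[measurable]: "E n \<in> borel_measurable (Q \<Otimes>\<^sub>M std_gauss)" for n unfolding E_def by measurable
  have normE: "cmod (E n w) = 1" for n w unfolding E_def by (rule norm_exp_i_times)
  have iE: "integrable (Q \<Otimes>\<^sub>M std_gauss) (\<lambda>(x, z). E n (x, z))" for n
    by (intro QG.integrable_const_bound[where B=1]) (auto simp: normE case_prod_beta')
  have mix: "(\<integral>z. E n (x, z) \<partial>std_gauss) = complex_of_real (exp (- (\<Sum>j\<in>J. b j * (nsum (\<phi> j) n x)\<^sup>2)))" for n x
  proof -
    have "(\<integral>z. E n (x, z) \<partial>std_gauss) = complex_of_real (exp (- (\<Sum>j\<in>J. (2 * b j) * (nsum (\<phi> j) n x)\<^sup>2) / 2))"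
      unfolding E_def r_def fst_conv snd_conv using b by (intro gauss_mixture J) auto
    then show ?thesis by (simp add: sum_divide_distrib)
  qed
  have swap: "(\<integral>x. complex_of_real (exp (- (\<Sum>j\<in>J. b j * (nsum (\<phi> j) n x)\<^sup>2))) \<partial>Q) = (\<integral>z. \<integral>x. E n (x, z) \<partial>Q \<partial>std_gauss)" for n
    unfolding mix[symmetric] using QG.Fubini_integral[OF iE[of n]] by simp
  have inner: "(\<lambda>n. \<integral>x. E n (x, z) \<partial>Q) \<longlonglongrightarrow> complex_of_real (exp (- (\<Sum>j\<in>J. b j * (z j)\<^sup>2)))" for z
  proof -
    let ?f = "\<lambda>y. \<Sum>j\<in>J. (r j * z j) * \<phi> j y"
    have "E n (x, z) = iexp ((\<Sum>i<n. ?f (x i)) / sqrt (real n))" for n x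
      unfolding E_def nsum_def fst_conv snd_conv
      by (subst sum.swap) (simp add: sum_distrib_left sum_distrib_right sum_divide_distrib mult_ac)
    moreover have "(\<lambda>n. \<integral>x. iexp ((\<Sum>i<n. ?f (x i)) / sqrt (real n)) \<partial>Q) \<longlonglongrightarrow>
        complex_of_real (exp (- (\<integral>y. (?f y)\<^sup>2 \<partial>F) / 2))"
      by (intro clt_char orthonormal_combination)
    moreover have "- (\<integral>y. (?f y)\<^sup>2 \<partial>F) / 2 = - (\<Sum>j\<in>J. b j * (z j)\<^sup>2)"
      unfolding orthonormal_combination r_def using b
      by (simp add: power_mult_distrib sum_divide_distrib cong: sum.cong)
    ultimately show ?thesis by simp
  qed
  have "(\<lambda>n. \<integral>z. \<integral>x. E n (x, z) \<partial>Q \<partial>std_gauss) \<longlonglongrightarrow> (\<integral>z. complex_of_real (exp (- (\<Sum>j\<in>J. b j * (z j)\<^sup>2))) \<partial>std_gauss)"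
  proof (rule integral_dominated_convergence[where w="\<lambda>_. 1"])
    show "AE z in std_gauss. (\<lambda>n. \<integral>x. E n (x, z) \<partial>Q) \<longlonglongrightarrow> complex_of_real (exp (- (\<Sum>j\<in>J. b j * (z j)\<^sup>2)))"
      using inner by simp
    show "AE z in std_gauss. norm (\<integral>x. E n (x, z) \<partial>Q) \<le> 1" for n
    proof (rule AE_I2)
      fix z
      have "norm (\<integral>x. E n (x, z) \<partial>Q) \<le> (\<integral>x. norm (E n (x, z)) \<partial>Q)" by (rule integral_norm_bound)
      then show "norm (\<integral>x. E n (x, z) \<partial>Q) \<le> 1" by (simp add: normE Q.prob_space)
    qed
    show "integrable std_gauss (\<lambda>_. 1)" by simp
  qed measurable
  then show ?thesis unfolding swap .
qed

text \<open>The coordinates in \<open>I\<close> oscillate and those in \<open>J - I\<close> are damped; induction on \<open>I\<close> moves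
  coordinates from the second kind to the first.\<close>

definition osc :: "(nat \<Rightarrow> real) \<Rightarrow> nat set \<Rightarrow> (nat \<Rightarrow> nat) \<Rightarrow> (nat \<Rightarrow> real) \<Rightarrow> complex" where
  "osc \<theta> I b s = iexp (\<Sum>j\<in>I. \<theta> j * (s j)\<^sup>2) * complex_of_real (exp (- (\<Sum>j\<in>J-I. real (b j) * (s j)\<^sup>2)))"

lemma norm_osc: "cmod (osc \<theta> I b s) \<le> 1"
  unfolding osc_def norm_mult norm_exp_i_times norm_of_real
  by (simp add: sum_nonneg)

lemma osc_conv:
  assumes "I \<subseteq> J"
  shows "(\<lambda>n. \<integral>x. osc \<theta> I b (\<lambda>j. nsum (\<phi> j) n x) \<partial>Q) \<longlonglongrightarrow> (\<integral>z. osc \<theta> I b z \<partial>std_gauss)"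
proof -
  have [measurable]: "\<And>j. j \<in> J \<Longrightarrow> \<phi> j \<in> borel_measurable F" using \<phi>L by (simp add: in_L2_def)
  have "finite I" using J assms finite_subset by blast
  from this assms show ?thesis
  proof (induction I arbitrary: b rule: finite_induct)
    case empty
    show ?case using laplace_conv[of "\<lambda>j. real (b j)"] by (simp add: osc_def)
  next
    case (insert i I)
    then have i: "i \<in> J" "i \<notin> I" "I \<subseteq> J" by auto
    have mx[measurable]: "(\<lambda>x. osc \<theta> K b (\<lambda>j. nsum (\<phi> j) n x)) \<in> borel_measurable Q" if "K \<subseteq> J" for K b n
    proof -
      have [measurable]: "\<And>j. j \<in> K \<Longrightarrow> \<phi> j \<in> borel_measurable F" using that by auto
      show ?thesis unfolding osc_def by measurable
    qed
    have mz[measurable]: "osc \<theta> K b \<in> borel_measurable std_gauss" for K b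
      unfolding osc_def[abs_def] by measurable
    have ix: "integrable Q (\<lambda>x. osc \<theta> K b (\<lambda>j. nsum (\<phi> j) n x))" if "K \<subseteq> J" for K b n
      using that by (intro Q.integrable_const_bound[where B=1] mx) (auto simp: norm_osc)
    have iz: "integrable std_gauss (osc \<theta> K b)" for K b
      by (intro G.P.integrable_const_bound[where B=1] mz) (auto simp: norm_osc)
    show ?case
    proof (rule tendsto_by_approximation)
      fix e :: real assume e: "e > 0"
      \<comment> \<open>Half of \<open>e\<close> suffices because \<open>1 + (s i)\<^sup>2\<close>
        has mean 2 both for the normalized sum and for the normal coordinate.\<close>
      then have "e/2 > 0" by simp
      from approx_osc_by_gaussians[OF this, of "\<theta> i"] obtain c d where
        cd: "\<And>s. cmod (iexp (\<theta> i * s\<^sup>2) - (\<Sum>m\<le>d. c m * complex_of_real (exp (- (real m * s\<^sup>2))))) \<le> e/2 * (1 + s\<^sup>2)" by blast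
      \<comment> \<open>Each term damps coordinate \<open>i\<close> at rate \<open>m\<close>. The
        induction hypothesis covers it because the rates \<open>b\<close> are arbitrary
        there.\<close>
      define B where "B s = (\<Sum>m\<le>d. c m * osc \<theta> I (b(i := m)) s)" for s
      have diff: "cmod (osc \<theta> (insert i I) b s - B s) \<le> e/2 * (1 + (s i)\<^sup>2)" for s
      proof -
        define P where "P = iexp (\<Sum>j\<in>I. \<theta> j * (s j)\<^sup>2) * complex_of_real (exp (- (\<Sum>j\<in>J - insert i I. real (b j) * (s j)\<^sup>2)))"
        have P1: "cmod P \<le> 1" unfolding P_def norm_mult norm_exp_i_times norm_of_real by (simp add: sum_nonneg)
        have 1: "osc \<theta> (insert i I) b s = iexp (\<theta> i * (s i)\<^sup>2) * P"
          using insert by (simp add: osc_def P_def distrib_left exp_add)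
        have 2: "osc \<theta> I (b(i := m)) s = complex_of_real (exp (- (real m * (s i)\<^sup>2))) * P" for m
        proof -
          have "(\<Sum>j\<in>J - I. real ((b(i := m)) j) * (s j)\<^sup>2) = real m * (s i)\<^sup>2 + (\<Sum>j\<in>J - insert i I. real (b j) * (s j)\<^sup>2)"
          proof -
            have JI: "J - I = insert i (J - insert i I)" using i by auto
            have "(\<Sum>j\<in>J - I. real ((b(i := m)) j) * (s j)\<^sup>2) =
              real ((b(i := m)) i) * (s i)\<^sup>2 + (\<Sum>j\<in>J - insert i I. real ((b(i := m)) j) * (s j)\<^sup>2)"
              using J by (subst JI, subst sum.insert) auto
            also have "(\<Sum>j\<in>J - insert i I. real ((b(i := m)) j) * (s j)\<^sup>2) = (\<Sum>j\<in>J - insert i I. real (b j) * (s j)\<^sup>2)"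
              by (intro sum.cong) auto
            finally show ?thesis by simp
          qed
          then show ?thesis by (simp add: osc_def P_def exp_add exp_diff exp_minus field_simps)
        qed
        have "osc \<theta> (insert i I) b s - B s =
          (iexp (\<theta> i * (s i)\<^sup>2) - (\<Sum>m\<le>d. c m * complex_of_real (exp (- (real m * (s i)\<^sup>2))))) * P"
          unfolding B_def 1 2 by (simp add: left_diff_distrib sum_distrib_right mult.assoc)
        then have "cmod (osc \<theta> (insert i I) b s - B s) =
          cmod (iexp (\<theta> i * (s i)\<^sup>2) - (\<Sum>m\<le>d. c m * complex_of_real (exp (- (real m * (s i)\<^sup>2))))) * cmod P"
          by (simp only: norm_mult)
        also have "\<dots> \<le> e/2 * (1 + (s i)\<^sup>2) * 1"
          using e by (intro mult_mono cd P1) auto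
        finally show ?thesis by simp
      qed
      show "\<exists>B b'. B \<longlonglongrightarrow> b' \<and>
          (\<forall>\<^sub>F n in sequentially. cmod ((\<integral>x. osc \<theta> (insert i I) b (\<lambda>j. nsum (\<phi> j) n x) \<partial>Q) - B n) \<le> e) \<and>
          cmod ((\<integral>z. osc \<theta> (insert i I) b z \<partial>std_gauss) - b') \<le> e"
      proof (intro exI conjI)
        have "(\<lambda>n. \<Sum>m\<le>d. c m * (\<integral>x. osc \<theta> I (b(i := m)) (\<lambda>j. nsum (\<phi> j) n x) \<partial>Q)) \<longlonglongrightarrow>
          (\<Sum>m\<le>d. c m * (\<integral>z. osc \<theta> I (b(i := m)) z \<partial>std_gauss))"
          by (intro tendsto_sum tendsto_mult tendsto_const insert.IH i)
        then show "(\<lambda>n. \<integral>x. B (\<lambda>j. nsum (\<phi> j) n x) \<partial>Q) \<longlonglongrightarrow> (\<integral>z. B z \<partial>std_gauss)"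
          using ix[OF i(3)] iz by (simp add: B_def)
        have iBx: "integrable Q (\<lambda>x. B (\<lambda>j. nsum (\<phi> j) n x))" for n
          unfolding B_def using ix[OF i(3)] by auto
        have iBz: "integrable std_gauss B"
          unfolding B_def[abs_def] using iz by auto
        show "cmod ((\<integral>z. osc \<theta> (insert i I) b z \<partial>std_gauss) - (\<integral>z. B z \<partial>std_gauss)) \<le> e"
        proof -
          have "cmod ((\<integral>z. osc \<theta> (insert i I) b z \<partial>std_gauss) - (\<integral>z. B z \<partial>std_gauss)) =
            cmod (\<integral>z. osc \<theta> (insert i I) b z - B z \<partial>std_gauss)"
            using iz iBz by simp
          also have "\<dots> \<le> (\<integral>z. cmod (osc \<theta> (insert i I) b z - B z) \<partial>std_gauss)" by (rule integral_norm_bound)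
          also have "\<dots> \<le> (\<integral>z. e/2 * (1 + (z i)\<^sup>2) \<partial>std_gauss)"
            using iz iBz gauss_second_moment(1)[of i] by (intro integral_mono diff) auto
          also have "\<dots> = e" using gauss_second_moment[of i] by (simp add: std_gauss_space)
          finally show ?thesis .
        qed
        show "\<forall>\<^sub>F n in sequentially. cmod ((\<integral>x. osc \<theta> (insert i I) b (\<lambda>j. nsum (\<phi> j) n x) \<partial>Q) - (\<integral>x. B (\<lambda>j. nsum (\<phi> j) n x) \<partial>Q)) \<le> e"
          using eventually_gt_at_top[of 0]
        proof eventually_elim
          case (elim n)
          have i2: "integrable Q (\<lambda>x. (nsum (\<phi> i) n x)\<^sup>2)"
            using nsum_second_moment(1)[OF \<phi>L \<phi>m] i by (simp add: in_L2_def)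
          have "cmod ((\<integral>x. osc \<theta> (insert i I) b (\<lambda>j. nsum (\<phi> j) n x) \<partial>Q) - (\<integral>x. B (\<lambda>j. nsum (\<phi> j) n x) \<partial>Q)) =
            cmod (\<integral>x. osc \<theta> (insert i I) b (\<lambda>j. nsum (\<phi> j) n x) - B (\<lambda>j. nsum (\<phi> j) n x) \<partial>Q)"
            using ix[of "insert i I"] iBx insert.prems by simp
          also have "\<dots> \<le> (\<integral>x. cmod (osc \<theta> (insert i I) b (\<lambda>j. nsum (\<phi> j) n x) - B (\<lambda>j. nsum (\<phi> j) n x)) \<partial>Q)" by (rule integral_norm_bound)
          also have "\<dots> \<le> (\<integral>x. e/2 * (1 + (nsum (\<phi> i) n x)\<^sup>2) \<partial>Q)"
            using ix[of "insert i I"] iBx insert.prems i2 by (intro integral_mono diff) auto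
          also have "\<dots> = e"
            using i2 nsum_second_moment(2)[OF \<phi>L \<phi>m, OF i(1) i(1) elim] \<phi>o[OF i(1) i(1)]
            by (simp add: Q.prob_space power2_eq_square)
          finally show ?case .
        qed
      qed
    qed
  qed
qed

lemma quadratic_char_conv:
  "(\<lambda>n. \<integral>x. iexp (\<Sum>j\<in>J. \<theta> j * (nsum (\<phi> j) n x)\<^sup>2) \<partial>Q) \<longlonglongrightarrow> (\<integral>z. iexp (\<Sum>j\<in>J. \<theta> j * (z j)\<^sup>2) \<partial>std_gauss)"
  using osc_conv[OF order_refl, of \<theta> "\<lambda>_. 0"] by (simp add: osc_def)

end

end

section \<open>Degenerate U-statistics of degree two\<close>

abbreviation doubletons :: "nat \<Rightarrow> nat set set" where
  "doubletons n \<equiv> {e. e \<subseteq> {..<n} \<and> card e = 2}"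

lemma doubletonE:
  assumes "card (e :: nat set) = 2"
  obtains i l where "i < l" "e = {i, l}" "Min e = i" "Max e = l"
proof -
  from assms obtain a b where ab: "e = {a, b}" "a \<noteq> b" by (auto simp: card_2_iff)
  show ?thesis
  proof (cases "a < b")
    case True
    with ab show ?thesis by (intro that[of a b]) auto
  next
    case False
    with ab show ?thesis by (intro that[of b a]) auto
  qed
qed

lemma doubletons_Suc: "doubletons (Suc n) = doubletons n \<union> (\<lambda>i. {i, n}) ` {..<n}"
proof (intro set_eqI iffI)
  fix e assume e: "e \<in> doubletons (Suc n)"
  then obtain i l where il: "i < l" "e = {i, l}" using doubletonE by blast
  show "e \<in> doubletons n \<union> (\<lambda>i. {i, n}) ` {..<n}"
  proof (cases "l = n")
    case True then show ?thesis using il e by auto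
  next
    case False then show ?thesis using il e by auto
  qed
qed (auto simp: card_2_iff)

text \<open>\<open>Min\<close> and \<open>Max\<close> pick an order for each unordered pair, so the
  sum runs over indices \<open>i < l\<close>.\<close>

definition pairU :: "('v \<Rightarrow> 'v \<Rightarrow> real) \<Rightarrow> nat \<Rightarrow> (nat \<Rightarrow> 'v) \<Rightarrow> real" where
  "pairU R n x = (\<Sum>e\<in>doubletons n. R (x (Min e)) (x (Max e)))"

lemma pairU_Suc: "pairU R (Suc n) x = pairU R n x + (\<Sum>i<n. R (x i) (x n))"
proof -
  have "inj_on (\<lambda>i. {i, n}) {..<n}" by (auto simp: inj_on_def doubleton_eq_iff)
  moreover have "doubletons n \<inter> (\<lambda>i. {i, n}) ` {..<n} = {}" by auto
  ultimately have "pairU R (Suc n) x = pairU R n x + (\<Sum>i<n. R (x (Min {i, n})) (x (Max {i, n})))"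
    unfolding pairU_def doubletons_Suc by (subst sum.union_disjoint) (auto simp: sum.reindex)
  also have "(\<Sum>i<n. R (x (Min {i, n})) (x (Max {i, n}))) = (\<Sum>i<n. R (x i) (x n))"
    by (intro sum.cong) (auto simp: min_def max_def)
  finally show ?thesis .
qed

lemma pairU_product:
  "pairU (\<lambda>u v. f u * f v) n x = ((\<Sum>i<n. f (x i))\<^sup>2 - (\<Sum>i<n. (f (x i))\<^sup>2)) / 2"
proof (induction n)
  case 0
  have "pairU (\<lambda>u v. f u * f v) 0 x = 0" by (auto simp: pairU_def intro!: sum.neutral)
  then show ?case by simp
next
  case (Suc n)
  then show ?case
    by (simp add: pairU_Suc sum_distrib_right[symmetric] power2_sum field_simps)
qed

lemma pairU_linear: "pairU (\<lambda>u v. R u v - (\<Sum>j<N. c j * S j u v)) n x = pairU R n x - (\<Sum>j<N. c j * pairU (S j) n x)"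
  unfolding pairU_def sum_subtractf sum_distrib_left by (subst sum.swap) simp

context iid_seq
begin

text \<open>Distinct pairs share at most one index, and conditioning on that index, or on none,
  kills the kernel. The terms are thus orthogonal and only the diagonal of the squared sum
  survives.\<close>

lemma pairU_second_moment:
  assumes RL: "in_L2 (F \<Otimes>\<^sub>M F) (\<lambda>w. R (fst w) (snd w))" and sym: "\<And>x y. R x y = R y x"
    and deg: "AE u in F. (\<integral>y. R u y \<partial>F) = 0"
  shows "in_L2 Q (pairU R n)"
    and "(\<integral>x. (pairU R n x)\<^sup>2 \<partial>Q) \<le> real (n choose 2) * (\<integral>w. (R (fst w) (snd w))\<^sup>2 \<partial>(F \<Otimes>\<^sub>M F))"
proof -
  interpret FF: pair_prob_space F F ..
  have Rm[measurable]: "(\<lambda>w. R (fst w) (snd w)) \<in> borel_measurable (F \<Otimes>\<^sub>M F)" using RL by (simp add: in_L2_def)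
  define f where "f e x = R (x (Min e)) (x (Max e))" for e and x :: "nat \<Rightarrow> 'v"
  have fL: "in_L2 Q (f e)" and fv: "(\<integral>x. (f e x)\<^sup>2 \<partial>Q) = (\<integral>w. (R (fst w) (snd w))\<^sup>2 \<partial>(F \<Otimes>\<^sub>M F))"
    if "card e = 2" for e
  proof -
    from that obtain i l where il: "i < l" "Min e = i" "Max e = l" by (rule doubletonE)
    then show "in_L2 Q (f e)"
      using in_L2_component_pair[OF _ RL, of i l] by (simp add: f_def[abs_def])
    show "(\<integral>x. (f e x)\<^sup>2 \<partial>Q) = (\<integral>w. (R (fst w) (snd w))\<^sup>2 \<partial>(F \<Otimes>\<^sub>M F))"
      using integral_component_pair[of i l "\<lambda>w. (R (fst w) (snd w))\<^sup>2"] il by (simp add: f_def)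
  qed
  have fd: "depends_on e (f e)" if "card e = 2" for e
  proof -
    from that obtain i l where il: "i < l" "e = {i, l}" "Min e = i" "Max e = l" by (rule doubletonE)
    then show ?thesis by (auto simp: depends_on_def f_def)
  qed
  have eq: "pairU R n = (\<lambda>x. \<Sum>e\<in>doubletons n. f e x)" by (auto simp: pairU_def f_def)
  show "in_L2 Q (pairU R n)" unfolding eq by (intro in_L2_sum fL) auto
  have orth: "(\<integral>x. f e x * f e' x \<partial>Q) = 0" if e: "card e = 2" "card e' = 2" "e \<noteq> e'" for e e'
  proof (rule orthogonal_if_cexp_zero[OF fL fd fL fd])
    from e(2) obtain i l where il: "i < l" "e' = {i, l}" "Min e' = i" "Max e' = l" by (rule doubletonE)
    have "e \<inter> e' \<noteq> e'"
    proof
      assume "e \<inter> e' = e'"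
      then have "e' \<subseteq> e" by auto
      moreover have "finite e" using e(1) by (metis card.infinite zero_neq_numeral)
      ultimately show False using e card_subset_eq[of e e'] by auto
    qed
    then consider "e \<inter> e' = {}" | "e \<inter> e' = {i}" | "e \<inter> e' = {l}" using il by auto
    then show "AE x in Q. cexp (e \<inter> e') (f e') x = 0"
    proof cases
      case 1
      have "(\<integral>z. f e' z \<partial>Q) = (\<integral>w. R (fst w) (snd w) \<partial>(F \<Otimes>\<^sub>M F))"
        using integral_component_pair[of i l "\<lambda>w. R (fst w) (snd w)"] il by (simp add: f_def)
      also have "\<dots> = (\<integral>x. \<integral>y. R x y \<partial>F \<partial>F)"
        using FF.integral_fst'[OF FF.P.in_L2_integrable[OF RL]] by simp
      also have "\<dots> = (\<integral>x. 0 \<partial>F)"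
      proof (rule integral_cong_AE)
        show "(\<lambda>x. \<integral>y. R x y \<partial>F) \<in> borel_measurable F"
          using FF.integrable_fst'[OF FF.P.in_L2_integrable[OF RL]] by (auto dest: borel_measurable_integrable)
      qed (use deg in auto)
      finally show ?thesis using 1 by (simp add: cexp_def mix_def)
    next
      case 2
      show ?thesis using AE_component[OF deg, of i] AE_space
      proof eventually_elim
        case (elim x)
        then have "x i \<in> space F" by (auto simp: Q_def space_PiM)
        then have "(\<lambda>y. R (x i) y) \<in> borel_measurable F"
          using measurable_compose[OF measurable_Pair1' Rm] by simp
        from integral_component[OF this, of l] elim(1) show ?case
          using il unfolding 2 by (simp add: cexp_def mix_def f_def)
      qed
    next
      case 3
      show ?thesis using AE_component[OF deg, of l] AE_space
      proof eventually_elim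
        case (elim x)
        then have "x l \<in> space F" by (auto simp: Q_def space_PiM)
        then have "(\<lambda>y. R (x l) y) \<in> borel_measurable F"
          using measurable_compose[OF measurable_Pair1' Rm] by simp
        from integral_component[OF this, of i] elim(1) show ?case
          using il unfolding 3 by (simp add: cexp_def mix_def f_def sym[of _ "x l"])
      qed
    qed
  qed (use e in auto)
  let ?v = "\<integral>w. (R (fst w) (snd w))\<^sup>2 \<partial>(F \<Otimes>\<^sub>M F)"
  show "(\<integral>x. (pairU R n x)\<^sup>2 \<partial>Q) \<le> real (n choose 2) * ?v"
  proof (cases "doubletons n = {}")
    case True
    then show ?thesis unfolding eq by (simp only: sum.empty) simp
  next
    case False
    have card: "card (doubletons n) = n choose 2" by (simp add: n_subsets)
    have pos: "real (card (doubletons n)) > 0" using False by (simp add: card_gt_0_iff)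
    have avg: "(\<integral>x. ((\<Sum>e\<in>doubletons n. f e x) / real (card (doubletons n)))\<^sup>2 \<partial>Q) \<le> (1 / real (card (doubletons n))) * ?v"
      by (rule second_moment_average_le[where B="\<lambda>e. {e}"]) (use pos False in \<open>auto intro!: fL orth simp: fv\<close>)
    have "(\<integral>x. (\<Sum>e\<in>doubletons n. f e x)\<^sup>2 \<partial>Q) \<le> real (card (doubletons n)) * ?v"
    proof -
      define c X where "c = real (card (doubletons n))" and "X = (\<integral>x. (\<Sum>e\<in>doubletons n. f e x)\<^sup>2 \<partial>Q)"
      have "X / c\<^sup>2 \<le> (1 / c) * ?v"
        using avg unfolding c_def X_def by (simp only: power_divide integral_divide_zero)
      then have "X \<le> c * ?v" using pos unfolding c_def[symmetric] by (simp add: power2_eq_square divide_le_eq mult.commute)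
      then show ?thesis unfolding c_def X_def .
    qed
    then show ?thesis unfolding eq card .
  qed
qed

text \<open>The statistic \<open>W n\<close> is compared with the truncated quadratic form
  \<open>Y N n\<close>. Its L1 error splits into \<open>sqrt (4 * \<rho> N)\<close>, uniform in
  \<open>n\<close>, and \<open>D N n\<close>, which vanishes as \<open>n\<close> grows for fixed
  \<open>N\<close>.\<close>

lemma degenerate_pair_char_conv:
  fixes k :: "'v \<Rightarrow> 'v \<Rightarrow> real" and t :: real
  assumes sym: "\<And>x y. k x y = k y x" and kL: "in_L2 (F \<Otimes>\<^sub>M F) (\<lambda>w. k (fst w) (snd w))"
    and deg: "AE u in F. (\<integral>y. k u y \<partial>F) = 0" and enum: "eigen_enum F k lam"
  shows "(\<lambda>n. \<integral>x. iexp (t * (2 / (real n - 1) * pairU k n x)) \<partial>Q)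
    \<longlonglongrightarrow> (\<integral>z. iexp (t * (\<Sum>j. lam j * ((z j)\<^sup>2 - 1))) \<partial>std_gauss)"
proof -
  interpret L: L2_kernel_space F ..
  obtain \<phi> where \<phi>L: "\<And>j. in_L2 F (\<phi> j)" and \<phi>0: "\<And>j. lam j = 0 \<Longrightarrow> \<phi> j = (\<lambda>_. 0)"
    and \<phi>o: "\<And>i j. lam i \<noteq> 0 \<Longrightarrow> lam j \<noteq> 0 \<Longrightarrow> (\<integral>x. \<phi> i x * \<phi> j x \<partial>F) = (if i = j then 1 else 0)"
    and \<phi>e: "\<And>j. AE x in F. int_op F k (\<phi> j) x = lam j * \<phi> j x"
    and summ: "summable (\<lambda>j. (lam j)\<^sup>2)"
    and lim: "(\<lambda>N. \<integral>w. (k (fst w) (snd w) - (\<Sum>j<N. lam j * (\<phi> j (fst w) * \<phi> j (snd w))))\<^sup>2 \<partial>(F \<Otimes>\<^sub>M F)) \<longlonglongrightarrow> 0"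
    using L.spectral_expansion[OF sym kL enum] by blast
  have [measurable]: "\<phi> j \<in> borel_measurable F" for j using \<phi>L by (simp add: in_L2_def)
  have k_meas[measurable]: "(\<lambda>w. k (fst w) (snd w)) \<in> borel_measurable (F \<Otimes>\<^sub>M F)" using kL by (simp add: in_L2_def)
  \<comment> \<open>Degeneracy says that the operator annihilates constants; eigenfunctions for
    nonzero eigenvalues are orthogonal to them.\<close>
  have \<phi>m: "(\<integral>x. \<phi> j x \<partial>F) = 0" for j
  proof (cases "lam j = 0")
    case False
    let ?K = "\<lambda>w. k (fst w) (snd w)"
    have mk: "(\<lambda>w. \<integral>z. k z w \<partial>F) \<in> borel_measurable F"
      using L.FF.integrable_fst'[OF L.FF.P.in_L2_integrable[OF kL]] by (auto dest: borel_measurable_integrable simp: sym)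
    have "lam j * (\<integral>x. \<phi> j x \<partial>F) = (\<integral>x. lam j * \<phi> j x \<partial>F)" by simp
    also have "\<dots> = (\<integral>x. 1 * L.app ?K (\<phi> j) x \<partial>F)"
      by (intro integral_cong_AE) (use \<phi>e[of j] in \<open>auto simp: L.app_def int_op_def elim!: eventually_mono\<close>)
    also have "\<dots> = (\<integral>w. (\<integral>z. 1 * ?K (z, w) \<partial>F) * \<phi> j w \<partial>F)"
      using L.inner_app[OF kL in_L2_const \<phi>L, of 1 j] L.inner_app'[OF kL in_L2_const \<phi>L, of 1 j] by simp
    also have "\<dots> = (\<integral>w. 0 \<partial>F)"
      by (intro integral_cong_AE) (use deg mk in \<open>auto simp: sym elim!: eventually_mono\<close>)
    finally show ?thesis using False by simp
  qed (simp add: \<phi>0)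
  define R where "R N u v = k u v - (\<Sum>j<N. lam j * (\<phi> j u * \<phi> j v))" for N u v
  define \<rho> where "\<rho> N = (\<integral>w. (R N (fst w) (snd w))\<^sup>2 \<partial>(F \<Otimes>\<^sub>M F))" for N
  have \<rho>lim: "\<rho> \<longlonglongrightarrow> 0" using lim by (simp add: \<rho>_def[abs_def] R_def)
  have RL: "in_L2 (F \<Otimes>\<^sub>M F) (\<lambda>w. R N (fst w) (snd w))" for N
    unfolding R_def by (intro in_L2_diff kL in_L2_sum in_L2_cmult L.tensor_L2 \<phi>L)
  have Rsym: "R N u v = R N v u" for N u v by (simp add: R_def sym[of u v] mult.commute)
  have Rdeg: "AE u in F. (\<integral>y. R N u y \<partial>F) = 0" for N
    using deg L.AE_row_L2[OF kL]
  proof eventually_elim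
    case (elim u)
    have "(\<integral>y. R N u y \<partial>F) = (\<integral>y. k u y \<partial>F) - (\<Sum>j<N. lam j * (\<phi> j u * (\<integral>y. \<phi> j y \<partial>F)))"
      unfolding R_def using in_L2_integrable[OF elim(2)] in_L2_integrable[OF \<phi>L] by simp
    then show ?case using elim by (simp add: \<phi>m)
  qed
  define V where "V N z = (\<Sum>j<N. lam j * ((z j)\<^sup>2 - 1))" for N and z :: "nat \<Rightarrow> real"
  have Vlim: "(\<lambda>N. \<integral>z. iexp (t * V N z) \<partial>std_gauss) \<longlonglongrightarrow> (\<integral>z. iexp (t * (\<Sum>j. lam j * ((z j)\<^sup>2 - 1))) \<partial>std_gauss)"
  proof (rule integral_dominated_convergence[where w="\<lambda>_. 1"])
    have L2: "in_L2 std_normal_distribution (\<lambda>x. x\<^sup>2 - 1)"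
    proof (rule in_L2_diff)
      show "in_L2 std_normal_distribution (\<lambda>x. x\<^sup>2)"
        using integrable_std_normal_distribution_moment[of 4] by (simp add: in_L2_def)
    qed (rule G.in_L2_const)
    have m0: "(\<integral>x. x\<^sup>2 - 1 \<partial>std_normal_distribution) = 0"
      using std_normal_L2 std_normal_second_moment G.prob_space by (simp add: in_L2_def)
    have "AE z in std_gauss. summable (\<lambda>j. lam j * ((z j)\<^sup>2 - 1))"
      by (rule G.AE_summable_random_series[OF L2 m0 summ])
    then show "AE z in std_gauss. (\<lambda>N. iexp (t * V N z)) \<longlonglongrightarrow> iexp (t * (\<Sum>j. lam j * ((z j)\<^sup>2 - 1)))"
    proof eventually_elim
      case (elim z)
      from summable_LIMSEQ[OF elim] have "(\<lambda>N. V N z) \<longlonglongrightarrow> (\<Sum>j. lam j * ((z j)\<^sup>2 - 1))" by (simp add: V_def)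
      then show ?case by (intro tendsto_intros)
    qed
    show "AE z in std_gauss. norm (iexp (t * V N z)) \<le> 1" for N by (simp only: norm_exp_i_times) simp
    show "integrable std_gauss (\<lambda>_. 1)" by simp
  qed (simp_all add: V_def)
  define s where "s j n = nsum (\<phi> j) n" for j n
  define A where "A j n x = (\<Sum>i<n. (\<phi> j (x i))\<^sup>2) / real n" for j n and x :: "nat \<Rightarrow> 'v"
  have sL: "in_L2 Q (s j n)" for j n unfolding s_def by (rule nsum_second_moment[OF \<phi>L \<phi>m])
  have s2i: "integrable Q (\<lambda>x. (s j n x)\<^sup>2)" for j n using sL by (simp add: in_L2_def)
  have phi2: "integrable F (\<lambda>y. (\<phi> j y)\<^sup>2)" for j using \<phi>L by (simp add: in_L2_def)
  have Ai: "integrable Q (A j n)" for j n unfolding A_def using integrable_component[OF phi2, of j] by auto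
  have [measurable]: "s j n \<in> borel_measurable Q" "A j n \<in> borel_measurable Q" for j n
    using sL Ai by (auto simp: in_L2_def dest: borel_measurable_integrable)
  have norm1: "(\<integral>y. (\<phi> j y)\<^sup>2 \<partial>F) = 1" if "lam j \<noteq> 0" for j using \<phi>o[OF that that] by (simp add: power2_eq_square)
  \<comment> \<open>The 2 is the sum of the means of \<open>(s j n)\<^sup>2\<close> and
    \<open>A j n\<close>, both 1 when \<open>lam j\<close> is nonzero. The second term is the error
    in replacing the diagonal average by its mean.\<close>
  define D where "D N n = (\<Sum>j<N. \<bar>lam j\<bar> * (2 / (real n - 1) + (\<integral>x. \<bar>A j n x - 1\<bar> \<partial>Q)))" for N n
  have Dlim: "(\<lambda>n. D N n) \<longlonglongrightarrow> 0" for N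
  proof -
    have "(\<lambda>n. \<bar>lam j\<bar> * (2 / (real n - 1) + (\<integral>x. \<bar>A j n x - 1\<bar> \<partial>Q))) \<longlonglongrightarrow> 0" for j
    proof (cases "lam j = 0")
      case False
      have 1: "(\<lambda>n. \<integral>x. \<bar>A j n x - 1\<bar> \<partial>Q) \<longlonglongrightarrow> 0"
        using weak_law_L1[OF phi2, of j] by (simp add: A_def norm1[OF False])
      have "filterlim (\<lambda>n. - 1 + real n) at_top sequentially"
        by (rule filterlim_tendsto_add_at_top[OF tendsto_const filterlim_real_sequentially])
      then have "filterlim (\<lambda>n. real n - 1) at_infinity sequentially"
        by (simp add: filterlim_at_top_imp_at_infinity)
      then have 2: "(\<lambda>n. 2 / (real n - 1)) \<longlonglongrightarrow> 0" by (rule tendsto_divide_0[OF tendsto_const])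
      show ?thesis using tendsto_mult[OF tendsto_const tendsto_add[OF 2 1], of "\<bar>lam j\<bar>"] by simp
    qed simp
    then have "(\<lambda>n. D N n) \<longlonglongrightarrow> (\<Sum>j<N. 0)" unfolding D_def by (intro tendsto_sum)
    then show ?thesis by simp
  qed
  define W where "W n x = 2 / (real n - 1) * pairU k n x" for n x
  define Y where "Y N n x = (\<Sum>j<N. lam j * ((s j n x)\<^sup>2 - 1))" for N n x
  have pairk: "in_L2 Q (pairU k n)" for n
    using pairU_second_moment(1)[OF kL sym deg] .
  have [measurable]: "W n \<in> borel_measurable Q" for n using pairk[of n] by (auto simp: W_def[abs_def] in_L2_def)
  have [measurable]: "Y N n \<in> borel_measurable Q" for N n unfolding Y_def by measurable
  have WY: "integrable Q (\<lambda>x. \<bar>W n x - Y N n x\<bar>) \<and> (\<integral>x. \<bar>W n x - Y N n x\<bar> \<partial>Q) \<le> sqrt (4 * \<rho> N) + D N n" if n: "n \<ge> 2" for n N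
  proof -
    define P where "P x = 2 / (real n - 1) * pairU (R N) n x" for x
    have PL: "in_L2 Q P" unfolding P_def by (intro in_L2_cmult pairU_second_moment(1)[OF RL Rsym Rdeg])
    \<comment> \<open>The \<open>n (n - 1) / 2\<close> orthogonal terms, scaled by
      \<open>(2 / (n - 1))\<^sup>2\<close>, give \<open>2 n / (n - 1)\<close>, at most 4 once
      \<open>n \<ge> 2\<close>.\<close>
    have P2: "(\<integral>x. (P x)\<^sup>2 \<partial>Q) \<le> 4 * \<rho> N"
    proof -
      have "(\<integral>x. (P x)\<^sup>2 \<partial>Q) = (2 / (real n - 1))\<^sup>2 * (\<integral>x. (pairU (R N) n x)\<^sup>2 \<partial>Q)"
        by (simp only: P_def power_mult_distrib integral_mult_right_zero)
      also have "\<dots> \<le> (2 / (real n - 1))\<^sup>2 * (real (n choose 2) * \<rho> N)"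
        unfolding \<rho>_def by (intro mult_left_mono pairU_second_moment(2)[OF RL Rsym Rdeg]) simp
      also have "\<dots> = (2 * real n / (real n - 1)) * \<rho> N"
      proof -
        have ch: "real (n choose 2) = real n * (real n - 1) / 2"
          using n by (simp add: choose_two real_of_nat_div of_nat_diff)
        have alg: "(2 / y)\<^sup>2 * (a * y / 2 * r) = 2 * a / y * r" if "y \<noteq> 0" for a y r :: real
          using that by (simp add: power2_eq_square)
        show ?thesis unfolding ch by (rule alg) (use n in simp)
      qed
      also have "\<dots> \<le> 4 * \<rho> N"
      proof (rule mult_right_mono)
        show "2 * real n / (real n - 1) \<le> 4" using n by (simp add: field_simps)
        show "0 \<le> \<rho> N" unfolding \<rho>_def by (rule Bochner_Integration.integral_nonneg) simp
      qed
      finally show ?thesis .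
    qed
    \<comment> \<open>The pair sum of a product kernel is half of the squared sum minus the
      diagonal; writing \<open>n / (n - 1)\<close> as \<open>1 / (n - 1) + 1\<close> separates the
      two vanishing corrections.\<close>
    have dec: "W n x - Y N n x = P x + (\<Sum>j<N. lam j * (1 / (real n - 1) * ((s j n x)\<^sup>2 - A j n x) + (1 - A j n x)))" for x
    proof -
      have "pairU (R N) n x = pairU k n x - (\<Sum>j<N. lam j * pairU (\<lambda>u v. \<phi> j u * \<phi> j v) n x)"
        unfolding R_def by (rule pairU_linear)
      moreover have "pairU (\<lambda>u v. \<phi> j u * \<phi> j v) n x = real n / 2 * ((s j n x)\<^sup>2 - A j n x)" for j
        unfolding pairU_product s_def nsum_def A_def using n by (simp add: power_divide field_simps)
      ultimately have pk: "pairU k n x = pairU (R N) n x + (\<Sum>j<N. lam j * (real n / 2 * ((s j n x)\<^sup>2 - A j n x)))"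
        by (simp only: diff_add_cancel)
      have "W n x = P x + (\<Sum>j<N. 2 / (real n - 1) * (lam j * (real n / 2 * ((s j n x)\<^sup>2 - A j n x))))"
        unfolding W_def P_def pk distrib_left sum_distrib_left ..
      also have "(\<Sum>j<N. 2 / (real n - 1) * (lam j * (real n / 2 * ((s j n x)\<^sup>2 - A j n x)))) =
        (\<Sum>j<N. lam j * (real n / (real n - 1) * ((s j n x)\<^sup>2 - A j n x)))"
      proof (intro sum.cong refl)
        have "2 / y * (l * (m / 2 * d)) = l * (m / y * d)" for y l m d :: real by simp
        then show "2 / (real n - 1) * (lam j * (real n / 2 * ((s j n x)\<^sup>2 - A j n x))) =
          lam j * (real n / (real n - 1) * ((s j n x)\<^sup>2 - A j n x))" for j .
      qed
      finally have "W n x = P x + (\<Sum>j<N. lam j * (real n / (real n - 1) * ((s j n x)\<^sup>2 - A j n x)))" .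
      then have "W n x - Y N n x = P x + (\<Sum>j<N. lam j * (real n / (real n - 1) * ((s j n x)\<^sup>2 - A j n x)) - lam j * ((s j n x)\<^sup>2 - 1))"
        by (simp add: Y_def sum_subtractf)
      also have "(\<Sum>j<N. lam j * (real n / (real n - 1) * ((s j n x)\<^sup>2 - A j n x)) - lam j * ((s j n x)\<^sup>2 - 1)) =
        (\<Sum>j<N. lam j * (1 / (real n - 1) * ((s j n x)\<^sup>2 - A j n x) + (1 - A j n x)))"
      proof (intro sum.cong refl)
        fix j
        have "real n / (real n - 1) = 1 / (real n - 1) + 1" using n by (simp add: field_simps)
        then show "lam j * (real n / (real n - 1) * ((s j n x)\<^sup>2 - A j n x)) - lam j * ((s j n x)\<^sup>2 - 1) =
          lam j * (1 / (real n - 1) * ((s j n x)\<^sup>2 - A j n x) + (1 - A j n x))"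
          by (simp only: right_diff_distrib[symmetric] mult_cancel_left) (simp add: algebra_simps)
      qed
      finally show ?thesis .
    qed
    let ?b = "\<lambda>x. \<bar>P x\<bar> + (\<Sum>j<N. \<bar>lam j\<bar> * (1 / (real n - 1) * ((s j n x)\<^sup>2 + A j n x) + \<bar>A j n x - 1\<bar>))"
    have ib: "integrable Q ?b"
      using Q.in_L2_integrable[OF PL] s2i Ai by auto
    have le: "\<bar>W n x - Y N n x\<bar> \<le> ?b x" for x
    proof -
      have A0: "A j n x \<ge> 0" for j by (simp add: A_def sum_nonneg)
      have "\<bar>\<Sum>j<N. lam j * (1 / (real n - 1) * ((s j n x)\<^sup>2 - A j n x) + (1 - A j n x))\<bar> \<le>
         (\<Sum>j<N. \<bar>lam j\<bar> * (1 / (real n - 1) * ((s j n x)\<^sup>2 + A j n x) + \<bar>A j n x - 1\<bar>))"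
      proof (rule order_trans[OF sum_abs sum_mono])
        fix j
        have "\<bar>1 / (real n - 1) * ((s j n x)\<^sup>2 - A j n x) + (1 - A j n x)\<bar> \<le> \<bar>1 / (real n - 1) * ((s j n x)\<^sup>2 - A j n x)\<bar> + \<bar>A j n x - 1\<bar>"
          by linarith
        also have "\<bar>1 / (real n - 1) * ((s j n x)\<^sup>2 - A j n x)\<bar> = 1 / (real n - 1) * \<bar>(s j n x)\<^sup>2 - A j n x\<bar>"
          using n by (simp add: abs_mult)
        also have "\<dots> \<le> 1 / (real n - 1) * ((s j n x)\<^sup>2 + A j n x)"
          using n A0[of j] by (intro mult_left_mono abs_leI) auto
        finally show "\<bar>lam j * (1 / (real n - 1) * ((s j n x)\<^sup>2 - A j n x) + (1 - A j n x))\<bar> \<le>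
          \<bar>lam j\<bar> * (1 / (real n - 1) * ((s j n x)\<^sup>2 + A j n x) + \<bar>A j n x - 1\<bar>)"
          unfolding abs_mult by (intro mult_left_mono) auto
      qed
      then show ?thesis unfolding dec by linarith
    qed
    have i: "integrable Q (\<lambda>x. \<bar>W n x - Y N n x\<bar>)"
      by (rule Bochner_Integration.integrable_bound[OF ib]) (auto intro!: AE_I2 order_trans[OF le])
    have "(\<integral>x. \<bar>W n x - Y N n x\<bar> \<partial>Q) \<le> (\<integral>x. ?b x \<partial>Q)" by (intro integral_mono i ib le)
    also have "\<dots> = (\<integral>x. \<bar>P x\<bar> \<partial>Q) + (\<Sum>j<N. \<bar>lam j\<bar> * (1 / (real n - 1) * ((\<integral>x. (s j n x)\<^sup>2 \<partial>Q) + (\<integral>x. A j n x \<partial>Q)) + (\<integral>x. \<bar>A j n x - 1\<bar> \<partial>Q)))"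
      using Q.in_L2_integrable[OF PL] s2i Ai by simp
    also have "(\<Sum>j<N. \<bar>lam j\<bar> * (1 / (real n - 1) * ((\<integral>x. (s j n x)\<^sup>2 \<partial>Q) + (\<integral>x. A j n x \<partial>Q)) + (\<integral>x. \<bar>A j n x - 1\<bar> \<partial>Q))) = D N n"
      unfolding D_def
    proof (intro sum.cong refl)
      fix j
      show "\<bar>lam j\<bar> * (1 / (real n - 1) * ((\<integral>x. (s j n x)\<^sup>2 \<partial>Q) + (\<integral>x. A j n x \<partial>Q)) + (\<integral>x. \<bar>A j n x - 1\<bar> \<partial>Q)) =
        \<bar>lam j\<bar> * (2 / (real n - 1) + (\<integral>x. \<bar>A j n x - 1\<bar> \<partial>Q))"
      proof (cases "lam j = 0")
        case False
        have "(\<integral>x. (s j n x)\<^sup>2 \<partial>Q) = 1"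
          unfolding s_def using n by (subst nsum_second_moment(2)[OF \<phi>L \<phi>m]) (auto simp: norm1[OF False])
        moreover have "(\<integral>x. A j n x \<partial>Q) = 1"
          unfolding A_def using n integrable_component[OF phi2, of j] integral_component[of "\<lambda>y. (\<phi> j y)\<^sup>2"]
          by (simp add: norm1[OF False])
        ultimately show ?thesis by simp
      qed simp
    qed
    also have "(\<integral>x. \<bar>P x\<bar> \<partial>Q) \<le> sqrt (4 * \<rho> N)"
      by (rule order_trans[OF Q.L1_norm_le_L2_norm[OF PL] real_sqrt_le_mono[OF P2]])
    finally show ?thesis using i by simp
  qed
  have Ylim: "(\<lambda>n. \<integral>x. iexp (t * Y N n x) \<partial>Q) \<longlonglongrightarrow> (\<integral>z. iexp (t * V N z) \<partial>std_gauss)" for N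
  proof -
    \<comment> \<open>Indices with eigenvalue zero carry \<open>\<phi> j = 0\<close>, which would
      spoil orthonormality.\<close>
    define J where "J = {j. j < N \<and> lam j \<noteq> 0}"
    have J: "finite J" by (simp add: J_def)
    define C where "C = iexp (- (t * (\<Sum>j\<in>J. lam j)))"
    have sumJ: "(\<Sum>j<N. lam j * (f j - 1)) = (\<Sum>j\<in>J. lam j * f j) - (\<Sum>j\<in>J. lam j)" for f :: "nat \<Rightarrow> real"
    proof -
      have "(\<Sum>j<N. lam j * (f j - 1)) = (\<Sum>j\<in>J. lam j * (f j - 1))"
        by (intro sum.mono_neutral_right) (auto simp: J_def)
      then show ?thesis by (simp add: right_diff_distrib sum_subtractf)
    qed
    have split: "iexp (t * (\<Sum>j<N. lam j * (f j - 1))) = C * iexp (\<Sum>j\<in>J. (t * lam j) * f j)" for f :: "nat \<Rightarrow> real"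
    proof -
      have "t * (\<Sum>j<N. lam j * (f j - 1)) = - (t * (\<Sum>j\<in>J. lam j)) + (\<Sum>j\<in>J. (t * lam j) * f j)"
        unfolding sumJ by (simp add: right_diff_distrib sum_distrib_left mult.assoc)
      then show ?thesis unfolding C_def by (simp only: of_real_add distrib_left exp_add)
    qed
    have "(\<lambda>n. C * (\<integral>x. iexp (\<Sum>j\<in>J. (t * lam j) * (nsum (\<phi> j) n x)\<^sup>2) \<partial>Q)) \<longlonglongrightarrow>
      C * (\<integral>z. iexp (\<Sum>j\<in>J. (t * lam j) * (z j)\<^sup>2) \<partial>std_gauss)"
      by (intro tendsto_mult tendsto_const quadratic_char_conv J \<phi>L \<phi>m \<phi>o) (auto simp: J_def)
    then show ?thesis
      unfolding Y_def V_def split s_def by (simp only: integral_mult_right_zero)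
  qed
  show ?thesis
  proof (rule tendsto_by_approximation)
    fix e :: real assume e: "e > 0"
    have "(\<lambda>N. \<bar>t\<bar> * sqrt (4 * \<rho> N)) \<longlonglongrightarrow> \<bar>t\<bar> * sqrt (4 * 0)" by (intro tendsto_intros \<rho>lim)
    then have "\<forall>\<^sub>F N in sequentially. \<bar>t\<bar> * sqrt (4 * \<rho> N) < e/2" using e by (intro order_tendstoD(2)) auto
    moreover have "\<forall>\<^sub>F N in sequentially. dist (\<integral>z. iexp (t * V N z) \<partial>std_gauss) (\<integral>z. iexp (t * (\<Sum>j. lam j * ((z j)\<^sup>2 - 1))) \<partial>std_gauss) < e"
      using tendstoD[OF Vlim e] .
    ultimately have "\<forall>\<^sub>F N in sequentially. \<bar>t\<bar> * sqrt (4 * \<rho> N) < e/2 \<and>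
      dist (\<integral>z. iexp (t * V N z) \<partial>std_gauss) (\<integral>z. iexp (t * (\<Sum>j. lam j * ((z j)\<^sup>2 - 1))) \<partial>std_gauss) < e"
      by eventually_elim simp
    then obtain N where N: "\<bar>t\<bar> * sqrt (4 * \<rho> N) < e/2"
      "dist (\<integral>z. iexp (t * V N z) \<partial>std_gauss) (\<integral>z. iexp (t * (\<Sum>j. lam j * ((z j)\<^sup>2 - 1))) \<partial>std_gauss) < e"
      by (auto simp: eventually_sequentially)
    have "(\<lambda>n. \<bar>t\<bar> * D N n) \<longlonglongrightarrow> \<bar>t\<bar> * 0" by (intro tendsto_intros Dlim)
    then have "\<forall>\<^sub>F n in sequentially. \<bar>t\<bar> * D N n < e/2" using e by (intro order_tendstoD(2)) auto
    then have "\<forall>\<^sub>F n in sequentially. cmod ((\<integral>x. iexp (t * W n x) \<partial>Q) - (\<integral>x. iexp (t * Y N n x) \<partial>Q)) \<le> e"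
      using eventually_ge_at_top[of 2]
    proof eventually_elim
      case (elim n)
      note WY = WY[OF elim(2), of N]
      have "cmod ((\<integral>x. iexp (t * W n x) \<partial>Q) - (\<integral>x. iexp (t * Y N n x) \<partial>Q)) \<le> (\<integral>x. \<bar>t * W n x - t * Y N n x\<bar> \<partial>Q)"
        using WY by (intro Q.char_diff_le) (auto simp: right_diff_distrib[symmetric] abs_mult)
      also have "\<dots> = \<bar>t\<bar> * (\<integral>x. \<bar>W n x - Y N n x\<bar> \<partial>Q)"
        by (simp add: right_diff_distrib[symmetric] abs_mult)
      also have "\<dots> \<le> \<bar>t\<bar> * (sqrt (4 * \<rho> N) + D N n)" using WY by (intro mult_left_mono) auto
      also have "\<dots> \<le> e" unfolding distrib_left using N(1) elim(1) by linarith
      finally show ?case .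
    qed
    then show "\<exists>B b. B \<longlonglongrightarrow> b \<and> (\<forall>\<^sub>F n in sequentially. cmod ((\<integral>x. iexp (t * (2 / (real n - 1) * pairU k n x)) \<partial>Q) - B n) \<le> e) \<and>
      cmod ((\<integral>z. iexp (t * (\<Sum>j. lam j * ((z j)\<^sup>2 - 1))) \<partial>std_gauss) - b) \<le> e"
      using Ylim[of N] N(2) unfolding W_def
      by (intro exI[of _ "\<lambda>n. \<integral>x. iexp (t * Y N n x) \<partial>Q"] exI[of _ "\<integral>z. iexp (t * V N z) \<partial>std_gauss"])
        (simp add: dist_norm norm_minus_commute)
  qed
qed

end

section \<open>Transfer to the two-sample statistic\<close>

context two_sample
begin

lemma reindex_Inr_measurable: "(\<lambda>x i. x (Inr i)) \<in> measurable Q (PiM UNIV (\<lambda>_::nat. F))"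
  by (rule measurable_PiM_single') (auto simp: Q_def space_PiM)

lemma distr_Inr: "distr Q (PiM UNIV (\<lambda>_::nat. F)) (\<lambda>x i. x (Inr i)) = PiM UNIV (\<lambda>_::nat. F)"
  using distr_PiM_reindex[of UNIV "\<lambda>_. F" "Inr :: nat \<Rightarrow> nat + nat" UNIV] prob_space_axioms
  by (simp add: Q_def restrict_UNIV)

lemma U_L2: "in_L2 Q (U N0 N1)"
proof -
  have "in_L2 Q (\<lambda>x. inverse (real (card (pairs N0 N1))) * (\<Sum>p\<in>pairs N0 N1. H (fst p) (snd p) x))"
    by (intro in_L2_cmult in_L2_sum H_L2 pairsD)
  then show ?thesis by (simp add: U_eq[abs_def] divide_inverse mult.commute case_prod_beta)
qed

text \<open>Dropping the remainder changes the characteristic function by at most the L1 norm of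
  \<open>t * a k * rem\<close>, which its second moment controls. The main part involves the cases
  alone and has the law of a one-sample statistic.\<close>

lemma char_U_tendsto:
  fixes a :: "nat \<Rightarrow> real" and W :: "nat \<Rightarrow> (nat \<Rightarrow> 'v) \<Rightarrow> real"
  assumes W: "\<And>n. W n \<in> borel_measurable (PiM UNIV (\<lambda>_. F))"
    and eq: "\<forall>\<^sub>F k in sequentially. \<forall>x\<in>space Q. a k * (U (n0 k) (n1 k) x - rem b (n0 k) (n1 k) x) = W (n1 k) (\<lambda>i. x (Inr i))"
    and rem0: "(\<lambda>k. (a k)\<^sup>2 * (\<integral>x. (rem b (n0 k) (n1 k) x)\<^sup>2 \<partial>Q)) \<longlonglongrightarrow> 0"
    and n1: "filterlim n1 at_top sequentially"
    and lim: "(\<lambda>n. \<integral>x. iexp (t * W n x) \<partial>PiM UNIV (\<lambda>_. F)) \<longlonglongrightarrow> l"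
  shows "(\<lambda>k. \<integral>x. iexp (t * (a k * U (n0 k) (n1 k) x)) \<partial>Q) \<longlonglongrightarrow> l"
proof -
  note [measurable] = W
  have [measurable]: "U N0 N1 \<in> borel_measurable Q" "rem b N0 N1 \<in> borel_measurable Q" for N0 N1
    using U_L2 rem_L2 by (auto simp: in_L2_def)
  have "(\<lambda>k. \<integral>x. iexp (t * (a k * (U (n0 k) (n1 k) x - rem b (n0 k) (n1 k) x))) \<partial>Q) \<longlonglongrightarrow> l"
  proof (rule Lim_transform_eventually)
    show "(\<lambda>k. \<integral>x. iexp (t * W (n1 k) x) \<partial>PiM UNIV (\<lambda>_. F)) \<longlonglongrightarrow> l"
      using filterlim_compose[OF lim n1] .
    show "\<forall>\<^sub>F k in sequentially. (\<integral>x. iexp (t * W (n1 k) x) \<partial>PiM UNIV (\<lambda>_. F)) =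
      (\<integral>x. iexp (t * (a k * (U (n0 k) (n1 k) x - rem b (n0 k) (n1 k) x))) \<partial>Q)"
      using eq
    proof eventually_elim
      case (elim k)
      have "(\<integral>x. iexp (t * W (n1 k) x) \<partial>PiM UNIV (\<lambda>_. F)) =
        (\<integral>x. iexp (t * W (n1 k) x) \<partial>distr Q (PiM UNIV (\<lambda>_::nat. F)) (\<lambda>x i. x (Inr i)))"
        by (simp only: distr_Inr)
      also have "\<dots> = (\<integral>x. iexp (t * W (n1 k) (\<lambda>i. x (Inr i))) \<partial>Q)"
        by (rule integral_distr[OF reindex_Inr_measurable]) measurable
      also have "\<dots> = (\<integral>x. iexp (t * (a k * (U (n0 k) (n1 k) x - rem b (n0 k) (n1 k) x))) \<partial>Q)"
        using elim by (intro Bochner_Integration.integral_cong refl) simp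
      finally show ?case .
    qed
  qed
  moreover have "(\<lambda>k. (\<integral>x. iexp (t * (a k * U (n0 k) (n1 k) x)) \<partial>Q) -
      (\<integral>x. iexp (t * (a k * (U (n0 k) (n1 k) x - rem b (n0 k) (n1 k) x))) \<partial>Q)) \<longlonglongrightarrow> 0"
  proof (rule Lim_null_comparison)
    show "\<forall>\<^sub>F k in sequentially. cmod ((\<integral>x. iexp (t * (a k * U (n0 k) (n1 k) x)) \<partial>Q) -
      (\<integral>x. iexp (t * (a k * (U (n0 k) (n1 k) x - rem b (n0 k) (n1 k) x))) \<partial>Q)) \<le>
      sqrt (t\<^sup>2 * ((a k)\<^sup>2 * (\<integral>x. (rem b (n0 k) (n1 k) x)\<^sup>2 \<partial>Q)))"
    proof (rule always_eventually, rule allI)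
      fix k
      let ?r = "\<lambda>x. (t * a k) * rem b (n0 k) (n1 k) x"
      have rL: "in_L2 Q ?r" by (intro in_L2_cmult rem_L2)
      have d: "t * (a k * U (n0 k) (n1 k) x) - t * (a k * (U (n0 k) (n1 k) x - rem b (n0 k) (n1 k) x)) = ?r x" for x
        by (simp add: algebra_simps)
      have "cmod ((\<integral>x. iexp (t * (a k * U (n0 k) (n1 k) x)) \<partial>Q) -
        (\<integral>x. iexp (t * (a k * (U (n0 k) (n1 k) x - rem b (n0 k) (n1 k) x))) \<partial>Q)) \<le>
        (\<integral>x. \<bar>t * (a k * U (n0 k) (n1 k) x) - t * (a k * (U (n0 k) (n1 k) x - rem b (n0 k) (n1 k) x))\<bar> \<partial>Q)"
        using Q.in_L2_integrable[OF rL] unfolding d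
        by (intro Q.char_diff_le[where X="\<lambda>x. t * (a k * U (n0 k) (n1 k) x)" and
              Y="\<lambda>x. t * (a k * (U (n0 k) (n1 k) x - rem b (n0 k) (n1 k) x))", unfolded d]) auto
      also have "\<dots> \<le> sqrt (\<integral>x. (?r x)\<^sup>2 \<partial>Q)" unfolding d by (rule Q.L1_norm_le_L2_norm[OF rL])
      also have "(\<integral>x. (?r x)\<^sup>2 \<partial>Q) = t\<^sup>2 * ((a k)\<^sup>2 * (\<integral>x. (rem b (n0 k) (n1 k) x)\<^sup>2 \<partial>Q))"
        unfolding power_mult_distrib by (simp add: mult.assoc)
      finally show "cmod ((\<integral>x. iexp (t * (a k * U (n0 k) (n1 k) x)) \<partial>Q) -
        (\<integral>x. iexp (t * (a k * (U (n0 k) (n1 k) x - rem b (n0 k) (n1 k) x))) \<partial>Q)) \<le>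
        sqrt (t\<^sup>2 * ((a k)\<^sup>2 * (\<integral>x. (rem b (n0 k) (n1 k) x)\<^sup>2 \<partial>Q)))" .
    qed
    have "(\<lambda>k. sqrt (t\<^sup>2 * ((a k)\<^sup>2 * (\<integral>x. (rem b (n0 k) (n1 k) x)\<^sup>2 \<partial>Q)))) \<longlonglongrightarrow> sqrt (t\<^sup>2 * 0)"
      by (intro tendsto_intros rem0)
    then show "(\<lambda>k. sqrt (t\<^sup>2 * ((a k)\<^sup>2 * (\<integral>x. (rem b (n0 k) (n1 k) x)\<^sup>2 \<partial>Q)))) \<longlonglongrightarrow> 0" by simp
  qed
  ultimately show ?thesis
    using tendsto_add by fastforce
qed

section \<open>Moments, symmetry and degeneracy of the case kernels\<close>

lemma kernel1_cexp: "x \<in> space Q \<Longrightarrow> cexp (base_set 0 1) H0 x = kernel1 (x (Inr 0))"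
proof -
  assume x: "x \<in> space Q"
  have "kernel1 (x (Inr 0)) = cexp (base_set 0 1) H0 (case_sum (\<lambda>_. undefined) (\<lambda>_. x (Inr 0)))"
    unfolding kernel1_def using space_Q_component[OF x] by (intro proj_eq_cexp) auto
  also have "\<dots> = cexp (base_set 0 1) H0 x" by (intro cexp_cong_on) auto
  finally show ?thesis by simp
qed

lemma kernel2_cexp: "x \<in> space Q \<Longrightarrow> cexp (base_set 0 2) H0 x = kernel2 (x (Inr 0)) (x (Inr 1))"
proof -
  assume x: "x \<in> space Q"
  have "kernel2 (x (Inr 0)) (x (Inr 1)) = cexp (base_set 0 2) H0 (case_sum (\<lambda>_. undefined) (\<lambda>j. if j = 0 then x (Inr 0) else x (Inr 1)))"
    unfolding kernel2_def using space_Q_component[OF x] by (intro proj_eq_cexp) auto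
  also have "\<dots> = cexp (base_set 0 2) H0 x" by (intro cexp_cong_on) (auto simp: less_2_cases_iff)
  finally show ?thesis by simp
qed

lemma kernel1_measurable[measurable]: "kernel1 \<in> borel_measurable F"
proof -
  \<comment> \<open>A configuration constantly equal to \<open>u\<close> replaces the partial
    arguments of \<open>proj\<close>: \<open>cexp\<close> reads it only at \<open>Inr 0\<close>, and
    it depends measurably on \<open>u\<close>.\<close>
  have [measurable]: "(\<lambda>w. mix (base_set 0 1) (\<lambda>_. fst w) (snd w)) \<in> measurable (F \<Otimes>\<^sub>M Q) Q"
    unfolding measurable_Q_iff mix_def by auto
  have "(\<lambda>u. cexp (base_set 0 1) H0 (\<lambda>_. u)) \<in> borel_measurable F"
    unfolding cexp_def by measurable
  moreover have "kernel1 u = cexp (base_set 0 1) H0 (\<lambda>_. u)" if "u \<in> space F" for u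
  proof -
    have "kernel1 u = cexp (base_set 0 1) H0 (case_sum (\<lambda>_. undefined) (\<lambda>_. u))"
      unfolding kernel1_def using that by (intro proj_eq_cexp) auto
    also have "\<dots> = cexp (base_set 0 1) H0 (\<lambda>_. u)" by (intro cexp_cong_on) auto
    finally show ?thesis .
  qed
  ultimately show ?thesis by (simp cong: measurable_cong)
qed

lemma kernel2_measurable[measurable]: "(\<lambda>w. kernel2 (fst w) (snd w)) \<in> borel_measurable (F \<Otimes>\<^sub>M F)"
proof -
  let ?c = "\<lambda>w. case_sum (\<lambda>_. fst w) (\<lambda>j::nat. if j = 0 then fst w else snd w)"
  have m: "(\<lambda>w. mix (base_set 0 2) (?c (fst w)) (snd w)) \<in> measurable ((F \<Otimes>\<^sub>M F) \<Otimes>\<^sub>M Q) Q"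
    unfolding measurable_Q_iff mix_def
  proof
    fix s :: "nat + nat"
    show "(\<lambda>w. if s \<in> base_set 0 2 then ?c (fst w) s else snd w s) \<in> measurable ((F \<Otimes>\<^sub>M F) \<Otimes>\<^sub>M Q) F"
    proof (cases s)
      case (Inl a)
      then show ?thesis by (simp add: image_iff)
    next
      case (Inr b)
      then show ?thesis by (cases "b < 2"; cases "b = 0") (simp_all add: image_iff)
    qed
  qed
  have "(\<lambda>w. cexp (base_set 0 2) H0 (?c w)) \<in> borel_measurable (F \<Otimes>\<^sub>M F)"
    unfolding cexp_def using measurable_compose[OF m H0_measurable] by measurable
  moreover have "kernel2 (fst w) (snd w) = cexp (base_set 0 2) H0 (?c w)" if "w \<in> space (F \<Otimes>\<^sub>M F)" for w
  proof -
    have "kernel2 (fst w) (snd w) = cexp (base_set 0 2) H0 (case_sum (\<lambda>_. undefined) (\<lambda>j. if j = 0 then fst w else snd w))"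
      unfolding kernel2_def using that by (intro proj_eq_cexp) (auto simp: space_pair_measure)
    also have "\<dots> = cexp (base_set 0 2) H0 (?c w)" by (intro cexp_cong_on) auto
    finally show ?thesis .
  qed
  ultimately show ?thesis by (simp cong: measurable_cong)
qed

lemma kernel1_L2:
  "in_L2 F kernel1" "(\<integral>u. kernel1 u \<partial>F) = 0" "(\<integral>u. (kernel1 u)\<^sup>2 \<partial>F) = xi F m0 m1 h 0 1"
proof -
  note L2 = cexp_L2(1)[OF H0_L2, of "base_set 0 1"]
  have i: "integrable Q (\<lambda>x. (kernel1 (x (Inr 0)))\<^sup>2)"
  proof (rule Bochner_Integration.integrable_cong[THEN iffD1, OF refl _ in_L2_integrable_square[OF L2]])
    show "(cexp (base_set 0 1) H0 x)\<^sup>2 = (kernel1 (x (Inr 0)))\<^sup>2" if "x \<in> space Q" for x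
      by (simp only: kernel1_cexp[OF that])
  qed
  have "integrable (distr Q F (\<lambda>x. x (Inr 0))) (\<lambda>u. (kernel1 u)\<^sup>2)"
    using i by (subst integrable_distr_eq) auto
  then show "in_L2 F kernel1" by (simp add: in_L2_def distr_component)
  have "(\<integral>u. kernel1 u \<partial>F) = (\<integral>x. cexp (base_set 0 1) H0 x \<partial>Q)"
    unfolding integral_component[OF kernel1_measurable, of "Inr 0", symmetric]
    by (intro Bochner_Integration.integral_cong refl) (simp only: kernel1_cexp)
  then show "(\<integral>u. kernel1 u \<partial>F) = 0" by (simp only: cexp_mean_zero)
  have "(\<integral>u. (kernel1 u)\<^sup>2 \<partial>F) = (\<integral>x. (kernel1 (x (Inr 0)))\<^sup>2 \<partial>Q)"
    by (rule integral_component[symmetric, of "\<lambda>u. (kernel1 u)\<^sup>2"]) measurable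
  also have "\<dots> = (\<integral>x. (cexp (base_set 0 1) H0 x)\<^sup>2 \<partial>Q)"
    by (intro Bochner_Integration.integral_cong refl) (simp only: kernel1_cexp)
  finally show "(\<integral>u. (kernel1 u)\<^sup>2 \<partial>F) = xi F m0 m1 h 0 1" by (simp only: xi_eq)
qed

lemma kernel2_L2: "in_L2 (F \<Otimes>\<^sub>M F) (\<lambda>w. kernel2 (fst w) (snd w))"
proof -
  note L2 = cexp_L2(1)[OF H0_L2, of "base_set 0 2"]
  have i: "integrable Q (\<lambda>x. (kernel2 (x (Inr 0)) (x (Inr 1)))\<^sup>2)"
  proof (rule Bochner_Integration.integrable_cong[THEN iffD1, OF refl _ in_L2_integrable_square[OF L2]])
    show "(cexp (base_set 0 2) H0 x)\<^sup>2 = (kernel2 (x (Inr 0)) (x (Inr 1)))\<^sup>2" if "x \<in> space Q" for x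
      by (simp only: kernel2_cexp[OF that])
  qed
  have "integrable (distr Q (F \<Otimes>\<^sub>M F) (\<lambda>x. (x (Inr 0), x (Inr 1)))) (\<lambda>w. (kernel2 (fst w) (snd w))\<^sup>2)"
    using i by (subst integrable_distr_eq) auto
  then show ?thesis by (simp add: in_L2_def distr_component_pair)
qed

text \<open>Both case arguments must be genuine arguments of \<open>h\<close> for their
  transposition to be a permutation of \<open>{..<m1}\<close>. The equality is pointwise, as
  \<open>spectral_expansion\<close> requires.\<close>

lemma kernel2_sym:
  assumes "m1 \<ge> 2"
  shows "kernel2 u v = kernel2 v u"
proof -
  let ?\<pi> = "Transposition.transpose 0 (1::nat)"
  have p: "?\<pi> permutes {..<m1}" using assms by (intro permutes_swap_id) auto
  have "h f (\<lambda>j. if j < 2 then if j = 0 then u else v else z j) = h f (\<lambda>j. if j < 2 then if j = 0 then v else u else z j)" for f z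
  proof -
    have "h f (\<lambda>j. if j < 2 then if j = 0 then u else v else z j) = h f ((\<lambda>j. if j < 2 then if j = 0 then u else v else z j) \<circ> ?\<pi>)"
      by (rule h_sym1[OF p, symmetric])
    also have "(\<lambda>j. if j < 2 then if j = 0 then u else v else z j) \<circ> ?\<pi> = (\<lambda>j. if j < 2 then if j = 0 then v else u else z j)"
      by (auto simp: transpose_def less_2_cases_iff)
    finally show ?thesis .
  qed
  then show ?thesis unfolding kernel2_def proj_def by simp
qed

text \<open>Conditioning the second-order projection on its first case gives the first-order one. If
  \<open>xi F m0 m1 h 0 1 = 0\<close>, this is the degeneracy of \<open>kernel2\<close>.\<close>

lemma integral_kernel2:
  "AE u in F. (\<integral>v. kernel2 u v \<partial>F) = kernel1 u"
proof -
  have int: "integrable Q H0" by (rule Q.in_L2_integrable[OF H0_L2])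
  have "{Inr 0} \<inter> base_set 0 2 = base_set 0 1" by auto
  then have "AE x in Q. cexp {Inr 0} (cexp (base_set 0 2) H0) x = cexp (base_set 0 1) H0 x"
    using cexp_cexp[OF int, of "{Inr 0}" "base_set 0 2"] by (simp only:)
  then have AE1: "AE x in Q. (\<integral>v. kernel2 (x (Inr 0)) v \<partial>F) = kernel1 (x (Inr 0))"
    using AE_space
  proof eventually_elim
    case (elim x)
    note x = elim(2)
    have mx: "mix {Inr 0} x z \<in> space Q" if "z \<in> space Q" for z
      using x that by (auto simp: mix_def Q_def space_PiM PiE_iff)
    have m: "(\<lambda>v. kernel2 (x (Inr 0)) v) \<in> borel_measurable F"
      using measurable_compose[OF measurable_Pair1'[OF space_Q_component[OF x, of "Inr 0"]] kernel2_measurable] by simp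
    have "cexp {Inr 0} (cexp (base_set 0 2) H0) x = (\<integral>z. kernel2 (x (Inr 0)) (z (Inr 1)) \<partial>Q)"
      unfolding cexp_def[of "{Inr 0}"]
      by (intro Bochner_Integration.integral_cong refl) (simp only: kernel2_cexp[OF mx], simp add: mix_def)
    also have "\<dots> = (\<integral>v. kernel2 (x (Inr 0)) v \<partial>F)" by (rule integral_component[OF m])
    finally show ?case using elim(1) kernel1_cexp[OF x] by (simp only:)
  qed
  have [measurable]: "(\<lambda>u. \<integral>v. kernel2 u v \<partial>F) \<in> borel_measurable F"
    using kernel2_measurable by (intro borel_measurable_lebesgue_integral) (simp add: case_prod_beta')
  have "AE u in distr Q F (\<lambda>x. x (Inr 0)). (\<integral>v. kernel2 u v \<partial>F) = kernel1 u"
    using AE1 by (subst AE_distr_iff) auto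
  then show ?thesis unfolding distr_component .
qed

end

section \<open>Limits of the characteristic functions\<close>

context two_sample
begin

lemma cexp_empty_H0: "cexp (base_set 0 0) H0 x = 0"
  using H0_mean by (simp add: cexp_def mix_def)

text \<open>With \<open>b = 1\<close> the only lower projection onto cases is the mean, which is
  zero; the leading term is \<open>m1 / n1\<close> times a sum of the independent variables
  \<open>kernel1 (x (Inr j))\<close>.\<close>

lemma char_nondegenerate:
  assumes m1: "m1 \<ge> 1"
    and n0: "filterlim n0 at_top sequentially" and n1: "filterlim n1 at_top sequentially"
    and ratio: "(\<lambda>k. real (n1 k) / real (n0 k)) \<longlonglongrightarrow> 0"
  shows "(\<lambda>k. \<integral>x. iexp (t * (sqrt (real (n1 k)) * U (n0 k) (n1 k) x)) \<partial>Q)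
    \<longlonglongrightarrow> complex_of_real (exp (- ((real m1)\<^sup>2 * xi F m0 m1 h 0 1 * t\<^sup>2) / 2))"
proof -
  interpret S: iid_seq F "PiM UNIV (\<lambda>_::nat. F)"
    unfolding iid_seq_def by (rule iid_space.intro) (rule prob_space_axioms)
  define W where "W n y = real m1 * (\<Sum>i<n. kernel1 (y i)) / sqrt (real n)" for n and y :: "nat \<Rightarrow> 'v"
  have [measurable]: "(\<lambda>y. y i) \<in> measurable (PiM UNIV (\<lambda>_::nat. F)) F" for i by measurable
  show ?thesis
  proof (rule char_U_tendsto[where W=W and b=1])
    show "W n \<in> borel_measurable (PiM UNIV (\<lambda>_. F))" for n unfolding W_def by measurable
    show "\<forall>\<^sub>F k in sequentially. \<forall>x\<in>space Q. sqrt (real (n1 k)) * (U (n0 k) (n1 k) x - rem 1 (n0 k) (n1 k) x) = W (n1 k) (\<lambda>i. x (Inr i))"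
      using filterlim_at_top[THEN iffD1, OF n0, rule_format, of m0]
        filterlim_at_top[THEN iffD1, OF n1, rule_format, of m1]
    proof eventually_elim
      case (elim k)
      show ?case
      proof
        fix x assume x: "x \<in> space Q"
        have "U (n0 k) (n1 k) x - rem 1 (n0 k) (n1 k) x =
          real (m1 choose 1) / real (n1 k choose 1) * (\<Sum>e\<in>{e. e \<subseteq> {..<n1 k} \<and> card e = 1}. kernel1 (x (Inr (Min e))))"
        proof (rule U_minus_rem[OF elim m1 x])
          fix I J e :: "nat set" assume IJ: "finite I" "card I = m0" "finite J" "card J = m1" and e: "e \<subseteq> J" "card e = 1"
          then obtain j where "e = {j}" "j \<in> J" by (auto simp: card_1_singleton_iff)
          then show "cexp (Inr ` e) (H I J) x = kernel1 (x (Inr (Min e)))"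
            using cexp_H_kernel1[OF IJ _ x] by simp
        qed
        also have "{e. e \<subseteq> {..<n1 k} \<and> card e = 1} = (\<lambda>j. {j}) ` {..<n1 k}"
          by (auto simp: card_1_singleton_iff)
        also have "(\<Sum>e\<in>(\<lambda>j. {j}) ` {..<n1 k}. kernel1 (x (Inr (Min e)))) = (\<Sum>j<n1 k. kernel1 (x (Inr j)))"
          by (subst sum.reindex) (auto simp: inj_on_def)
        finally have *: "U (n0 k) (n1 k) x - rem 1 (n0 k) (n1 k) x = real m1 / real (n1 k) * (\<Sum>j<n1 k. kernel1 (x (Inr j)))"
          by simp
        have "real (n1 k) = sqrt (real (n1 k)) * sqrt (real (n1 k))" by simp
        moreover have "sqrt (real (n1 k)) \<noteq> 0" using elim m1 by simp
        ultimately show "sqrt (real (n1 k)) * (U (n0 k) (n1 k) x - rem 1 (n0 k) (n1 k) x) = W (n1 k) (\<lambda>i. x (Inr i))"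
          unfolding * W_def by (simp add: field_simps)
      qed
    qed
    show "(\<lambda>k. (sqrt (real (n1 k)))\<^sup>2 * (\<integral>x. (rem 1 (n0 k) (n1 k) x)\<^sup>2 \<partial>Q)) \<longlonglongrightarrow> 0"
    proof -
      have "(\<lambda>k. real (n1 k) ^ 1 * (\<integral>x. (rem 1 (n0 k) (n1 k) x)\<^sup>2 \<partial>Q)) \<longlonglongrightarrow> 0"
      proof (rule rem_tendsto_general[OF _ n0 n1])
        fix c :: nat assume "c < 1"
        then have "c = 0" by simp
        then show "AE x in Q. cexp (base_set 0 c) H0 x = 0" using cexp_empty_H0 by simp
      qed (use ratio in simp)
      then show ?thesis by simp
    qed
    show "filterlim n1 at_top sequentially" by (rule n1)
    show "(\<lambda>n. \<integral>x. iexp (t * W n x) \<partial>PiM UNIV (\<lambda>_. F)) \<longlonglongrightarrow> complex_of_real (exp (- ((real m1)\<^sup>2 * xi F m0 m1 h 0 1 * t\<^sup>2) / 2))"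
    proof -
      let ?f = "\<lambda>u. (t * real m1) * kernel1 u"
      have fL: "in_L2 F ?f" by (intro in_L2_cmult kernel1_L2)
      have fm: "(\<integral>u. ?f u \<partial>F) = 0" by (simp add: kernel1_L2)
      have fv: "(\<integral>u. (?f u)\<^sup>2 \<partial>F) = (real m1)\<^sup>2 * xi F m0 m1 h 0 1 * t\<^sup>2"
        unfolding power_mult_distrib by (simp add: kernel1_L2)
      have "t * W n x = (\<Sum>i<n. ?f (x i)) / sqrt (real n)" for n x
        by (simp add: W_def sum_distrib_left[symmetric])
      then show ?thesis using S.clt_char[OF fL fm] unfolding fv by simp
    qed
  qed
qed

lemma char_degenerate:
  assumes m1: "m1 \<ge> 2" and xi01: "xi F m0 m1 h 0 1 = 0"
    and alt: "xi F m0 m1 h 1 0 = 0 \<or> (\<lambda>k. (real (n1 k))\<^sup>2 / real (n0 k)) \<longlonglongrightarrow> 0"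
    and n0: "filterlim n0 at_top sequentially" and n1: "filterlim n1 at_top sequentially"
    and ratio: "(\<lambda>k. real (n1 k) / real (n0 k)) \<longlonglongrightarrow> 0"
    and enum: "eigen_enum F kernel2 lam"
  shows "(\<lambda>k. \<integral>x. iexp (t * (real (n1 k) * U (n0 k) (n1 k) x)) \<partial>Q)
    \<longlonglongrightarrow> (\<integral>z. iexp (t * (real m1 * (real m1 - 1) / 2 * (\<Sum>j. lam j * ((z j)\<^sup>2 - 1)))) \<partial>std_gauss)"
proof -
  interpret S: iid_seq F "PiM UNIV (\<lambda>_::nat. F)"
    unfolding iid_seq_def by (rule iid_space.intro) (rule prob_space_axioms)
  define c where "c = real m1 * (real m1 - 1) / 2"
  define W where "W n y = c * (2 / (real n - 1) * pairU kernel2 n y)" for n and y :: "nat \<Rightarrow> 'v"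
  have k1: "AE u in F. kernel1 u = 0"
    using kernel1_L2(1) by (rule AE_zero_of_L2_norm_zero) (simp only: kernel1_L2 xi01)
  have deg: "AE u in F. (\<integral>y. kernel2 u y \<partial>F) = 0"
    using integral_kernel2 k1 by eventually_elim simp
  note pL = S.pairU_second_moment(1)[OF kernel2_L2 kernel2_sym[OF m1] deg]
  have zero: "AE x in Q. cexp (base_set 0 c) H0 x = 0" if "c < 2" for c
  proof -
    from that consider "c = 0" | "c = 1" by linarith
    then show ?thesis
    proof cases
      case 1 then show ?thesis using cexp_empty_H0 by simp
    next
      case 2
      show ?thesis unfolding 2 by (rule AE_cexp_zero_of_xi_zero[OF xi01])
    qed
  qed
  show ?thesis
  proof (rule char_U_tendsto[where W=W and b=2])
    show "W n \<in> borel_measurable (PiM UNIV (\<lambda>_. F))" for n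
      using pL[of n] unfolding W_def in_L2_def by auto
    show "\<forall>\<^sub>F k in sequentially. \<forall>x\<in>space Q. real (n1 k) * (U (n0 k) (n1 k) x - rem 2 (n0 k) (n1 k) x) = W (n1 k) (\<lambda>i. x (Inr i))"
      using filterlim_at_top[THEN iffD1, OF n0, rule_format, of m0]
        filterlim_at_top[THEN iffD1, OF n1, rule_format, of m1]
    proof eventually_elim
      case (elim k)
      show ?case
      proof
        fix x assume x: "x \<in> space Q"
        have "U (n0 k) (n1 k) x - rem 2 (n0 k) (n1 k) x =
          real (m1 choose 2) / real (n1 k choose 2) * (\<Sum>e\<in>{e. e \<subseteq> {..<n1 k} \<and> card e = 2}. kernel2 (x (Inr (Min e))) (x (Inr (Max e))))"
        proof (rule U_minus_rem[OF elim m1 x])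
          fix I J e :: "nat set" assume IJ: "finite I" "card I = m0" "finite J" "card J = m1" and e: "e \<subseteq> J" "card e = 2"
          from e(2) obtain i l where il: "i < l" "e = {i, l}" "Min e = i" "Max e = l" by (rule doubletonE)
          then show "cexp (Inr ` e) (H I J) x = kernel2 (x (Inr (Min e))) (x (Inr (Max e)))"
            using cexp_H_kernel2[OF IJ _ _ _ x, of i l] e by simp
        qed
        also have "\<dots> = real (m1 choose 2) / real (n1 k choose 2) * pairU kernel2 (n1 k) (\<lambda>i. x (Inr i))"
          by (simp add: pairU_def)
        finally have *: "U (n0 k) (n1 k) x - rem 2 (n0 k) (n1 k) x =
          real (m1 choose 2) / real (n1 k choose 2) * pairU kernel2 (n1 k) (\<lambda>i. x (Inr i))" .
        have choose2: "real (n choose 2) = real n * (real n - 1) / 2" if "n \<ge> 2" for n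
          using that by (simp add: choose_two real_of_nat_div of_nat_diff)
        have alg: "n * (c / (n * y / 2) * p) = c * (2 / y * p)" if "n \<noteq> 0" for n y p :: real
          using that by (cases "y = 0") (simp_all add: field_simps)
        show "real (n1 k) * (U (n0 k) (n1 k) x - rem 2 (n0 k) (n1 k) x) = W (n1 k) (\<lambda>i. x (Inr i))"
          unfolding * W_def choose2[OF m1] c_def[symmetric] choose2[OF order_trans[OF m1 elim(2)]]
          by (rule alg) (use elim m1 in simp)
      qed
    qed
    \<comment> \<open>The two alternatives of the hypothesis correspond to the two variance bounds:
      the first needs only n1/n0 to vanish, the second uses the faster rate.\<close>
    have "(\<lambda>k. real (n1 k) ^ 2 * (\<integral>x. (rem 2 (n0 k) (n1 k) x)\<^sup>2 \<partial>Q)) \<longlonglongrightarrow> 0"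
      using alt
    proof
      assume "xi F m0 m1 h 1 0 = 0"
      from AE_cexp_zero_of_xi_zero[OF this] show ?thesis
        by (intro rem_tendsto_degenerate zero n0 n1 ratio)
    qed (intro rem_tendsto_general zero n0 n1)
    then show "(\<lambda>k. (real (n1 k))\<^sup>2 * (\<integral>x. (rem 2 (n0 k) (n1 k) x)\<^sup>2 \<partial>Q)) \<longlonglongrightarrow> 0" .
    show "filterlim n1 at_top sequentially" by (rule n1)
    show "(\<lambda>n. \<integral>x. iexp (t * W n x) \<partial>PiM UNIV (\<lambda>_. F)) \<longlonglongrightarrow>
      (\<integral>z. iexp (t * (real m1 * (real m1 - 1) / 2 * (\<Sum>j. lam j * ((z j)\<^sup>2 - 1)))) \<partial>std_gauss)"
      using S.degenerate_pair_char_conv[OF kernel2_sym[OF m1] kernel2_L2 deg enum, of "t * c"]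
      unfolding W_def c_def[symmetric] by (simp only: mult.assoc)
  qed
qed

text \<open>A second case index is not an argument of \<open>h\<close> then, so fixing it adds
  nothing. This rules out \<open>m1 = 1\<close> under the assumptions of the degenerate
  part.\<close>

lemma xi02_eq_xi01_if_m1_le_1:
  assumes "m1 \<le> 1"
  shows "xi F m0 m1 h 0 2 = xi F m0 m1 h 0 1"
proof -
  have "cexp (base_set 0 2) H0 = cexp (base_set 0 1) H0"
    by (rule cexp_cong_depends[OF H0_depends]) (use assms in auto)
  then show ?thesis unfolding xi_eq by (simp only:)
qed

end

section \<open>Return to the given probability spaces\<close>

lemma density_normal_eq_distr:
  assumes "\<sigma> > 0"
  shows "density lborel (normal_density 0 \<sigma>) = distr std_normal_distribution borel (\<lambda>x. \<sigma> * x)"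
proof -
  have "distributed std_normal_distribution lborel (\<lambda>x. x) std_normal_density"
    by (auto simp: distributed_def distr_id2 intro!: distr_id2)
  from prob_space.normal_density_affine[OF prob_space_std_normal this zero_less_one, of \<sigma> 0] assms
  have "distributed std_normal_distribution lborel (\<lambda>x. 0 + \<sigma> * x) (normal_density (0 + \<sigma> * 0) (\<bar>\<sigma>\<bar> * 1))" by simp
  from distributed_distr_eq_density[OF this] assms show ?thesis
    by (simp cong: distr_cong)
qed

text \<open>Used for the pooled observations and for the normal variables in the limit: both limit
  statements then concern canonical coordinates. The product over \<open>borel\<close> and the one
  over \<open>F\<close> have the same measurable sets.\<close>

lemma distr_iid_process:
  assumes "prob_space M" "prob_space.indep_vars M (\<lambda>_. borel) X UNIV" "\<And>i. distr M borel (X i) = F"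
    "\<And>i. X i \<in> borel_measurable M"
  shows "distr M (PiM UNIV (\<lambda>_. F)) (\<lambda>\<omega> i. X i \<omega>) = PiM UNIV (\<lambda>_. F)"
proof -
  interpret prob_space M by fact
  have sF: "sets F = sets borel" by (simp add: assms(3)[of undefined, symmetric])
  have "distr M (PiM UNIV (\<lambda>_. borel)) (\<lambda>\<omega>. \<lambda>i\<in>UNIV. X i \<omega>) = PiM UNIV (\<lambda>i. distr M borel (X i))"
    using assms by (subst indep_vars_iff_distr_eq_PiM[symmetric]) auto
  then have "distr M (PiM UNIV (\<lambda>_. borel)) (\<lambda>\<omega> i. X i \<omega>) = PiM UNIV (\<lambda>_. F)"
    by (simp add: assms(3) restrict_UNIV)
  moreover have "distr M (PiM UNIV (\<lambda>_. borel)) (\<lambda>\<omega> i. X i \<omega>) = distr M (PiM UNIV (\<lambda>_. F)) (\<lambda>\<omega> i. X i \<omega>)"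
    by (intro distr_cong refl sets_PiM_cong) (simp_all add: sF)
  ultimately show ?thesis by simp
qed

theorem theorem1:
  fixes M :: "'a measure" and F :: "(real ^ 'p) measure"
    and X0 X1 :: "nat \<Rightarrow> 'a \<Rightarrow> real ^ 'p"
    and h :: "(nat \<Rightarrow> real ^ 'p) \<Rightarrow> (nat \<Rightarrow> real ^ 'p) \<Rightarrow> real"
    and m0 m1 :: nat and n0 n1 :: "nat \<Rightarrow> nat"
  assumes M: "prob_space M"
    and indep: "prob_space.indep_vars M (\<lambda>_. borel)
                  (\<lambda>s. case s of Inl i \<Rightarrow> X0 i | Inr j \<Rightarrow> X1 j) UNIV"
    and null0: "\<And>i. distr M borel (X0 i) = F"
    and null1: "\<And>j. distr M borel (X1 j) = F"
    and m0: "m0 \<ge> 1" and m1: "m1 \<ge> 1"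
    and h_local: "\<And>x x' y y'. (\<forall>i<m0. x i = x' i) \<Longrightarrow> (\<forall>j<m1. y j = y' j) \<Longrightarrow> h x y = h x' y'"
    and h_sym0: "\<And>\<pi> x y. \<pi> permutes {..<m0} \<Longrightarrow> h (x \<circ> \<pi>) y = h x y"
    and h_sym1: "\<And>\<pi> x y. \<pi> permutes {..<m1} \<Longrightarrow> h x (y \<circ> \<pi>) = h x y"
    and h_meas: "(\<lambda>w. h (fst w) (snd w)) \<in>
                   borel_measurable (PiM {..<m0} (\<lambda>_. borel) \<Otimes>\<^sub>M PiM {..<m1} (\<lambda>_. borel))"
    and h_L2: "integrable (PiM {..<m0} (\<lambda>_. F) \<Otimes>\<^sub>M PiM {..<m1} (\<lambda>_. F))
                 (\<lambda>w. (h (fst w) (snd w))\<^sup>2)"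
    and h_mean: "(\<integral>w. h (fst w) (snd w) \<partial>(PiM {..<m0} (\<lambda>_. F) \<Otimes>\<^sub>M PiM {..<m1} (\<lambda>_. F))) = 0"
    and n1_lim: "filterlim n1 at_top sequentially"
    and ratio: "(\<lambda>k. real (n1 k) / real (n0 k + n1 k)) \<longlonglongrightarrow> 0"
  shows
   "(xi F m0 m1 h 0 1 > 0 \<longrightarrow>
       weak_conv_m
         (\<lambda>k. distr M borel (\<lambda>\<omega>. sqrt (real (n1 k)) * ustat m0 m1 h (n0 k) (n1 k) (\<lambda>i. X0 i \<omega>) (\<lambda>j. X1 j \<omega>)))
         (density lborel (normal_density 0 (real m1 * sqrt (xi F m0 m1 h 0 1)))))
    \<and>
    (xi F m0 m1 h 0 1 = 0 \<and> xi F m0 m1 h 0 2 > 0 \<and>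
     (xi F m0 m1 h 1 0 = 0 \<or> ((\<lambda>k. (real (n1 k))\<^sup>2 / real (n0 k)) \<longlonglongrightarrow> 0)) \<longrightarrow>
       (\<forall>lam (N :: 'b measure) (Z :: nat \<Rightarrow> 'b \<Rightarrow> real).
          eigen_enum F (\<lambda>x y. proj F m0 m1 h 0 2 (\<lambda>_. undefined) (\<lambda>j. if j = 0 then x else y)) lam \<and>
          prob_space N \<and> prob_space.indep_vars N (\<lambda>_. borel) Z UNIV \<and>
          (\<forall>j. distr N borel (Z j) = density lborel std_normal_density) \<longrightarrow>
          weak_conv_m
            (\<lambda>k. distr M borel (\<lambda>\<omega>. real (n1 k) * ustat m0 m1 h (n0 k) (n1 k) (\<lambda>i. X0 i \<omega>) (\<lambda>j. X1 j \<omega>)))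
            (distr N borel (\<lambda>\<omega>. real m1 * (real m1 - 1) / 2 *
                (\<Sum>j. lam j * ((Z j \<omega>)\<^sup>2 - 1))))))"
proof -
  interpret M: prob_space M by fact
  let ?X = "\<lambda>s. case s of Inl i \<Rightarrow> X0 i | Inr j \<Rightarrow> X1 j"
  have Xm: "?X s \<in> borel_measurable M" for s
    using indep unfolding M.indep_vars_def2 by simp
  have [measurable]: "X0 i \<in> borel_measurable M" "X1 j \<in> borel_measurable M" for i j
    using Xm[of "Inl i"] Xm[of "Inr j"] by simp_all
  have XF: "distr M borel (?X s) = F" for s using null0 null1 by (cases s) auto
  have sF: "sets F = sets borel" by (simp add: null0[of 0, symmetric])
  have pF: "prob_space F" unfolding null0[of 0, symmetric] by (rule M.prob_space_distr) simp
  have sP: "sets (PiM {..<m} (\<lambda>_. F)) = sets (PiM {..<m} (\<lambda>_. borel))" for m :: nat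
    by (intro sets_PiM_cong) (simp_all add: sF)
  interpret T: two_sample F "PiM UNIV (\<lambda>_. F)" m0 m1 h
  proof (intro two_sample.intro iid_space.intro two_sample_axioms.intro pF h_sym0 h_sym1 h_L2 h_mean)
    show "(\<lambda>w. h (fst w) (snd w)) \<in> borel_measurable (PiM {..<m0} (\<lambda>_. F) \<Otimes>\<^sub>M PiM {..<m1} (\<lambda>_. F))"
      using h_meas by (subst measurable_cong_sets[OF sets_pair_measure_cong[OF sP sP] refl])
    show "h x y = h x' y'" if "\<forall>i<m0. x i = x' i" "\<forall>j<m1. y j = y' j" for x x' y y'
      using h_local[OF that] .
  qed
  let ?Q = "PiM UNIV (\<lambda>_. F) :: (nat + nat \<Rightarrow> real ^ 'p) measure"
  have dQ: "distr M ?Q (\<lambda>\<omega> s. ?X s \<omega>) = ?Q"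
    by (rule distr_iid_process[OF M indep XF Xm])
  have mX: "(\<lambda>\<omega> s. ?X s \<omega>) \<in> measurable M ?Q"
    by (rule measurable_PiM_single') (use Xm sF in \<open>auto simp: sets_eq_imp_space_eq[OF sF] cong: measurable_cong_sets\<close>)
  have UL: "(\<lambda>x. a * T.U N0 N1 x) \<in> borel_measurable ?Q" for a N0 N1
    using T.U_L2[of N0 N1] by (auto simp: in_L2_def)
  have transfer: "distr M borel (\<lambda>\<omega>. a * ustat m0 m1 h N0 N1 (\<lambda>i. X0 i \<omega>) (\<lambda>j. X1 j \<omega>)) =
    distr ?Q borel (\<lambda>x. a * T.U N0 N1 x)" for a N0 N1
  proof -
    have "distr ?Q borel (\<lambda>x. a * T.U N0 N1 x) = distr (distr M ?Q (\<lambda>\<omega> s. ?X s \<omega>)) borel (\<lambda>x. a * T.U N0 N1 x)"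
      by (simp only: dQ)
    also have "\<dots> = distr M borel (\<lambda>\<omega>. a * ustat m0 m1 h N0 N1 (\<lambda>i. X0 i \<omega>) (\<lambda>j. X1 j \<omega>))"
      by (subst distr_distr[OF UL mX]) (simp add: comp_def T.U_def)
    finally show ?thesis by simp
  qed
  have char_U: "char (distr ?Q borel (\<lambda>x. a * T.U N0 N1 x)) t = (\<integral>x. iexp (t * (a * T.U N0 N1 x)) \<partial>?Q)" for a N0 N1 t
    unfolding char_def by (rule integral_distr[OF UL]) simp
  have rd: "real_distribution (distr ?Q borel (\<lambda>x. a * T.U N0 N1 x))" for a N0 N1
    by (intro prob_space.real_distribution_distr prob_space_PiM pF UL)
  have r: "(\<lambda>k. real (n1 k) / real (n0 k)) \<longlonglongrightarrow> 0" and n0_lim: "filterlim n0 at_top sequentially"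
  proof -
    \<comment> \<open>A ratio below 1/2 means n1 < n0, so n0 + n1 is at most 2 n0. This turns n1/n
      into n1/n0 at the cost of a factor 2 and makes n0 diverge along with n1.\<close>
    have ev: "\<forall>\<^sub>F k in sequentially. real (n1 k) / real (n0 k + n1 k) < 1/2 \<and> n1 k \<ge> 1"
      using order_tendstoD(2)[OF ratio, of "1/2"] filterlim_at_top[THEN iffD1, OF n1_lim, rule_format, of 1]
      by (simp add: eventually_conj_iff)
    have bd: "real (n1 k) / real (n0 k) \<le> 2 * (real (n1 k) / real (n0 k + n1 k)) \<and> n1 k \<le> n0 k"
      if "real (n1 k) / real (n0 k + n1 k) < 1/2 \<and> n1 k \<ge> 1" for k
    proof -
      have pos: "real (n0 k + n1 k) > 0" using that by simp
      with that have "n1 k < n0 k" by (simp add: divide_less_eq)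
      moreover from this have "real (n1 k) * real (n0 k + n1 k) \<le> real (n1 k) * (2 * real (n0 k))"
        by (intro mult_left_mono) auto
      ultimately show ?thesis using pos by (simp add: field_simps)
    qed
    show "(\<lambda>k. real (n1 k) / real (n0 k)) \<longlonglongrightarrow> 0"
    proof (rule tendsto_sandwich)
      show "\<forall>\<^sub>F k in sequentially. 0 \<le> real (n1 k) / real (n0 k)" by simp
      show "\<forall>\<^sub>F k in sequentially. real (n1 k) / real (n0 k) \<le> 2 * (real (n1 k) / real (n0 k + n1 k))"
        using ev by eventually_elim (use bd in blast)
      show "(\<lambda>k. 2 * (real (n1 k) / real (n0 k + n1 k))) \<longlonglongrightarrow> 0"
        using tendsto_mult_right_zero[OF ratio] .
    qed simp
    show "filterlim n0 at_top sequentially"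
      by (rule filterlim_at_top_mono[OF n1_lim]) (use ev bd in \<open>auto elim!: eventually_mono\<close>)
  qed
  show ?thesis
  proof (intro conjI impI allI)
    assume pos: "xi F m0 m1 h 0 1 > 0"
    define \<sigma> where "\<sigma> = real m1 * sqrt (xi F m0 m1 h 0 1)"
    have \<sigma>: "\<sigma> > 0" using pos m1 by (simp add: \<sigma>_def)
    show "weak_conv_m
         (\<lambda>k. distr M borel (\<lambda>\<omega>. sqrt (real (n1 k)) * ustat m0 m1 h (n0 k) (n1 k) (\<lambda>i. X0 i \<omega>) (\<lambda>j. X1 j \<omega>)))
         (density lborel (normal_density 0 (real m1 * sqrt (xi F m0 m1 h 0 1))))"
      unfolding transfer \<sigma>_def[symmetric] density_normal_eq_distr[OF \<sigma>]
    proof (rule levy_continuity[OF rd])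
      show "real_distribution (distr std_normal_distribution borel ((*) \<sigma>))"
        by (intro prob_space.real_distribution_distr prob_space_std_normal) simp
      fix t
      have "char (distr std_normal_distribution borel ((*) \<sigma>)) t = char std_normal_distribution (t * \<sigma>)"
        unfolding char_def by (subst integral_distr) (auto simp: mult.assoc)
      also have "\<dots> = complex_of_real (exp (- ((real m1)\<^sup>2 * xi F m0 m1 h 0 1 * t\<^sup>2) / 2))"
        using pos by (simp add: char_std_normal_distribution \<sigma>_def power_mult_distrib mult_ac)
      finally show "(\<lambda>k. char (distr ?Q borel (\<lambda>x. sqrt (real (n1 k)) * T.U (n0 k) (n1 k) x)) t)
          \<longlonglongrightarrow> char (distr std_normal_distribution borel ((*) \<sigma>)) t"
        unfolding char_U using T.char_nondegenerate[OF m1 n0_lim n1_lim r, of t] by (simp only:)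
    qed
  next
    fix lam :: "nat \<Rightarrow> real" and N :: "'b measure" and Z :: "nat \<Rightarrow> 'b \<Rightarrow> real"
    assume A: "xi F m0 m1 h 0 1 = 0 \<and> xi F m0 m1 h 0 2 > 0 \<and>
       (xi F m0 m1 h 1 0 = 0 \<or> ((\<lambda>k. (real (n1 k))\<^sup>2 / real (n0 k)) \<longlonglongrightarrow> 0))"
    assume B: "eigen_enum F (\<lambda>x y. proj F m0 m1 h 0 2 (\<lambda>_. undefined) (\<lambda>j. if j = 0 then x else y)) lam \<and>
          prob_space N \<and> prob_space.indep_vars N (\<lambda>_. borel) Z UNIV \<and>
          (\<forall>j. distr N borel (Z j) = density lborel std_normal_density)"
    from A have xi01: "xi F m0 m1 h 0 1 = 0"
      and alt: "xi F m0 m1 h 1 0 = 0 \<or> ((\<lambda>k. (real (n1 k))\<^sup>2 / real (n0 k)) \<longlonglongrightarrow> 0)" by blast+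
    have m2: "m1 \<ge> 2"
    proof (rule ccontr)
      assume "\<not> m1 \<ge> 2"
      then have "m1 \<le> 1" by simp
      from T.xi02_eq_xi01_if_m1_le_1[OF this] A show False by auto
    qed
    have enum: "eigen_enum F T.kernel2 lam" using B by (simp add: T.kernel2_def[abs_def])
    interpret N: prob_space N using B by simp
    have Zm: "Z j \<in> borel_measurable N" for j using B unfolding N.indep_vars_def2 by simp
    have dZ: "distr N std_gauss (\<lambda>\<omega> j. Z j \<omega>) = std_gauss"
      using B Zm by (intro distr_iid_process) (auto intro: N.prob_space_axioms)
    have mZ: "(\<lambda>\<omega> j. Z j \<omega>) \<in> measurable N std_gauss"
      by (rule measurable_PiM_single') (use Zm in auto)
    let ?V = "\<lambda>z. real m1 * (real m1 - 1) / 2 * (\<Sum>j. lam j * ((z j)\<^sup>2 - 1))"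
    have mV: "?V \<in> borel_measurable std_gauss" by measurable
    \<comment> \<open>The limit law depends only on the joint law of the \<open>Z j\<close>, so the
      arbitrary space \<open>N\<close> can be replaced by \<open>std_gauss\<close>.\<close>
    have lim_eq: "distr N borel (\<lambda>\<omega>. ?V (\<lambda>j. Z j \<omega>)) = distr std_gauss borel ?V"
    proof -
      have "distr std_gauss borel ?V = distr (distr N std_gauss (\<lambda>\<omega> j. Z j \<omega>)) borel ?V" by (simp only: dZ)
      also have "\<dots> = distr N borel (\<lambda>\<omega>. ?V (\<lambda>j. Z j \<omega>))"
        by (subst distr_distr[OF mV mZ]) (simp add: comp_def)
      finally show ?thesis by simp
    qed
    show "weak_conv_m
            (\<lambda>k. distr M borel (\<lambda>\<omega>. real (n1 k) * ustat m0 m1 h (n0 k) (n1 k) (\<lambda>i. X0 i \<omega>) (\<lambda>j. X1 j \<omega>)))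
            (distr N borel (\<lambda>\<omega>. real m1 * (real m1 - 1) / 2 * (\<Sum>j. lam j * ((Z j \<omega>)\<^sup>2 - 1))))"
      unfolding transfer lim_eq
    proof (rule levy_continuity[OF rd])
      show "real_distribution (distr std_gauss borel ?V)"
        by (intro prob_space.real_distribution_distr prob_space_PiM prob_space_std_normal mV)
      fix t
      have "char (distr std_gauss borel ?V) t = (\<integral>z. iexp (t * ?V z) \<partial>std_gauss)"
        unfolding char_def by (rule integral_distr[OF mV]) simp
      then show "(\<lambda>k. char (distr ?Q borel (\<lambda>x. real (n1 k) * T.U (n0 k) (n1 k) x)) t)
          \<longlonglongrightarrow> char (distr std_gauss borel ?V) t"
        unfolding char_U using T.char_degenerate[OF m2 xi01 alt n0_lim n1_lim r enum, of t] by (simp only:)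
    qed
  qed
qed

end
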